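(* For $d\ge0$ let $$c(d)=\inf_{\gamma\in\Gamma}\ \max_{u\in\gamma([-1,1])}\mathcal{J}_d(u),\qquad \Gamma=\{\gamma\in C([-1,1],S):\gamma(-1)=-\phi_1,\ \gamma(1)=\phi_1\}.$$ Then $\displaystyle\lim_{d\to\infty}c(d)=\lambda_1(\Omega)$.
   Context: Let $N$ be a positive integer, $0<s<1<p<N$, $\theta\in[s,1]$, and let $\Omega\subset\mathbb{R}^N$ be a bounded domain. $W_0^{1,p}(\Omega)$ is the closure of $C_c^\infty(\Omega)$ with respect to $\left(\int_\Omega|\nabla u|^p\right)^{1/p}$, and $X(\Omega)=\{u\in W^{1,p}(\mathbb{R}^N): u|_\Omega\in W_0^{1,p}(\Omega),\ u=0 \text{ a.e. in } \mathbb{R}^N\setminus\Omega\}$, with norm $\|u\|=\left(\int_\Omega|\nabla u|^p+[u]_{s,p}^p\right)^{1/p}$, $[u]_{s,p}^p=\int_{\mathbb{R}^N}\int_{\mathbb{R}^N}\frac{|u(x)-u(y)|^p}{|x-y|^{N+ps}}\,dx\,dy$. Constants: $C_H=\left(\frac{N-p}{p}\right)^p$; $C_{N,p,s}=2\int_0^1 r^{ps-1}|1-r^{(N-ps)/p}|^p\Psi_{N,s,p}(r)\,dr$ with $\Psi_{N,s,p}(r)=|\mathbb{S}^{N-2}|\int_{-1}^1\frac{(1-t^2)^{(N-3)/2}}{(1-2rt+r^2)^{(N+ps)/2}}\,dt$ ($N\ge2$). Set $\mu_0(\theta)=C_{N,p,s}$ if $\theta=s$; $\mu_0(\theta)=\min\left\{\frac{C_H(1-s)}{\theta-s},\frac{C_{N,p,s}(1-s)}{1-\theta}\right\}$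 if $\theta\in(s,1)$; $\mu_0(\theta)=C_H$ if $\theta=1$. Fix $\mu\in(0,\mu_0(\theta))$. For $d\ge0$, $\mathcal{J}_d(u)=\int_\Omega|\nabla u|^p+[u]_{s,p}^p-\mu\int_\Omega\frac{|u|^p}{|x|^{p\theta}}-d\int_\Omega(u^+)^p$ on $X(\Omega)$, where $u^+=\max\{u,0\}$; $S=\{u\in X(\Omega):\int_\Omega|u|^p=1\}$ with the topology of $X(\Omega)$; $\lambda_1(\Omega)=\inf_{S}\mathcal{J}_0$; and $\phi_1\in S$ is the (unique) positive function with $\mathcal{J}_0(\phi_1)=\lambda_1(\Omega)$. *)

theory Defs
  imports "HOL-Analysis.Analysis"
begin

text \<open>
  The ambient space of dimension \<open>N = DIM('a)\<close> is a type \<open>'a :: euclidean_space\<close>.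
  Elements of Lebesgue and Sobolev spaces are represented by functions (not by classes modulo
  equality a.e.), measurable with respect to the Borel sets; every class of Lebesgue measurable
  functions has such a representative. All functionals below respect equality a.e.
\<close>

section \<open>Lebesgue spaces\<close>

definition Lp_space :: "real \<Rightarrow> 'a::euclidean_space set \<Rightarrow> ('a \<Rightarrow> 'b::euclidean_space) set" where
  "Lp_space p U =
     {f. set_borel_measurable lborel U f \<and> set_integrable lborel U (\<lambda>x. norm (f x) powr p)}"

definition Lp_norm :: "real \<Rightarrow> 'a::euclidean_space set \<Rightarrow> ('a \<Rightarrow> 'b::euclidean_space) \<Rightarrow> real" where
  "Lp_norm p U f = (LINT x:U|lborel. norm (f x) powr p) powr (1 / p)"

definition locally_integrable :: "'a::euclidean_space set \<Rightarrow> ('a \<Rightarrow> 'b::euclidean_space) \<Rightarrow> bool" where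
  "locally_integrable U f \<longleftrightarrow> (\<forall>K. compact K \<and> K \<subseteq> U \<longrightarrow> set_integrable lborel K f)"

section \<open>Test functions and Sobolev spaces\<close>

definition grad :: "('a::euclidean_space \<Rightarrow> real) \<Rightarrow> 'a \<Rightarrow> 'a" where
  "grad f x = (\<Sum>i\<in>Basis. frechet_derivative f (at x) i *\<^sub>R i)"

primrec continuously_differentiable :: "nat \<Rightarrow> ('a::euclidean_space \<Rightarrow> real) \<Rightarrow> bool" where
  "continuously_differentiable 0 f \<longleftrightarrow> continuous_on UNIV f"
| "continuously_differentiable (Suc k) f \<longleftrightarrow>
     (\<forall>x. f differentiable (at x)) \<and>
     (\<forall>i\<in>Basis. continuously_differentiable k (\<lambda>x. grad f x \<bullet> i))"

definition test_functions :: "'a::euclidean_space set \<Rightarrow> ('a \<Rightarrow> real) set" where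
  "test_functions U =
     {f. (\<forall>k. continuously_differentiable k f) \<and>
         compact (closure {x. f x \<noteq> 0}) \<and> closure {x. f x \<noteq> 0} \<subseteq> U}"

definition has_weak_grad ::
  "'a::euclidean_space set \<Rightarrow> ('a \<Rightarrow> real) \<Rightarrow> ('a \<Rightarrow> 'a) \<Rightarrow> bool" where
  "has_weak_grad U u G \<longleftrightarrow>
     locally_integrable U u \<and> locally_integrable U G \<and>
     (\<forall>f\<in>test_functions U. \<forall>i\<in>Basis.
        (LINT x:U|lborel. u x * (grad f x \<bullet> i)) = - (LINT x:U|lborel. (G x \<bullet> i) * f x))"

text \<open>The weak gradient is unique up to equality a.e., so the choice below is harmless.\<close>

definition weak_grad :: "'a::euclidean_space set \<Rightarrow> ('a \<Rightarrow> real) \<Rightarrow> 'a \<Rightarrow> 'a" where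
  "weak_grad U u = (SOME G. has_weak_grad U u G)"

definition W1p :: "real \<Rightarrow> 'a::euclidean_space set \<Rightarrow> ('a \<Rightarrow> real) set" where
  "W1p p U = {u \<in> Lp_space p U. \<exists>G\<in>Lp_space p U. has_weak_grad U u G}"

text \<open>
  The closure of the test functions with respect to the norm \<open>\<parallel>\<nabla>u\<parallel>\<^sub>p\<close>: limits of sequences
  that are Cauchy in this norm. The limit function is identified through convergence in
  \<open>L\<^sup>p\<close>, which on a bounded set is automatic by the Poincare inequality. (Convergence of the
  gradients alone would not determine the limit: it would admit constant functions.)
\<close>

definition W1p_zero :: "real \<Rightarrow> 'a::euclidean_space set \<Rightarrow> ('a \<Rightarrow> real) set" where
  "W1p_zero p U =
     {u \<in> Lp_space p U. \<exists>f :: nat \<Rightarrow> 'a \<Rightarrow> real.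
        (\<forall>n. f n \<in> test_functions U) \<and>
        (\<forall>e>0. \<exists>M. \<forall>m\<ge>M. \<forall>n\<ge>M. Lp_norm p U (\<lambda>x. grad (f m) x - grad (f n) x) < e) \<and>
        (\<lambda>n. Lp_norm p U (\<lambda>x. f n x - u x)) \<longlonglongrightarrow> 0}"

section \<open>The space $X(\Omega)$\<close>

text \<open>
  On \<open>W1p p UNIV\<close> with \<open>0 < s < 1 < p\<close> the double integral is finite, so the Bochner integral
  does not fall back to its default value.
\<close>

definition gagliardo :: "real \<Rightarrow> real \<Rightarrow> ('a::euclidean_space \<Rightarrow> real) \<Rightarrow> real" where
  "gagliardo p s u =
     (LINT x|lborel. (LINT y|lborel.
        \<bar>u x - u y\<bar> powr p / norm (x - y) powr (real DIM('a) + p * s)))"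

definition X_space :: "real \<Rightarrow> 'a::euclidean_space set \<Rightarrow> ('a \<Rightarrow> real) set" where
  "X_space p \<Omega> =
     {u \<in> W1p p UNIV. u \<in> W1p_zero p \<Omega> \<and> (AE x in lborel. x \<notin> \<Omega> \<longrightarrow> u x = 0)}"

definition grad_energy :: "real \<Rightarrow> 'a::euclidean_space set \<Rightarrow> ('a \<Rightarrow> real) \<Rightarrow> real" where
  "grad_energy p \<Omega> u = (LINT x:\<Omega>|lborel. norm (weak_grad \<Omega> u x) powr p)"

definition X_norm :: "real \<Rightarrow> real \<Rightarrow> 'a::euclidean_space set \<Rightarrow> ('a \<Rightarrow> real) \<Rightarrow> real" where
  "X_norm p s \<Omega> u = (grad_energy p \<Omega> u + gagliardo p s u) powr (1 / p)"

text \<open>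
  As elements are functions rather than classes, \<open>X_norm\<close> is only a seminorm; the topology is
  the preimage of the norm topology under the quotient map.
\<close>

definition X_topology :: "real \<Rightarrow> real \<Rightarrow> 'a::euclidean_space set \<Rightarrow> ('a \<Rightarrow> real) topology" where
  "X_topology p s \<Omega> = topology (\<lambda>V. V \<subseteq> X_space p \<Omega> \<and>
     (\<forall>u\<in>V. \<exists>r>0. \<forall>v\<in>X_space p \<Omega>. X_norm p s \<Omega> (\<lambda>x. v x - u x) < r \<longrightarrow> v \<in> V))"

lemma openin_X_topology:
  "openin (X_topology p s \<Omega>) V \<longleftrightarrow> V \<subseteq> X_space p \<Omega> \<and>
     (\<forall>u\<in>V. \<exists>r>0. \<forall>v\<in>X_space p \<Omega>. X_norm p s \<Omega> (\<lambda>x. v x - u x) < r \<longrightarrow> v \<in> V)"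
proof -
  define near where "near r u v \<longleftrightarrow> X_norm p s \<Omega> (\<lambda>x. v x - u x) < r" for r u v
  define P where "P V \<longleftrightarrow> V \<subseteq> X_space p \<Omega> \<and>
     (\<forall>u\<in>V. \<exists>r>0. \<forall>v\<in>X_space p \<Omega>. near r u v \<longrightarrow> v \<in> V)" for V
  have near_mono: "near r' u v" if "near r u v" "r \<le> r'" for r r' u v
    using that unfolding near_def by linarith
  have "istopology P"
    unfolding istopology_def
  proof (intro conjI allI impI)
    fix A B assume A: "P A" and B: "P B"
    have "\<exists>r>0. \<forall>v\<in>X_space p \<Omega>. near r u v \<longrightarrow> v \<in> A \<inter> B" if u: "u \<in> A \<inter> B" for u
    proof -
      obtain r1 where r1: "r1 > 0" "\<forall>v\<in>X_space p \<Omega>. near r1 u v \<longrightarrow> v \<in> A"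
        using A u unfolding P_def by auto
      obtain r2 where r2: "r2 > 0" "\<forall>v\<in>X_space p \<Omega>. near r2 u v \<longrightarrow> v \<in> B"
        using B u unfolding P_def by auto
      have "\<forall>v\<in>X_space p \<Omega>. near (min r1 r2) u v \<longrightarrow> v \<in> A \<inter> B"
        using r1(2) r2(2) near_mono[of "min r1 r2" u _ r1] near_mono[of "min r1 r2" u _ r2]
        by auto
      then show ?thesis
        using r1(1) r2(1) by (intro exI[of _ "min r1 r2"]) simp
    qed
    moreover have "A \<inter> B \<subseteq> X_space p \<Omega>"
      using A unfolding P_def by auto
    ultimately show "P (A \<inter> B)"
      unfolding P_def by blast
  next
    fix K assume K: "\<forall>k\<in>K. P k"
    have "\<exists>r>0. \<forall>v\<in>X_space p \<Omega>. near r u v \<longrightarrow> v \<in> \<Union>K" if u: "u \<in> \<Union>K" for u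
    proof -
      obtain k where k: "k \<in> K" "u \<in> k" using u by auto
      then have "P k" using K by auto
      with k(2) obtain r where "r > 0" "\<forall>v\<in>X_space p \<Omega>. near r u v \<longrightarrow> v \<in> k"
        unfolding P_def by auto
      with k(1) show ?thesis by (intro exI[of _ r]) auto
    qed
    moreover have "\<Union>K \<subseteq> X_space p \<Omega>"
      using K unfolding P_def by auto
    ultimately show "P (\<Union>K)"
      unfolding P_def by blast
  qed
  then have "openin (topology P) = P"
    by (rule topology_inverse')
  moreover have "X_topology p s \<Omega> = topology P"
    unfolding X_topology_def P_def near_def ..
  ultimately have "openin (X_topology p s \<Omega>) V \<longleftrightarrow> P V"
    by simp
  then show ?thesis
    unfolding P_def near_def .
qed

lemma topspace_X_topology [simp]: "topspace (X_topology p s \<Omega>) = X_space p \<Omega>"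
proof -
  have "openin (X_topology p s \<Omega>) (X_space p \<Omega>)"
    unfolding openin_X_topology by (auto intro: exI[of _ "1::real"])
  moreover have "topspace (X_topology p s \<Omega>) \<subseteq> X_space p \<Omega>"
    using openin_topspace[of "X_topology p s \<Omega>"] unfolding openin_X_topology by blast
  ultimately show ?thesis
    using openin_subset by blast
qed

section \<open>Hardy constants\<close>

definition C_H :: "nat \<Rightarrow> real \<Rightarrow> real" where
  "C_H N p = ((real N - p) / p) powr p"

text \<open>
  The surface area of the unit sphere of dimension \<open>k - 1\<close> is \<open>k\<close> times the volume of the unit
  ball of dimension \<open>k\<close>; here \<open>k = N - 1\<close>.
\<close>

definition Psi :: "nat \<Rightarrow> real \<Rightarrow> real \<Rightarrow> real \<Rightarrow> real" where
  "Psi N s p r = (real (N - 1) * unit_ball_vol (real (N - 1))) *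
     (LINT t:{-1..1}|lborel.
        (1 - t\<^sup>2) powr ((real N - 3) / 2) / (1 - 2 * r * t + r\<^sup>2) powr ((real N + p * s) / 2))"

definition C_Nps :: "nat \<Rightarrow> real \<Rightarrow> real \<Rightarrow> real" where
  "C_Nps N p s = 2 * (LINT r:{0..1}|lborel.
     r powr (p * s - 1) * \<bar>1 - r powr ((real N - p * s) / p)\<bar> powr p * Psi N s p r)"

definition mu_zero :: "nat \<Rightarrow> real \<Rightarrow> real \<Rightarrow> real \<Rightarrow> real" where
  "mu_zero N p s \<theta> =
     (if \<theta> = s then C_Nps N p s
      else if \<theta> = 1 then C_H N p
      else min (C_H N p * (1 - s) / (\<theta> - s)) (C_Nps N p s * (1 - s) / (1 - \<theta>)))"

section \<open>The functionals and the minimax level\<close>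

definition J :: "real \<Rightarrow> real \<Rightarrow> real \<Rightarrow> real \<Rightarrow> 'a::euclidean_space set \<Rightarrow> real \<Rightarrow> ('a \<Rightarrow> real) \<Rightarrow> real"
  where
  "J p s \<theta> \<mu> \<Omega> d u =
     grad_energy p \<Omega> u + gagliardo p s u
     - \<mu> * (LINT x:\<Omega>|lborel. \<bar>u x\<bar> powr p / norm x powr (p * \<theta>))
     - d * (LINT x:\<Omega>|lborel. (max (u x) 0) powr p)"

definition S_set :: "real \<Rightarrow> 'a::euclidean_space set \<Rightarrow> ('a \<Rightarrow> real) set" where
  "S_set p \<Omega> = {u \<in> X_space p \<Omega>. (LINT x:\<Omega>|lborel. \<bar>u x\<bar> powr p) = 1}"

definition lambda1 :: "real \<Rightarrow> real \<Rightarrow> real \<Rightarrow> real \<Rightarrow> 'a::euclidean_space set \<Rightarrow> real" where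
  "lambda1 p s \<theta> \<mu> \<Omega> = (INF u\<in>S_set p \<Omega>. J p s \<theta> \<mu> \<Omega> 0 u)"

definition first_eigenfunction ::
  "real \<Rightarrow> real \<Rightarrow> real \<Rightarrow> real \<Rightarrow> 'a::euclidean_space set \<Rightarrow> ('a \<Rightarrow> real) \<Rightarrow> bool" where
  "first_eigenfunction p s \<theta> \<mu> \<Omega> \<phi> \<longleftrightarrow>
     \<phi> \<in> S_set p \<Omega> \<and> (AE x in lborel. x \<in> \<Omega> \<longrightarrow> \<phi> x > 0) \<and>
     J p s \<theta> \<mu> \<Omega> 0 \<phi> = lambda1 p s \<theta> \<mu> \<Omega>"

definition path_set ::
  "real \<Rightarrow> real \<Rightarrow> 'a::euclidean_space set \<Rightarrow> ('a \<Rightarrow> real) \<Rightarrow> (real \<Rightarrow> 'a \<Rightarrow> real) set" where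
  "path_set p s \<Omega> \<phi> =
     {\<gamma>. continuous_map (top_of_set {-1..1}) (subtopology (X_topology p s \<Omega>) (S_set p \<Omega>)) \<gamma> \<and>
         (AE x in lborel. \<gamma> (-1) x = - \<phi> x) \<and> (AE x in lborel. \<gamma> 1 x = \<phi> x)}"

text \<open>
  The supremum is a maximum, since the functional is continuous on the compact image of the path.
\<close>

definition minimax_level ::
  "real \<Rightarrow> real \<Rightarrow> real \<Rightarrow> real \<Rightarrow> 'a::euclidean_space set \<Rightarrow> ('a \<Rightarrow> real) \<Rightarrow> real \<Rightarrow> real" where
  "minimax_level p s \<theta> \<mu> \<Omega> \<phi> d =
     (INF \<gamma>\<in>path_set p s \<Omega> \<phi>. SUP u\<in>\<gamma> ` {-1..1}. J p s \<theta> \<mu> \<Omega> d u)"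

end

theory Submission
  imports Defs
begin

text \<open>
  The lower bound is immediate: a path starts at \<open>- \<phi>\<close>, where the positive part vanishes, so the
  maximum of the functional along it is at least \<open>J\<^sub>0 \<phi> = \<lambda>\<^sub>1\<close>. The functional is bounded along a path
  because it is dominated by the norm of \<open>X\<close>.

  For the upper bound, a path from \<open>- \<phi>\<close> to \<open>\<phi>\<close> is drawn through a nonnegative bump \<open>\<psi>\<close>: normalise
  \<open>v\<^sub>t = t \<phi> + (1 - \<bar>t\<bar>) \<psi>\<close>. If all seminorms of \<open>\<psi>\<close> are at most 1, there is an \<open>\<eta>\<close> depending only on
  \<open>\<phi>\<close> and \<open>\<epsilon>\<close> such that \<open>J\<^sub>0\<close> is at most \<open>\<lambda>\<^sub>1 + \<epsilon>\<close> for \<open>t \<le> - 1 + \<eta>\<close>. Since \<open>p < N\<close>, a bump of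
  arbitrarily large height may be squeezed into so small a cube that its seminorms are at most 1. It
  is placed where \<open>\<phi>\<close> lies between two positive constants on a set of positive measure, and it is
  made so high that \<open>v\<^sub>t\<close> is at least a positive constant on that set for all \<open>t \<ge> - 1 + \<eta>\<close>. There the
  integral of the positive part is bounded below and the term with \<open>d\<close> wins as \<open>d\<close> grows.

  These estimates rest on the fact that the terms of the functional are powers of seminorms. The
  local energy is a power of a seminorm because weak gradients are unique, which is the lemma of
  du Bois-Reymond. The same holds for the nonlocal energy provided that it is finite on \<open>X\<close>: for test
  functions it is bounded by the Sobolev norm, as translations by \<open>h\<close> move them by at most \<open>\<bar>h\<bar>\<close> times
  the norm of the gradient in \<open>L\<^sup>p\<close>, and Fatou's lemma extends the bound to limits. The triangle
  inequalities are then Minkowski's inequality. The lemmas that carry the argument are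
  \<open>du_Bois_Reymond\<close>, \<open>gagliardo_nn_X_space_finite\<close>, \<open>exists_high_bump_of_small_norm\<close>,
  \<open>exists_low_path\<close> and \<open>lambda1_le_SUP_path\<close>.
\<close>

section \<open>Gradients and smooth functions\<close>

lemma has_derivative_grad:
  fixes f :: "'a::euclidean_space \<Rightarrow> real"
  assumes "f differentiable (at x)"
  shows "(f has_derivative (\<lambda>h. grad f x \<bullet> h)) (at x)"
proof -
  let ?D = "frechet_derivative f (at x)"
  have D: "(f has_derivative ?D) (at x)"
    using assms frechet_derivative_works by blast
  then have lin: "linear ?D" by (rule has_derivative_linear)
  have "?D h = grad f x \<bullet> h" for h
  proof -
    have "?D h = ?D (\<Sum>i\<in>Basis. (h \<bullet> i) *\<^sub>R i)" by (simp add: euclidean_representation)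
    also have "\<dots> = (\<Sum>i\<in>Basis. (h \<bullet> i) * ?D i)"
      using lin by (simp add: linear_sum linear_cmul)
    also have "\<dots> = grad f x \<bullet> h"
      by (simp add: grad_def inner_sum_right inner_commute[of _ h] mult.commute)
    finally show ?thesis .
  qed
  then have "?D = (\<lambda>h. grad f x \<bullet> h)" by auto
  with D show ?thesis by simp
qed

lemma grad_eqI:
  fixes f :: "'a::euclidean_space \<Rightarrow> real"
  assumes "(f has_derivative (\<lambda>h. g \<bullet> h)) (at x)"
  shows "grad f x = g"
proof -
  have "frechet_derivative f (at x) = (\<lambda>h. g \<bullet> h)"
    using assms by (metis frechet_derivative_at)
  then show ?thesis by (simp add: grad_def euclidean_representation)
qed

lemma grad_const: "grad (\<lambda>x. c) x = 0"
  by (rule grad_eqI) simp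

lemma grad_lincomb:
  fixes f g :: "'a::euclidean_space \<Rightarrow> real"
  assumes "f differentiable (at x)" "g differentiable (at x)"
  shows "grad (\<lambda>x. \<alpha> * f x + \<beta> * g x) x = \<alpha> *\<^sub>R grad f x + \<beta> *\<^sub>R grad g x"
  by (rule grad_eqI)
     (auto intro!: derivative_eq_intros has_derivative_grad assms simp: inner_add_left)

lemma grad_mult:
  fixes f g :: "'a::euclidean_space \<Rightarrow> real"
  assumes "f differentiable (at x)" "g differentiable (at x)"
  shows "grad (\<lambda>x. f x * g x) x = f x *\<^sub>R grad g x + g x *\<^sub>R grad f x"
  by (rule grad_eqI)
     (auto intro!: derivative_eq_intros has_derivative_grad assms simp: inner_add_left algebra_simps)

lemma continuously_differentiable_SucD:
  "continuously_differentiable (Suc k) f \<Longrightarrow> continuously_differentiable k f"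
proof (induction k arbitrary: f)
  case 0
  then have "f differentiable (at x)" for x by (simp only: continuously_differentiable.simps)
  then show ?case
    by (simp add: continuous_at_imp_continuous_on differentiable_imp_continuous_within)
next
  case (Suc k)
  from Suc.prems have 1: "\<forall>x. f differentiable (at x)"
    and 2: "\<forall>i\<in>Basis. continuously_differentiable (Suc k) (\<lambda>x. grad f x \<bullet> i)"
    by (subst (asm) continuously_differentiable.simps, blast)+
  from 2 Suc.IH have "\<forall>i\<in>Basis. continuously_differentiable k (\<lambda>x. grad f x \<bullet> i)" by blast
  with 1 show ?case by (subst continuously_differentiable.simps) blast
qed

lemma continuously_differentiable_const: "continuously_differentiable k (\<lambda>x. c)"
  by (induction k arbitrary: c) (auto simp: grad_const)

lemma continuously_differentiable_add:
  "continuously_differentiable k f \<Longrightarrow> continuously_differentiable k g \<Longrightarrow>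
   continuously_differentiable k (\<lambda>x. f x + g x)"
proof (induction k arbitrary: f g)
  case (Suc k)
  then have d: "f differentiable (at x)" "g differentiable (at x)" for x by simp_all
  have "grad (\<lambda>x. f x + g x) x = grad f x + grad g x" for x
    using grad_lincomb[OF d, of 1 1] by simp
  with Suc d show ?case by (simp add: inner_add_left)
qed (simp add: continuous_on_add)

lemma continuously_differentiable_mult:
  "continuously_differentiable k f \<Longrightarrow> continuously_differentiable k g \<Longrightarrow>
   continuously_differentiable k (\<lambda>x. f x * g x)"
proof (induction k arbitrary: f g)
  case (Suc k)
  note fg = Suc.prems[THEN continuously_differentiable_SucD]
  have d: "f differentiable (at x)" "g differentiable (at x)" for x using Suc.prems by simp_all
  have "continuously_differentiable k (\<lambda>x. f x * (grad g x \<bullet> i) + g x * (grad f x \<bullet> i))"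
    if "i \<in> Basis" for i
    using Suc.prems that fg
    by (intro continuously_differentiable_add Suc.IH) simp_all
  with d show ?case by (simp add: grad_mult inner_add_left)
qed (simp add: continuous_on_mult)

lemma continuously_differentiable_prod:
  "finite I \<Longrightarrow> (\<And>i. i \<in> I \<Longrightarrow> continuously_differentiable k (f i)) \<Longrightarrow>
   continuously_differentiable k (\<lambda>x. \<Prod>i\<in>I. f i x)"
  by (induction I rule: finite_induct)
     (auto intro: continuously_differentiable_const continuously_differentiable_mult)

subsection \<open>A flat function\<close>

text \<open>
  The polynomial parameter makes the family closed under differentiation, so that smoothness
  follows by induction on the order. The member with \<open>P = 1\<close> is the usual function \<open>exp (- 1 / t)\<close>.
\<close>

definition flat :: "real poly \<Rightarrow> real \<Rightarrow> real" where
  "flat P t = (if t > 0 then poly P (1 / t) * exp (- (1 / t)) else 0)"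

lemma poly_exp_tendsto_0: "((\<lambda>y::real. poly P y * exp (- y)) \<longlongrightarrow> 0) at_top"
proof -
  have "((\<lambda>y. \<Sum>i\<le>degree P. coeff P i * (y ^ i / exp y)) \<longlongrightarrow> (\<Sum>i\<le>degree P. coeff P i * 0)) at_top"
    by (intro tendsto_sum tendsto_mult tendsto_const tendsto_power_div_exp_0)
  then show ?thesis
    by (simp add: poly_altdef sum_distrib_right exp_minus divide_inverse mult.assoc)
qed

lemma flat_quotient_tendsto_0: "((\<lambda>h. flat P h / h) \<longlongrightarrow> 0) (at 0)"
proof -
  have "((\<lambda>h. poly (pCons 0 P) (inverse h) * exp (- inverse h)) \<longlongrightarrow> 0) (at_right 0)"
    by (rule filterlim_compose[OF poly_exp_tendsto_0 filterlim_inverse_at_top_right])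
  then have R: "((\<lambda>h. flat P h / h) \<longlongrightarrow> 0) (at_right 0)"
    by (rule Lim_transform_eventually)
       (auto simp: eventually_at_filter flat_def divide_inverse)
  have L: "((\<lambda>h. flat P h / h) \<longlongrightarrow> 0) (at_left 0)"
    by (rule Lim_transform_eventually[OF tendsto_const])
       (auto simp: eventually_at_filter flat_def)
  from L R show ?thesis using filterlim_split_at by blast
qed

lemma flat_has_derivative:
  "(flat P has_real_derivative flat ([:0, 0, 1:] * (P - pderiv P)) t) (at t)"
proof (cases t "0 :: real" rule: linorder_cases)
  case less
  have "((\<lambda>t. 0) has_real_derivative 0) (at t)" by simp
  then have "(flat P has_real_derivative 0) (at t)"
    by (rule has_field_derivative_transform_within_open[of _ _ _ "{..<0}"])
       (use less in \<open>auto simp: flat_def\<close>)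
  with less show ?thesis by (simp add: flat_def)
next
  case equal
  have "(flat P has_real_derivative 0) (at 0)"
    using flat_quotient_tendsto_0[of P] by (simp add: DERIV_def flat_def)
  with equal show ?thesis by (simp add: flat_def)
next
  case greater
  have "((\<lambda>t. poly P (1 / t) * exp (- (1 / t))) has_real_derivative
      poly ([:0, 0, 1:] * (P - pderiv P)) (1 / t) * exp (- (1 / t))) (at t)"
    using greater
    by (auto intro!: derivative_eq_intros simp: field_simps power2_eq_square)
  then have "(flat P has_real_derivative
      poly ([:0, 0, 1:] * (P - pderiv P)) (1 / t) * exp (- (1 / t))) (at t)"
    by (rule has_field_derivative_transform_within_open[of _ _ _ "{0<..}"])
       (use greater in \<open>auto simp: flat_def\<close>)
  with greater show ?thesis by (simp add: flat_def)
qed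

lemma continuously_differentiable_flat:
  fixes e :: "'a::euclidean_space"
  shows "continuously_differentiable k (\<lambda>x. flat P (e \<bullet> x + d))"
proof (induction k arbitrary: P)
  case 0
  have "continuous_on UNIV (flat P)"
    by (intro continuous_at_imp_continuous_on ballI DERIV_isCont[OF flat_has_derivative])
  from continuous_on_compose2[OF this, of UNIV "\<lambda>x. e \<bullet> x + d"] show ?case
    by (simp add: continuous_intros)
next
  case (Suc k)
  let ?Q = "[:0, 0, 1:] * (P - pderiv P)"
  have D: "((\<lambda>x. flat P (e \<bullet> x + d)) has_derivative (\<lambda>h. (flat ?Q (e \<bullet> x + d) *\<^sub>R e) \<bullet> h)) (at x)" for x
  proof -
    have "((\<lambda>x. e \<bullet> x + d) has_derivative (\<lambda>h. e \<bullet> h)) (at x)"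
      by (auto intro!: derivative_eq_intros)
    from has_derivative_compose[OF this
        flat_has_derivative[of P "e \<bullet> x + d", unfolded has_field_derivative_def]]
    show ?thesis by simp
  qed
  show ?case
    unfolding continuously_differentiable.simps grad_eqI[OF D] inner_scaleR_left
    using D Suc.IH[of ?Q]
    by (intro conjI allI ballI continuously_differentiable_mult continuously_differentiable_const)
       (auto simp only: differentiable_def)
qed

lemma flat1_nonneg: "0 \<le> flat 1 t" by (simp add: flat_def)
lemma flat1_le_1: "flat 1 t \<le> 1" by (simp add: flat_def)
lemma flat1_eq_0: "t \<le> 0 \<Longrightarrow> flat 1 t = 0" by (simp add: flat_def)

text \<open>
  The flat function tends to 1 at infinity, so steepening it yields the indicator of the open
  half-line. Products of such factors approximate boxes.
\<close>

lemma flat1_scaled_tendsto: "(\<lambda>n. flat 1 (real n * t)) \<longlonglongrightarrow> (if t > 0 then 1 else 0)"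
proof (cases "t > 0")
  case True
  have "(\<lambda>n. exp (- (inverse t * inverse (real n)))) \<longlonglongrightarrow> exp (- (inverse t * 0))"
    by (intro tendsto_intros lim_inverse_n)
  then have "(\<lambda>n. exp (- (inverse t * inverse (real n)))) \<longlonglongrightarrow> 1" by simp
  then have "(\<lambda>n. flat 1 (real n * t)) \<longlonglongrightarrow> 1"
    by (rule Lim_transform_eventually)
       (use True in \<open>auto intro!: eventually_sequentiallyI[of 1] simp: flat_def field_simps\<close>)
  with True show ?thesis by simp
next
  case False
  then have "flat 1 (real n * t) = 0" for n
    by (intro flat1_eq_0) (simp add: mult_nonneg_nonpos)
  with False show ?thesis by simp
qed

subsection \<open>Bumps on boxes\<close>

text \<open>
  The parameter \<open>c\<close> serves two purposes: as \<open>c\<close> tends to infinity the bump tends to the indicator of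
  the open box, and \<open>c = 1 / e\<close> gives the rescaled bumps on the cubes of side \<open>2 * e\<close>.
\<close>

definition box_bump :: "real \<Rightarrow> 'a::euclidean_space \<Rightarrow> 'a \<Rightarrow> 'a \<Rightarrow> real" where
  "box_bump c a b x =
     (\<Prod>i\<in>Basis. flat 1 (c * (x \<bullet> i - a \<bullet> i)) * flat 1 (c * (b \<bullet> i - x \<bullet> i)))"

lemma continuously_differentiable_box_bump: "continuously_differentiable k (box_bump c a b)"
proof -
  have "continuously_differentiable k (\<lambda>x. flat 1 (c * (x \<bullet> i - a \<bullet> i)))" for i
    using continuously_differentiable_flat[of k 1 "c *\<^sub>R i" "- (c * (a \<bullet> i))"]
    by (simp add: algebra_simps inner_commute)
  moreover have "continuously_differentiable k (\<lambda>x. flat 1 (c * (b \<bullet> i - x \<bullet> i)))" for i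
    using continuously_differentiable_flat[of k 1 "- c *\<^sub>R i" "c * (b \<bullet> i)"]
    by (simp add: algebra_simps inner_commute)
  ultimately show ?thesis
    unfolding box_bump_def
    by (intro continuously_differentiable_prod continuously_differentiable_mult finite_Basis)
qed

lemma box_bump_nonneg: "0 \<le> box_bump c a b x"
  unfolding box_bump_def by (intro prod_nonneg ballI mult_nonneg_nonneg flat1_nonneg)

lemma box_bump_le_1: "box_bump c a b x \<le> 1"
  unfolding box_bump_def
  by (intro prod_le_1 conjI mult_nonneg_nonneg mult_le_one flat1_nonneg flat1_le_1)

lemma box_bump_eq_0:
  assumes "c \<ge> 0" "x \<notin> box a b"
  shows "box_bump c a b x = 0"
proof -
  from assms(2) obtain i where i: "i \<in> Basis" "x \<bullet> i \<le> a \<bullet> i \<or> b \<bullet> i \<le> x \<bullet> i"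
    by (force simp: mem_box)
  then have "flat 1 (c * (x \<bullet> i - a \<bullet> i)) * flat 1 (c * (b \<bullet> i - x \<bullet> i)) = 0"
    using assms(1) flat1_eq_0[of "c * (x \<bullet> i - a \<bullet> i)"] flat1_eq_0[of "c * (b \<bullet> i - x \<bullet> i)"]
    by (auto simp: mult_nonneg_nonpos)
  with i(1) show ?thesis unfolding box_bump_def by (intro prod_zero) auto
qed

lemma box_bump_tendsto: "(\<lambda>n. box_bump (real n) a b x) \<longlonglongrightarrow> indicator (box a b) x"
proof -
  have "(\<lambda>n. box_bump (real n) a b x) \<longlonglongrightarrow>
      (\<Prod>i\<in>Basis. (if x \<bullet> i - a \<bullet> i > 0 then 1 else 0) * (if b \<bullet> i - x \<bullet> i > 0 then 1 else 0))"
    unfolding box_bump_def by (intro tendsto_prod tendsto_mult flat1_scaled_tendsto)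
  moreover have "(\<Prod>i\<in>Basis. (if x \<bullet> i - a \<bullet> i > 0 then 1 else 0) * (if b \<bullet> i - x \<bullet> i > 0 then 1 else 0))
      = (indicator (box a b) x :: real)"
  proof (cases "x \<in> box a b")
    case True
    then show ?thesis by (auto simp: mem_box intro!: prod.neutral)
  next
    case False
    then obtain i where "i \<in> Basis" "\<not> (a \<bullet> i < x \<bullet> i \<and> x \<bullet> i < b \<bullet> i)" by (auto simp: mem_box)
    with False show ?thesis by (auto intro!: prod_zero bexI[of _ i])
  qed
  ultimately show ?thesis by simp
qed

lemma test_functionI:
  assumes "\<And>k. continuously_differentiable k f" "compact K" "K \<subseteq> U" "\<And>x. x \<notin> K \<Longrightarrow> f x = 0"
  shows "f \<in> test_functions U"
proof -
  have "closure {x. f x \<noteq> 0} \<subseteq> K"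
    using assms(2,4) by (intro closure_minimal compact_imp_closed) auto
  with assms show ?thesis
    unfolding test_functions_def
    using compact_Int_closed[of K "closure {x. f x \<noteq> 0}"] by (auto simp: Int_absorb1)
qed

lemma box_bump_test_function:
  assumes "c \<ge> 0" "cbox a b \<subseteq> U"
  shows "(\<lambda>x. K * box_bump c a b x) \<in> test_functions U"
proof (rule test_functionI[of _ "cbox a b"])
  show "continuously_differentiable k (\<lambda>x. K * box_bump c a b x)" for k
    by (intro continuously_differentiable_mult continuously_differentiable_const
        continuously_differentiable_box_bump)
  show "K * box_bump c a b x = 0" if "x \<notin> cbox a b" for x
    using that box_subset_cbox[of a b] box_bump_eq_0[OF assms(1), of x a b] by auto
qed (use assms in auto)

subsection \<open>Test functions\<close>

lemma test_function_differentiable: "f \<in> test_functions U \<Longrightarrow> f differentiable (at x)"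
  unfolding test_functions_def using continuously_differentiable.simps(2)[of 0 f] by blast

lemma test_function_continuous: "f \<in> test_functions U \<Longrightarrow> continuous_on UNIV f"
  unfolding test_functions_def using continuously_differentiable.simps(1)[of f] by blast

lemma test_function_continuous_grad:
  assumes "f \<in> test_functions U" shows "continuous_on UNIV (grad f)"
proof -
  have "continuous_on UNIV (\<lambda>x. grad f x \<bullet> i)" if "i \<in> Basis" for i
    using assms that continuously_differentiable.simps(2)[of 0 f]
    unfolding test_functions_def by auto
  then show ?thesis by (subst continuous_on_componentwise) auto
qed

lemma test_function_support:
  assumes "f \<in> test_functions U"
  obtains K where "compact K" "K \<subseteq> U" "\<And>x. x \<notin> K \<Longrightarrow> f x = 0" "\<And>x. x \<notin> K \<Longrightarrow> grad f x = 0"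
proof (rule that[of "closure {x. f x \<noteq> 0}"])
  let ?K = "closure {x. f x \<noteq> 0}"
  show "compact ?K" "?K \<subseteq> U" using assms by (auto simp: test_functions_def)
  show f0: "f x = 0" if "x \<notin> ?K" for x
    using that closure_subset[of "{x. f x \<noteq> 0}"] by blast
  show "grad f x = 0" if "x \<notin> ?K" for x
  proof (rule grad_eqI)
    have D0: "((\<lambda>x. 0) has_derivative (\<lambda>h. 0 \<bullet> h)) (at x)" by simp
    show "(f has_derivative (\<lambda>h. 0 \<bullet> h)) (at x)"
    proof (rule has_derivative_transform_within_open[OF D0, of "- ?K"])
      show "open (- ?K)" by (intro open_Compl closed_closure)
      show "x \<in> - ?K" using that by simp
      show "0 = f y" if "y \<in> - ?K" for y using f0[of y] that by simp
    qed
  qed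
qed

lemma test_functions_mono: "U \<subseteq> V \<Longrightarrow> test_functions U \<subseteq> test_functions V"
  by (auto simp: test_functions_def)

lemma test_functions_lincomb:
  assumes "f \<in> test_functions U" "g \<in> test_functions U"
  shows "(\<lambda>x. \<alpha> * f x + \<beta> * g x) \<in> test_functions U"
proof -
  obtain K L where "compact K" "K \<subseteq> U" "\<And>x. x \<notin> K \<Longrightarrow> f x = 0"
    "compact L" "L \<subseteq> U" "\<And>x. x \<notin> L \<Longrightarrow> g x = 0"
    using test_function_support[OF assms(1)] test_function_support[OF assms(2)] by metis
  then show ?thesis
    using assms
    by (intro test_functionI[of _ "K \<union> L"])
       (auto simp: test_functions_def compact_Un
         intro!: continuously_differentiable_add continuously_differentiable_mult
           continuously_differentiable_const)
qed

section \<open>Minkowski's inequality\<close>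

definition in_Lp :: "'c measure \<Rightarrow> real \<Rightarrow> ('c \<Rightarrow> 'b::euclidean_space) \<Rightarrow> bool" where
  "in_Lp M p f \<longleftrightarrow> f \<in> borel_measurable M \<and> integrable M (\<lambda>x. norm (f x) powr p)"

definition pnorm :: "'c measure \<Rightarrow> real \<Rightarrow> ('c \<Rightarrow> 'b::euclidean_space) \<Rightarrow> real" where
  "pnorm M p f = (LINT x|M. norm (f x) powr p) powr (1 / p)"

lemma in_Lp_measurable [measurable_dest]: "in_Lp M p f \<Longrightarrow> f \<in> borel_measurable M"
  by (simp add: in_Lp_def)

lemma pnorm_nonneg: "0 \<le> pnorm M p f"
  by (simp add: pnorm_def)

lemma pnorm_powr: "p > 0 \<Longrightarrow> pnorm M p f powr p = (LINT x|M. norm (f x) powr p)"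
  by (simp add: pnorm_def powr_powr)

lemma pnorm_cong:
  assumes "\<And>x. x \<in> space M \<Longrightarrow> norm (f x) = norm (g x)"
  shows "pnorm M p f = pnorm M p g"
  unfolding pnorm_def using assms by (metis (mono_tags, lifting) Bochner_Integration.integral_cong)

lemma pnorm_AE_cong:
  assumes "f \<in> borel_measurable M" "g \<in> borel_measurable M" "AE x in M. norm (f x) = norm (g x)"
  shows "pnorm M p f = pnorm M p g"
proof -
  have "(LINT x|M. norm (f x) powr p) = (LINT x|M. norm (g x) powr p)"
    using assms by (intro integral_cong_AE) auto
  then show ?thesis by (simp add: pnorm_def)
qed

lemma in_Lp_bound:
  assumes "p > 0" "in_Lp M p g" "f \<in> borel_measurable M" "AE x in M. norm (f x) \<le> norm (g x)"
  shows "in_Lp M p f"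
  unfolding in_Lp_def
proof
  have int: "integrable M (\<lambda>x. norm (g x) powr p)" using assms(2) by (simp add: in_Lp_def)
  have le: "AE x in M. norm (norm (f x) powr p) \<le> norm (norm (g x) powr p)"
    using assms(4) by eventually_elim (use assms(1) in \<open>auto intro: powr_mono2\<close>)
  have "(\<lambda>x. norm (f x) powr p) \<in> borel_measurable M" using assms(3) by measurable
  from Bochner_Integration.integrable_bound[OF int this le]
  show "integrable M (\<lambda>x. norm (f x) powr p)" .
qed (rule assms)

lemma pnorm_mono:
  assumes "p > 0" "in_Lp M p g" "f \<in> borel_measurable M" "AE x in M. norm (f x) \<le> norm (g x)"
  shows "pnorm M p f \<le> pnorm M p g"
proof -
  have "AE x in M. norm (f x) powr p \<le> norm (g x) powr p"
    using assms(4) by eventually_elim (use assms(1) in \<open>auto intro: powr_mono2\<close>)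
  then have le: "(LINT x|M. norm (f x) powr p) \<le> (LINT x|M. norm (g x) powr p)"
    using in_Lp_bound[OF assms] assms(2) by (intro integral_mono_AE) (auto simp: in_Lp_def)
  have 0: "0 \<le> (LINT x|M. norm (f x) powr p)" by (rule integral_nonneg_AE) simp
  have "0 \<le> 1 / p" using \<open>p > 0\<close> by simp
  from powr_mono2[OF this 0 le] show ?thesis unfolding pnorm_def .
qed

lemma pnorm_scaleR:
  assumes "p > 0"
  shows "pnorm M p (\<lambda>x. c *\<^sub>R f x) = \<bar>c\<bar> * pnorm M p f"
proof -
  have "norm (c *\<^sub>R f x) powr p = \<bar>c\<bar> powr p * norm (f x) powr p" for x
    unfolding norm_scaleR by (rule powr_mult)
  then have "pnorm M p (\<lambda>x. c *\<^sub>R f x) = (\<bar>c\<bar> powr p * (LINT x|M. norm (f x) powr p)) powr (1 / p)"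
    unfolding pnorm_def by (simp only: integral_mult_right_zero)
  also have "\<dots> = (\<bar>c\<bar> powr p) powr (1 / p) * pnorm M p f"
    unfolding pnorm_def by (rule powr_mult)
  also have "(\<bar>c\<bar> powr p) powr (1 / p) = \<bar>c\<bar>" using assms by (simp add: powr_powr)
  finally show ?thesis .
qed

lemma in_Lp_scaleR: "in_Lp M p f \<Longrightarrow> in_Lp M p (\<lambda>x. c *\<^sub>R f x)"
  by (auto simp: in_Lp_def powr_mult)

lemma powr_convex_combination:
  fixes a b :: real
  assumes "1 \<le> p" "0 \<le> a" "0 \<le> b" "0 < l" "l < 1"
  shows "(l * a + (1 - l) * b) powr p \<le> l * a powr p + (1 - l) * b powr p"
proof (cases "a = 0 \<or> b = 0")
  case True
  have *: "m powr p \<le> m" if "0 < m" "m < 1" for m :: real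
    using powr_mono'[of 1 p m] that assms(1) by simp
  from True show ?thesis
  proof
    assume "a = 0"
    then show ?thesis using assms *[of "1 - l"] by (simp add: powr_mult mult_right_mono)
  next
    assume "b = 0"
    then show ?thesis using assms *[of l] by (simp add: powr_mult mult_right_mono)
  qed
next
  case False
  with assms convex_onD[OF powr_convex[of p], of "1 - l" a b] show ?thesis by simp
qed

lemma in_Lp_add:
  assumes "p > 0" "in_Lp M p f" "in_Lp M p g"
  shows "in_Lp M p (\<lambda>x. f x + g x)"
  unfolding in_Lp_def
proof
  have *: "norm (norm (f x + g x) powr p) \<le> norm (2 powr p * (norm (f x) powr p + norm (g x) powr p))" for x
  proof -
    have "norm (f x + g x) powr p \<le> (2 * max (norm (f x)) (norm (g x))) powr p"
      using assms(1) norm_triangle_ineq[of "f x" "g x"] by (intro powr_mono2) auto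
    also have "\<dots> = 2 powr p * max (norm (f x)) (norm (g x)) powr p"
      by (simp add: powr_mult)
    also have "\<dots> \<le> 2 powr p * (norm (f x) powr p + norm (g x) powr p)"
      by (intro mult_left_mono) (auto simp: max_def)
    finally show ?thesis by simp
  qed
  have "integrable M (\<lambda>x. 2 powr p * (norm (f x) powr p + norm (g x) powr p))"
    using assms by (auto simp: in_Lp_def)
  then show "integrable M (\<lambda>x. norm (f x + g x) powr p)"
    by (rule Bochner_Integration.integrable_bound) (use assms * in \<open>auto simp: in_Lp_def\<close>)
qed (use assms in \<open>auto simp: in_Lp_def\<close>)

text \<open>
  For numbers \<open>A > \<parallel>f\<parallel>\<close> and \<open>B > \<parallel>g\<parallel>\<close>, the convexity of \<open>t powr p\<close> at the weight \<open>A / (A + B)\<close>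
  bounds the integral of \<open>(\<bar>f + g\<bar> / (A + B)) powr p\<close> by 1. Working with strict upper bounds
  avoids the cases of vanishing norms.
\<close>

lemma pnorm_triangle:
  assumes "1 \<le> p" "in_Lp M p f" "in_Lp M p g"
  shows "pnorm M p (\<lambda>x. f x + g x) \<le> pnorm M p f + pnorm M p g"
proof (rule field_le_epsilon)
  fix e :: real assume "e > 0"
  define A where "A = pnorm M p f + e / 2"
  define B where "B = pnorm M p g + e / 2"
  define l where "l = A / (A + B)"
  have AB: "A > 0" "B > 0" using \<open>e > 0\<close> pnorm_nonneg[of M p f] pnorm_nonneg[of M p g]
    by (auto simp: A_def B_def)
  then have l: "0 < l" "l < 1" "1 - l = B / (A + B)" by (auto simp: l_def field_simps)
  have p: "p > 0" using assms by simp
  have fA: "(LINT x|M. norm (f x) powr p) \<le> A powr p"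
    unfolding pnorm_powr[OF p, symmetric] using \<open>e > 0\<close> p
    by (intro powr_mono2) (auto simp: A_def pnorm_nonneg)
  have gB: "(LINT x|M. norm (g x) powr p) \<le> B powr p"
    unfolding pnorm_powr[OF p, symmetric] using \<open>e > 0\<close> p
    by (intro powr_mono2) (auto simp: B_def pnorm_nonneg)
  have pw: "norm (f x + g x) powr p \<le>
     (A + B) powr p * (l * (norm (f x) powr p / A powr p) + (1 - l) * (norm (g x) powr p / B powr p))" for x
  proof -
    have "norm (f x + g x) powr p \<le> ((A + B) * (l * (norm (f x) / A) + (1 - l) * (norm (g x) / B))) powr p"
    proof (rule powr_mono2)
      have "(A + B) * (l * (norm (f x) / A) + (1 - l) * (norm (g x) / B)) = norm (f x) + norm (g x)"
      proof -
        have "(A + B) * l = A" "(A + B) * (1 - l) = B"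
          unfolding l(3) using AB by (simp_all add: l_def)
        then have "(A + B) * l * (norm (f x) / A) + (A + B) * (1 - l) * (norm (g x) / B)
            = norm (f x) + norm (g x)" using AB by simp
        then show ?thesis by (simp only: distrib_left mult.assoc)
      qed
      then show "norm (f x + g x) \<le> (A + B) * (l * (norm (f x) / A) + (1 - l) * (norm (g x) / B))"
        by (simp add: norm_triangle_ineq)
    qed (use p in auto)
    also have "\<dots> = (A + B) powr p * (l * (norm (f x) / A) + (1 - l) * (norm (g x) / B)) powr p"
      using AB l by (intro powr_mult)
    also have "\<dots> \<le> (A + B) powr p * (l * (norm (f x) / A) powr p + (1 - l) * (norm (g x) / B) powr p)"
      using AB l assms by (intro mult_left_mono powr_convex_combination) auto
    finally show ?thesis using AB by (simp add: powr_divide)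
  qed
  have int: "integrable M (\<lambda>x. norm (f x) powr p)" "integrable M (\<lambda>x. norm (g x) powr p)"
    "integrable M (\<lambda>x. norm (f x + g x) powr p)"
    using assms in_Lp_add[OF p assms(2,3)] by (auto simp: in_Lp_def)
  have "(LINT x|M. norm (f x + g x) powr p) \<le>
      (LINT x|M. (A + B) powr p * (l * (norm (f x) powr p / A powr p) + (1 - l) * (norm (g x) powr p / B powr p)))"
    using int pw by (intro integral_mono) auto
  also have "\<dots> = (A + B) powr p * (l * ((LINT x|M. norm (f x) powr p) / A powr p)
      + (1 - l) * ((LINT x|M. norm (g x) powr p) / B powr p))"
    using int by simp
  also have "\<dots> \<le> (A + B) powr p * (l * 1 + (1 - l) * 1)"
    using fA gB AB l by (intro mult_left_mono add_mono) (auto simp: divide_le_eq_1)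
  also have "\<dots> = (A + B) powr p" by simp
  finally have le: "(LINT x|M. norm (f x + g x) powr p) \<le> (A + B) powr p" .
  have 0: "0 \<le> (LINT x|M. norm (f x + g x) powr p)" by (rule integral_nonneg_AE) simp
  have "0 \<le> 1 / p" using p by simp
  from powr_mono2[OF this 0 le]
  have "pnorm M p (\<lambda>x. f x + g x) \<le> ((A + B) powr p) powr (1 / p)"
    unfolding pnorm_def .
  also have "\<dots> = A + B" using AB p by (simp add: powr_powr)
  finally show "pnorm M p (\<lambda>x. f x + g x) \<le> pnorm M p f + pnorm M p g + e"
    by (simp add: A_def B_def)
qed

lemma in_Lp_lincomb:
  assumes "p > 0" "in_Lp M p f" "in_Lp M p g"
  shows "in_Lp M p (\<lambda>x. \<alpha> *\<^sub>R f x + \<beta> *\<^sub>R g x)"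
  using assms by (intro in_Lp_add in_Lp_scaleR)

lemma pnorm_lincomb:
  assumes "1 \<le> p" "in_Lp M p f" "in_Lp M p g"
  shows "pnorm M p (\<lambda>x. \<alpha> *\<^sub>R f x + \<beta> *\<^sub>R g x) \<le> \<bar>\<alpha>\<bar> * pnorm M p f + \<bar>\<beta>\<bar> * pnorm M p g"
  using pnorm_triangle[OF assms(1) in_Lp_scaleR[OF assms(2), of \<alpha>] in_Lp_scaleR[OF assms(3), of \<beta>]]
    pnorm_scaleR[of p M \<alpha> f] pnorm_scaleR[of p M \<beta> g] assms(1) by simp

lemma pnorm_le_add_diff:
  assumes "1 \<le> p" "in_Lp M p f" "in_Lp M p g"
  shows "pnorm M p f \<le> pnorm M p g + pnorm M p (\<lambda>x. f x - g x)"
  using pnorm_triangle[of p M g "\<lambda>x. f x - g x"] in_Lp_lincomb[of p M f g 1 "-1"] assms by simp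

section \<open>Weak gradients\<close>

subsection \<open>Integrability against test functions\<close>

lemma integrable_scaleR_bounded:
  fixes g :: "'c \<Rightarrow> 'b::euclidean_space"
  assumes "integrable M g" "h \<in> borel_measurable M" "\<And>x. \<bar>h x\<bar> \<le> B"
  shows "integrable M (\<lambda>x. h x *\<^sub>R g x)"
proof (rule Bochner_Integration.integrable_bound)
  show "integrable M (\<lambda>x. B *\<^sub>R g x)" using assms(1) by simp
  show "(\<lambda>x. h x *\<^sub>R g x) \<in> borel_measurable M" using assms(1,2) by measurable
  show "AE x in M. norm (h x *\<^sub>R g x) \<le> norm (B *\<^sub>R g x)"
  proof (rule AE_I2)
    fix x
    have "\<bar>h x\<bar> \<le> \<bar>B\<bar>" using assms(3)[of x] by linarith
    then show "norm (h x *\<^sub>R g x) \<le> norm (B *\<^sub>R g x)" by (simp add: mult_right_mono)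
  qed
qed

lemma bounded_of_compact_support:
  fixes h :: "'a::euclidean_space \<Rightarrow> 'b::euclidean_space"
  assumes "continuous_on UNIV h" "compact K" "\<And>x. x \<notin> K \<Longrightarrow> h x = 0"
  obtains B where "B \<ge> 0" "\<And>x. norm (h x) \<le> B"
proof -
  have "compact (h ` K)"
    using assms(1,2) by (intro compact_continuous_image) (auto intro: continuous_on_subset)
  then obtain B where B: "\<forall>y\<in>h ` K. norm y \<le> B" using compact_imp_bounded bounded_iff by metis
  have "norm (h x) \<le> max B 0" for x
    using B assms(3)[of x] by (cases "x \<in> K") auto
  then show thesis by (intro that[of "max B 0"]) simp_all
qed

lemma integrable_of_compact_support:
  fixes h :: "'a::euclidean_space \<Rightarrow> 'b::euclidean_space"
  assumes "continuous_on UNIV h" "compact K" "\<And>x. x \<notin> K \<Longrightarrow> h x = 0"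
  shows "integrable lborel h"
proof -
  have "integrable lborel (\<lambda>x. indicator K x *\<^sub>R h x)"
    using assms(1,2) by (intro borel_integrable_compact) (auto intro: continuous_on_subset)
  moreover have "(\<lambda>x. indicator K x *\<^sub>R h x) = h"
    using assms(3) by (auto simp: indicator_def fun_eq_iff)
  ultimately show ?thesis by simp
qed

lemma set_integrable_compact_support_scaleR:
  fixes g :: "'a::euclidean_space \<Rightarrow> 'b::euclidean_space"
  assumes g: "locally_integrable U g" and h: "continuous_on UNIV h" "compact K" "K \<subseteq> U"
    "\<And>x. x \<notin> K \<Longrightarrow> h x = 0"
  shows "set_integrable lborel U (\<lambda>x. h x *\<^sub>R g x)"
proof -
  obtain B where B: "\<And>x. norm (h x) \<le> B" using bounded_of_compact_support[OF h(1,2,4)] by metis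
  have "set_integrable lborel K g" using g h(2,3) by (simp add: locally_integrable_def)
  then have "integrable lborel (\<lambda>x. indicator K x *\<^sub>R g x)" by (simp add: set_integrable_def)
  moreover have "h \<in> borel_measurable lborel"
    using borel_measurable_continuous_onI[OF h(1)] by simp
  moreover have "\<bar>h x\<bar> \<le> B" for x using B[of x] by simp
  ultimately have "integrable lborel (\<lambda>x. h x *\<^sub>R (indicator K x *\<^sub>R g x))"
    by (rule integrable_scaleR_bounded)
  moreover have "h x *\<^sub>R (indicator K x *\<^sub>R g x) = indicator U x *\<^sub>R (h x *\<^sub>R g x)" for x
    using h(3) h(4)[of x] by (cases "x \<in> K") auto
  ultimately show ?thesis unfolding set_integrable_def by (simp only:)
qed

lemma locally_integrable_lincomb:
  assumes "locally_integrable U f" "locally_integrable U g"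
  shows "locally_integrable U (\<lambda>x. \<alpha> *\<^sub>R f x + \<beta> *\<^sub>R g x)"
proof -
  have "set_integrable lborel K (\<lambda>x. \<alpha> *\<^sub>R f x + \<beta> *\<^sub>R g x)" if "compact K" "K \<subseteq> U" for K
    using assms that
    by (intro set_integral_add(1) set_integrable_scaleR_right) (auto simp: locally_integrable_def)
  then show ?thesis by (simp add: locally_integrable_def)
qed

lemma locally_integrable_inner:
  assumes "locally_integrable U G"
  shows "locally_integrable U (\<lambda>x. G x \<bullet> i)"
  unfolding locally_integrable_def set_integrable_def
proof (intro allI impI)
  fix K assume "compact K \<and> K \<subseteq> U"
  then have "integrable lborel (\<lambda>x. indicator K x *\<^sub>R G x)"
    using assms by (simp add: locally_integrable_def set_integrable_def)
  then have "integrable lborel (\<lambda>x. (indicator K x *\<^sub>R G x) \<bullet> i)" by (rule integrable_inner_left)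
  then show "integrable lborel (\<lambda>x. indicator K x *\<^sub>R (G x \<bullet> i))" by simp
qed

lemma locally_integrable_continuous:
  "continuous_on UNIV f \<Longrightarrow> locally_integrable U f"
  unfolding locally_integrable_def set_integrable_def
  by (auto intro!: borel_integrable_compact intro: continuous_on_subset)

subsection \<open>The lemma of du Bois-Reymond\<close>

text \<open>
  Bumps converge boundedly to the indicators of boxes, so the integral of \<open>g\<close> over each small
  box vanishes. Boxes generate the Borel sets and are stable under intersection, so the integral
  over each Borel subset vanishes.
\<close>

lemma AE_zero_on_box:
  fixes g :: "'a::euclidean_space \<Rightarrow> real"
  assumes int: "set_integrable lborel (cbox c d) g"
    and orth: "\<And>a b n. cbox a b \<subseteq> cbox c d \<Longrightarrow> (LINT x:cbox c d|lborel. g x * box_bump (real n) a b x) = 0"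
  shows "AE x in lborel. x \<in> box c d \<longrightarrow> g x = 0"
proof -
  define G where "G x = indicator (box c d) x * g x" for x
  define G' where "G' x = indicator (cbox c d) x * g x" for x
  have G': "integrable lborel G'"
    using int by (simp add: G'_def[abs_def] set_integrable_def)
  have "set_integrable lborel (box c d) g"
    by (rule set_integrable_subset[OF int]) (auto simp: box_subset_cbox)
  then have G: "integrable lborel G"
    by (simp add: G_def[abs_def] set_integrable_def)
  have small: "(LINT x|lborel. indicator (box a b) x * G x) = 0" if ab: "cbox a b \<subseteq> cbox c d" for a b
  proof -
    have bb: "(\<lambda>x. box_bump (real n) a b x) \<in> borel_measurable lborel" for n
      using borel_measurable_continuous_onI[OF continuously_differentiable_box_bump[of 0, simplified]]
      by simp
    have "(\<lambda>n. LINT x|lborel. box_bump (real n) a b x * G' x)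
        \<longlonglongrightarrow> (LINT x|lborel. indicator (box a b) x * G' x)"
    proof (rule integral_dominated_convergence[where w="\<lambda>x. norm (G' x)"])
      show "AE x in lborel. (\<lambda>n. box_bump (real n) a b x * G' x) \<longlonglongrightarrow> indicator (box a b) x * G' x"
        by (intro AE_I2 tendsto_mult box_bump_tendsto tendsto_const)
      show "AE x in lborel. norm (box_bump (real n) a b x * G' x) \<le> norm (G' x)" for n
      proof (rule AE_I2)
        fix x
        show "norm (box_bump (real n) a b x * G' x) \<le> norm (G' x)"
          using box_bump_nonneg[of "real n" a b x] box_bump_le_1[of "real n" a b x]
            mult_right_mono[of "box_bump (real n) a b x" 1 "\<bar>G' x\<bar>"]
          by (simp add: abs_mult)
      qed
    qed (use G' bb in auto)
    moreover have "(LINT x|lborel. box_bump (real n) a b x * G' x) = 0" for n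
      using orth[OF ab, of n] by (simp add: set_lebesgue_integral_def G'_def mult_ac)
    ultimately have "(LINT x|lborel. indicator (box a b) x * G' x) = 0"
      by (simp add: LIMSEQ_const_iff)
    moreover have "indicator (box a b) x * G' x = indicator (box a b) x * G x" for x
    proof (cases "x \<in> box a b")
      case True
      have "box a b \<subseteq> interior (cbox c d)"
        using ab box_subset_cbox[of a b] by (intro interior_maximal) (auto simp: open_box)
      with True have "x \<in> box c d" by auto
      moreover have "x \<in> cbox c d" using True ab box_subset_cbox[of a b] by auto
      ultimately show ?thesis by (simp add: G_def G'_def)
    qed auto
    ultimately show ?thesis by (simp only:)
  qed
  have box: "(LINT x|lborel. indicator (box a b) x * G x) = 0" for a b
  proof -
    obtain a' b' where ab': "box a b \<inter> box c d = box a' b'"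
      using box_Int_box[of a b c d] by auto
    have eq: "indicator (box a b) x * G x = indicator (box a' b') x * G x" for x
      using ab' by (auto simp: G_def indicator_def)
    show ?thesis
    proof (cases "box a' b' = {}")
      case False
      have "box a' b' \<subseteq> cbox c d" using ab' box_subset_cbox[of c d] by auto
      then have "cbox a' b' \<subseteq> cbox c d"
        using closure_box[OF False] closure_minimal[of "box a' b'" "cbox c d"] closed_cbox by metis
      from small[OF this] show ?thesis by (simp only: eq)
    qed (simp add: eq)
  qed
  have tot: "(LINT x|lborel. G x) = 0"
  proof -
    have "indicator (box c d) x * G x = G x" for x by (simp add: G_def indicator_def)
    with box[of c d] show ?thesis by (simp only:)
  qed
  have meas: "(LINT x:A|lborel. G x) = 0" if "A \<in> sets lborel" for A
  proof -
    have st: "Int_stable (range (\<lambda>(a, b). box a b :: 'a set))"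
    proof (rule Int_stableI)
      fix A B :: "'a set"
      assume "A \<in> range (\<lambda>(a, b). box a b)" "B \<in> range (\<lambda>(a, b). box a b)"
      then obtain a b a' b' where "A = box a b" "B = box a' b'" by auto
      then show "A \<inter> B \<in> range (\<lambda>(a, b). box a b)" by (auto simp: box_Int_box)
    qed
    have eq: "sets lborel = sigma_sets UNIV (range (\<lambda>(a, b). box a b :: 'a set))"
      by (simp add: borel_eq_box)
    have cl: "range (\<lambda>(a, b). box a b :: 'a set) \<subseteq> Pow UNIV" by simp
    have "A \<in> sigma_sets UNIV (range (\<lambda>(a, b). box a b :: 'a set))" using that eq by simp
    then show ?thesis
    proof (induction rule: sigma_sets_induct_disjoint[OF st cl, consumes 1, case_names basic empty compl union])
      case (basic A)
      then obtain a b where "A = box a b" by auto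
      then show ?case using box[of a b] by (simp add: set_lebesgue_integral_def)
    next
      case empty
      then show ?case by (simp add: set_lebesgue_integral_def)
    next
      case (compl A)
      then have A: "A \<in> sets lborel" by (simp only: eq)
      have iA: "integrable lborel (\<lambda>x. indicator A x * G x)"
        using integrable_mult_indicator[OF A G] by simp
      have "(LINT x:UNIV - A|lborel. G x) = (LINT x|lborel. G x - indicator A x * G x)"
        unfolding set_lebesgue_integral_def
        by (rule Bochner_Integration.integral_cong) (auto simp: indicator_def)
      also have "\<dots> = (LINT x|lborel. G x) - (LINT x|lborel. indicator A x * G x)"
        by (rule Bochner_Integration.integral_diff[OF G iA])
      also have "\<dots> = 0" using tot compl by (simp add: set_lebesgue_integral_def)
      finally show ?case .
    next
      case (union A)
      then have A: "A i \<in> sets lborel" for i unfolding eq by blast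
      have "(\<Union>i. A i) \<in> sets lborel" using A by blast
      from integrable_mult_indicator[OF this G]
      have "set_integrable lborel (\<Union>i. A i) G" by (simp add: set_integrable_def)
      then have "(LINT x:(\<Union>i. A i)|lborel. G x) = (\<Sum>i. (LINT x:(A i)|lborel. G x))"
        using A union(1) by (intro lebesgue_integral_countable_add) (auto simp: disjoint_family_on_def)
      moreover have "(LINT x:A i|lborel. G x) = 0" for i
        using union(3)[of i] A[of i] unfolding eq by blast
      ultimately show ?case by simp
    qed
  qed
  have "AE x in lborel. G x = 0"
    by (rule density_unique_real[OF G]) (simp_all add: meas)
  then show ?thesis by eventually_elim (auto simp: G_def)
qed

lemma AE_on_open_if_AE_on_boxes:
  fixes U :: "'a::euclidean_space set"
  assumes "open U" "\<And>c d. cbox c d \<subseteq> U \<Longrightarrow> AE x in lborel. x \<in> box c d \<longrightarrow> P x"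
  shows "AE x in lborel. x \<in> U \<longrightarrow> P x"
proof -
  obtain D where D: "countable D" "D \<subseteq> Pow U" "\<And>X. X \<in> D \<Longrightarrow> \<exists>a b. X = cbox a b" "\<Union>D = U"
    using open_countable_Union_open_cbox[OF assms(1)] by metis
  have "AE x in lborel. x \<in> X \<longrightarrow> P x" if X: "X \<in> D" for X
  proof -
    obtain a b where ab: "X = cbox a b" using D(3)[OF X] by auto
    have "cbox a b - box a b \<in> null_sets lborel"
      using negligible_frontier_interval[of a b]
      by (simp add: negligible_iff_null_sets null_sets_completion_iff)
    then have "AE x in lborel. x \<notin> cbox a b - box a b" by (rule AE_not_in)
    moreover have "AE x in lborel. x \<in> box a b \<longrightarrow> P x" using assms(2) X D(2) ab by auto
    ultimately show ?thesis by eventually_elim (auto simp: ab)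
  qed
  then have "AE x in lborel. \<forall>X\<in>D. x \<in> X \<longrightarrow> P x" using D(1) by (intro AE_ball_countable')
  then show ?thesis by eventually_elim (use D(4) in auto)
qed

lemma du_Bois_Reymond:
  fixes g :: "'a::euclidean_space \<Rightarrow> real"
  assumes "open U" "locally_integrable U g"
    and orth: "\<And>f. f \<in> test_functions U \<Longrightarrow> (LINT x:U|lborel. g x * f x) = 0"
  shows "AE x in lborel. x \<in> U \<longrightarrow> g x = 0"
proof (rule AE_on_open_if_AE_on_boxes[OF assms(1)])
  fix c d assume cd: "cbox c d \<subseteq> U"
  show "AE x in lborel. x \<in> box c d \<longrightarrow> g x = 0"
  proof (rule AE_zero_on_box)
    show "set_integrable lborel (cbox c d) g"
      using assms(2) cd by (simp add: locally_integrable_def)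
    fix a b n assume ab: "cbox a b \<subseteq> cbox c d"
    have "(\<lambda>x. 1 * box_bump (real n) a b x) \<in> test_functions U"
      using ab cd by (intro box_bump_test_function) auto
    then have "(LINT x:U|lborel. g x * box_bump (real n) a b x) = 0"
      using orth[of "box_bump (real n) a b"] by simp
    moreover have "indicator U x *\<^sub>R (g x * box_bump (real n) a b x)
        = indicator (cbox c d) x *\<^sub>R (g x * box_bump (real n) a b x)" for x
    proof (cases "x \<in> cbox c d")
      case False
      then have "x \<notin> box a b" using ab box_subset_cbox[of a b] by auto
      then show ?thesis by (simp add: box_bump_eq_0)
    qed (use cd in auto)
    ultimately show "(LINT x:cbox c d|lborel. g x * box_bump (real n) a b x) = 0"
      unfolding set_lebesgue_integral_def by (simp only:)
  qed
qed

subsection \<open>Weak gradients\<close>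

lemma has_weak_grad_locally_integrable:
  assumes "has_weak_grad U u G"
  shows "locally_integrable U u" "locally_integrable U G"
  using assms by (auto simp: has_weak_grad_def)

lemma set_integrable_times_grad:
  assumes "locally_integrable U u" "f \<in> test_functions U"
  shows "set_integrable lborel U (\<lambda>x. u x * (grad f x \<bullet> i))"
proof -
  obtain K where K: "compact K" "K \<subseteq> U" "\<And>x. x \<notin> K \<Longrightarrow> grad f x = 0"
    using test_function_support[OF assms(2)] by metis
  have "continuous_on UNIV (\<lambda>x. grad f x \<bullet> i)"
    using test_function_continuous_grad[OF assms(2)] by (intro continuous_intros)
  from set_integrable_compact_support_scaleR[OF assms(1) this K(1,2)] K(3)
  show ?thesis by (simp add: mult.commute)
qed

lemma set_integrable_times_test:
  fixes g :: "'a::euclidean_space \<Rightarrow> real"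
  assumes "locally_integrable U g" "f \<in> test_functions U"
  shows "set_integrable lborel U (\<lambda>x. g x * f x)"
proof -
  obtain K where K: "compact K" "K \<subseteq> U" "\<And>x. x \<notin> K \<Longrightarrow> f x = 0"
    using test_function_support[OF assms(2)] by metis
  from set_integrable_compact_support_scaleR[OF assms(1) test_function_continuous[OF assms(2)] K]
  show ?thesis by (simp add: mult.commute)
qed

lemma has_weak_grad_lincomb:
  assumes "has_weak_grad U u G" "has_weak_grad U v H"
  shows "has_weak_grad U (\<lambda>x. \<alpha> * u x + \<beta> * v x) (\<lambda>x. \<alpha> *\<^sub>R G x + \<beta> *\<^sub>R H x)"
  unfolding has_weak_grad_def
proof (intro conjI ballI)
  note li = has_weak_grad_locally_integrable[OF assms(1)] has_weak_grad_locally_integrable[OF assms(2)]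
  show "locally_integrable U (\<lambda>x. \<alpha> * u x + \<beta> * v x)"
    using locally_integrable_lincomb[OF li(1,3), of \<alpha> \<beta>] by simp
  show "locally_integrable U (\<lambda>x. \<alpha> *\<^sub>R G x + \<beta> *\<^sub>R H x)"
    by (rule locally_integrable_lincomb[OF li(2,4)])
  fix f :: "'a \<Rightarrow> real" and i :: 'a assume f: "f \<in> test_functions U" and i: "i \<in> Basis"
  note I1 = set_integrable_times_grad[OF li(1) f, of i] set_integrable_times_grad[OF li(3) f, of i]
  note I2 = set_integrable_times_test[OF locally_integrable_inner[OF li(2), of i] f]
    set_integrable_times_test[OF locally_integrable_inner[OF li(4), of i] f]
  have "(LINT x:U|lborel. (\<alpha> * u x + \<beta> * v x) * (grad f x \<bullet> i))
      = (LINT x:U|lborel. \<alpha> * (u x * (grad f x \<bullet> i)) + \<beta> * (v x * (grad f x \<bullet> i)))"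
    by (simp only: distrib_right mult.assoc)
  also have "\<dots> = \<alpha> * (LINT x:U|lborel. u x * (grad f x \<bullet> i)) + \<beta> * (LINT x:U|lborel. v x * (grad f x \<bullet> i))"
    using I1 by (subst set_integral_add(2)) auto
  also have "\<dots> = - (\<alpha> * (LINT x:U|lborel. (G x \<bullet> i) * f x) + \<beta> * (LINT x:U|lborel. (H x \<bullet> i) * f x))"
    using assms f i by (simp add: has_weak_grad_def)
  also have "\<dots> = - (LINT x:U|lborel. \<alpha> * ((G x \<bullet> i) * f x) + \<beta> * ((H x \<bullet> i) * f x))"
    using I2 by (subst set_integral_add(2)) auto
  also have "\<dots> = - (LINT x:U|lborel. ((\<alpha> *\<^sub>R G x + \<beta> *\<^sub>R H x) \<bullet> i) * f x)"
    by (simp only: inner_add_left inner_scaleR_left distrib_right mult.assoc)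
  finally show "(LINT x:U|lborel. (\<alpha> * u x + \<beta> * v x) * (grad f x \<bullet> i))
      = - (LINT x:U|lborel. ((\<alpha> *\<^sub>R G x + \<beta> *\<^sub>R H x) \<bullet> i) * f x)" .
qed

lemma has_weak_grad_subset:
  assumes "has_weak_grad U u G" "V \<subseteq> U"
  shows "has_weak_grad V u G"
  unfolding has_weak_grad_def
proof (intro conjI ballI)
  show "locally_integrable V u" "locally_integrable V G"
    using has_weak_grad_locally_integrable[OF assms(1)] assms(2)
    by (auto simp: locally_integrable_def)
  fix f :: "'a \<Rightarrow> real" and i :: 'a assume f: "f \<in> test_functions V" and i: "i \<in> Basis"
  obtain K where K: "K \<subseteq> V" "\<And>x. x \<notin> K \<Longrightarrow> f x = 0" "\<And>x. x \<notin> K \<Longrightarrow> grad f x = 0"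
    using test_function_support[OF f] by metis
  have "indicator V x *\<^sub>R (u x * (grad f x \<bullet> i)) = indicator U x *\<^sub>R (u x * (grad f x \<bullet> i))"
    "indicator V x *\<^sub>R ((G x \<bullet> i) * f x) = indicator U x *\<^sub>R ((G x \<bullet> i) * f x)" for x
    using K assms(2) by (cases "x \<in> K"; auto simp: indicator_def)+
  moreover have "(LINT x:U|lborel. u x * (grad f x \<bullet> i)) = - (LINT x:U|lborel. (G x \<bullet> i) * f x)"
    using assms f i test_functions_mono[OF assms(2)] by (auto simp: has_weak_grad_def)
  ultimately show "(LINT x:V|lborel. u x * (grad f x \<bullet> i)) = - (LINT x:V|lborel. (G x \<bullet> i) * f x)"
    unfolding set_lebesgue_integral_def by (simp only:)
qed

lemma has_weak_grad_AE_cong: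
  assumes "has_weak_grad U u G" "locally_integrable U v" "AE x in lborel. v x = u x"
  shows "has_weak_grad U v G"
  unfolding has_weak_grad_def
proof (intro conjI ballI)
  show "locally_integrable U v" "locally_integrable U G"
    using assms has_weak_grad_locally_integrable by auto
  fix f :: "'a \<Rightarrow> real" and i :: 'a assume f: "f \<in> test_functions U" and i: "i \<in> Basis"
  have "(LINT x:U|lborel. v x * (grad f x \<bullet> i)) = (LINT x:U|lborel. u x * (grad f x \<bullet> i))"
    unfolding set_lebesgue_integral_def
  proof (rule integral_cong_AE)
    show "(\<lambda>x. indicat_real U x *\<^sub>R (v x * (grad f x \<bullet> i))) \<in> borel_measurable lborel"
      "(\<lambda>x. indicat_real U x *\<^sub>R (u x * (grad f x \<bullet> i))) \<in> borel_measurable lborel"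
      using set_integrable_times_grad[OF _ f, of _ i] assms(2) has_weak_grad_locally_integrable(1)[OF assms(1)]
      unfolding set_integrable_def by blast+
    show "AE x in lborel. indicat_real U x *\<^sub>R (v x * (grad f x \<bullet> i)) = indicat_real U x *\<^sub>R (u x * (grad f x \<bullet> i))"
      using assms(3) by eventually_elim simp
  qed
  then show "(LINT x:U|lborel. v x * (grad f x \<bullet> i)) = - (LINT x:U|lborel. (G x \<bullet> i) * f x)"
    using assms(1) f i by (simp add: has_weak_grad_def)
qed

text \<open>
  Weak gradients are defined by an arbitrary choice for each function. Uniqueness makes the choice
  linear up to null sets.
\<close>

lemma has_weak_grad_unique:
  assumes "open U" "has_weak_grad U u G" "has_weak_grad U u H"
  shows "AE x in lborel. x \<in> U \<longrightarrow> G x = H x"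
proof -
  have W: "has_weak_grad U (\<lambda>x. 1 * u x + (-1) * u x) (\<lambda>x. 1 *\<^sub>R G x + (-1) *\<^sub>R H x)"
    by (rule has_weak_grad_lincomb[OF assms(2,3)])
  have "AE x in lborel. x \<in> U \<longrightarrow> (G x - H x) \<bullet> i = 0" if i: "i \<in> Basis" for i
  proof (rule du_Bois_Reymond[OF assms(1)])
    show "locally_integrable U (\<lambda>x. (G x - H x) \<bullet> i)"
      using locally_integrable_inner[OF has_weak_grad_locally_integrable(2)[OF W]] by simp
    show "(LINT x:U|lborel. ((G x - H x) \<bullet> i) * f x) = 0" if f: "f \<in> test_functions U" for f
      using W i f by (simp add: has_weak_grad_def)
  qed
  then have "AE x in lborel. \<forall>i\<in>Basis. x \<in> U \<longrightarrow> (G x - H x) \<bullet> i = 0"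
    by (intro AE_ball_countable') (auto intro: countable_finite)
  then show ?thesis
    by eventually_elim (auto simp: euclidean_eq_iff[of "G _"] inner_diff_left)
qed

lemma has_weak_grad_weak_grad: "has_weak_grad U u G \<Longrightarrow> has_weak_grad U u (weak_grad U u)"
  unfolding weak_grad_def by (rule someI[of "has_weak_grad U u"])

text \<open>
  Local integrability yields measurability on compact sets only; countably many cubes exhaust \<open>U\<close>.
\<close>

lemma locally_integrable_imp_measurable:
  fixes G :: "'a::euclidean_space \<Rightarrow> 'b::euclidean_space"
  assumes "open U" "locally_integrable U G"
  shows "(\<lambda>x. indicator U x *\<^sub>R G x) \<in> borel_measurable lborel"
proof -
  obtain D where D: "countable D" "D \<subseteq> Pow U" "\<And>X. X \<in> D \<Longrightarrow> \<exists>a b. X = cbox a b" "\<Union>D = U"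
    using open_countable_Union_open_cbox[OF assms(1)] by metis
  show ?thesis
  proof (rule measurable_piecewise_restrict[where C="insert (- U) D"])
    show "countable (insert (- U) D)" using D(1) by simp
    show "X \<inter> space lborel \<in> sets lborel" if "X \<in> insert (- U) D" for X
      using that D(3)[of X] assms(1) by auto
    show "space lborel \<subseteq> \<Union> (insert (- U) D)" using D(4) by auto
    fix X assume X: "X \<in> insert (- U) D"
    show "(\<lambda>x. indicator U x *\<^sub>R G x) \<in> borel_measurable (restrict_space lborel X)"
    proof (cases "X = - U")
      case True
      have eq: "indicator U x *\<^sub>R G x = 0" if "x \<in> space (restrict_space lborel X)" for x
        using that True by (simp add: space_restrict_space)
      show ?thesis
        by (rule measurable_cong[OF eq, THEN iffD2]) simp_all
    next
      case False
      with X D obtain a b where ab: "X = cbox a b" "cbox a b \<subseteq> U" by blast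
      then have "integrable lborel (\<lambda>x. indicator X x *\<^sub>R G x)"
        using assms(2) by (auto simp: locally_integrable_def set_integrable_def)
      then have m: "(\<lambda>x. indicator X x *\<^sub>R G x) \<in> borel_measurable (restrict_space lborel X)"
        by (intro measurable_restrict_space1 borel_measurable_integrable)
      have eq: "indicator U x *\<^sub>R G x = indicator X x *\<^sub>R G x"
        if "x \<in> space (restrict_space lborel X)" for x
        using that ab by (auto simp: space_restrict_space indicator_def)
      show ?thesis
        by (rule measurable_cong[of "restrict_space lborel X" "\<lambda>x. indicator U x *\<^sub>R G x"
              "\<lambda>x. indicator X x *\<^sub>R G x", THEN iffD2, OF eq m])
    qed
  qed
qed

subsection \<open>Integration by parts\<close>

lemma integral_translate:
  fixes F :: "'a::euclidean_space \<Rightarrow> 'b::euclidean_space"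
  assumes "F \<in> borel_measurable lborel"
  shows "(LINT x|lborel. F (h + x)) = (LINT x|lborel. F x)"
proof -
  have "(LINT x|lborel. F x) = (LINT x|distr lborel borel ((+) h). F x)"
    by (simp only: lborel_distr_plus)
  also have "\<dots> = (LINT x|lborel. F (h + x))"
    using assms by (intro integral_distr) auto
  finally show ?thesis ..
qed

lemma integrable_translate:
  fixes F :: "'a::euclidean_space \<Rightarrow> 'b::euclidean_space"
  assumes "integrable lborel F"
  shows "integrable lborel (\<lambda>x. F (h + x))"
proof -
  have "integrable (distr lborel borel ((+) h)) F"
    using assms by (simp only: lborel_distr_plus)
  then show ?thesis by (rule integrable_distr[rotated]) auto
qed

lemma Lipschitz_of_grad_bound:
  fixes F :: "'a::euclidean_space \<Rightarrow> real"
  assumes "\<And>x. F differentiable (at x)" "\<And>x. norm (grad F x) \<le> B"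
  shows "\<bar>F x - F y\<bar> \<le> B * norm (x - y)"
proof -
  have "norm (F x - F y) \<le> B * norm (x - y)"
  proof (rule differentiable_bound[of UNIV])
    show "(F has_derivative (\<lambda>h. grad F x \<bullet> h)) (at x within UNIV)" for x
      using has_derivative_grad[OF assms(1)] by simp
    show "onorm (\<lambda>h. grad F x \<bullet> h) \<le> B" for x
    proof (rule onorm_le)
      fix h show "norm (grad F x \<bullet> h) \<le> B * norm h"
        using Cauchy_Schwarz_ineq2[of "grad F x" h] assms(2)[of x]
        by (metis mult_right_mono norm_ge_zero order_trans real_norm_def)
    qed
  qed auto
  then show ?thesis by simp
qed

text \<open>
  This is the divergence theorem for compact support. Difference quotients of \<open>F\<close> have integral
  zero by translation invariance. They are bounded and supported in a fixed compact set, so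
  dominated convergence applies.
\<close>

lemma integral_grad_eq_0:
  fixes F :: "'a::euclidean_space \<Rightarrow> real"
  assumes d: "\<And>x. F differentiable (at x)" and c: "continuous_on UNIV (grad F)"
    and K: "compact K" "\<And>x. x \<notin> K \<Longrightarrow> F x = 0" "\<And>x. x \<notin> K \<Longrightarrow> grad F x = 0"
  shows "(LINT x|lborel. grad F x \<bullet> e) = 0"
proof -
  obtain B where B: "B \<ge> 0" "\<And>x. norm (grad F x) \<le> B"
    using bounded_of_compact_support[OF c K(1,3)] by metis
  have cF: "continuous_on UNIV F"
    using d by (simp add: continuous_at_imp_continuous_on differentiable_imp_continuous_within)
  have mF: "F \<in> borel_measurable lborel" using borel_measurable_continuous_onI[OF cF] by simp
  have iF: "integrable lborel F" by (rule integrable_of_compact_support[OF cF K(1,2)])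
  define t where "t n = inverse (real (Suc n))" for n
  have t: "t n > 0" "t n \<le> 1" for n by (auto simp: t_def field_simps)
  define q where "q n x = (F (t n *\<^sub>R e + x) - F x) / t n" for n x
  have mq: "q n \<in> borel_measurable lborel" for n
    unfolding q_def using integrable_translate[OF iF, of "t n *\<^sub>R e"] mF by measurable
  have q0: "(LINT x|lborel. q n x) = 0" for n
    unfolding q_def using integral_translate[OF mF, of "t n *\<^sub>R e"] integrable_translate[OF iF, of "t n *\<^sub>R e"] iF
    by simp
  define L where "L = {x + y |x y. x \<in> K \<and> y \<in> cball (0::'a) (norm e)}"
  have L: "compact L" unfolding L_def using K(1) by (intro compact_sums) auto
  have qL: "\<bar>q n x\<bar> \<le> B * norm e * indicator L x" for n x
  proof (cases "x \<in> L")
    case True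
    have "\<bar>F (t n *\<^sub>R e + x) - F x\<bar> \<le> B * (t n * norm e)"
      using Lipschitz_of_grad_bound[OF d B(2), of "t n *\<^sub>R e + x" x] t(1)[of n] by simp
    with True t(1)[of n] show ?thesis by (simp add: q_def field_simps)
  next
    case False
    have "x \<notin> K" using False by (auto simp: L_def intro!: exI[of _ x] exI[of _ 0])
    moreover have "t n *\<^sub>R e + x \<notin> K"
    proof
      assume "t n *\<^sub>R e + x \<in> K"
      moreover have "- (t n *\<^sub>R e) \<in> cball 0 (norm e)"
        using t[of n] by (simp add: mult_left_le_one_le)
      ultimately have "(t n *\<^sub>R e + x) + - (t n *\<^sub>R e) \<in> L" unfolding L_def by blast
      with False show False by simp
    qed
    ultimately show ?thesis using False K(2) by (simp add: q_def)
  qed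
  have lim: "(\<lambda>n. q n x) \<longlonglongrightarrow> grad F x \<bullet> e" for x
  proof -
    have D: "(F has_derivative (\<lambda>h. grad F x \<bullet> h)) (at x)" by (rule has_derivative_grad[OF d])
    have "((\<lambda>s. F (x + s *\<^sub>R e)) has_derivative (\<lambda>s. grad F x \<bullet> (s *\<^sub>R e))) (at 0)"
    proof (rule has_derivative_compose[of "\<lambda>s. x + s *\<^sub>R e" "\<lambda>s. s *\<^sub>R e"])
      show "((\<lambda>s. x + s *\<^sub>R e) has_derivative (\<lambda>s. s *\<^sub>R e)) (at 0)"
        by (auto intro!: derivative_eq_intros)
    qed (use D in simp)
    then have "((\<lambda>s. F (x + s *\<^sub>R e)) has_real_derivative (grad F x \<bullet> e)) (at 0)"
      by (simp add: has_field_derivative_def mult.commute[of _ "grad F x \<bullet> e"])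
    then have l: "((\<lambda>s. (F (x + s *\<^sub>R e) - F x) / s) \<longlongrightarrow> grad F x \<bullet> e) (at 0)"
      by (simp add: DERIV_def)
    have "filterlim t (at 0) sequentially"
      unfolding filterlim_at using t(1) LIMSEQ_inverse_real_of_nat
      by (auto simp: t_def[abs_def] intro!: always_eventually)
    from filterlim_compose[OF l this] show ?thesis by (simp add: q_def add.commute)
  qed
  have "(\<lambda>n. LINT x|lborel. q n x) \<longlonglongrightarrow> (LINT x|lborel. grad F x \<bullet> e)"
  proof (rule integral_dominated_convergence[where w="\<lambda>x. B * norm e * indicator L x"])
    have "(\<lambda>x. grad F x \<bullet> e) \<in> borel_measurable borel"
      using c by (intro borel_measurable_continuous_onI continuous_intros)
    then show "(\<lambda>x. grad F x \<bullet> e) \<in> borel_measurable lborel" by simp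
    show "integrable lborel (\<lambda>x. B * norm e * indicator L x)"
      using borel_integrable_compact[OF L continuous_on_const[of L "1::real"]] by simp
  qed (use mq lim qL in auto)
  then show ?thesis by (simp add: q0 LIMSEQ_const_iff)
qed

text \<open>The integral of the gradient of the product \<open>\<psi> f\<close> vanishes.\<close>

lemma has_weak_grad_test_function:
  assumes "\<psi> \<in> test_functions UNIV"
  shows "has_weak_grad UNIV \<psi> (grad \<psi>)"
  unfolding has_weak_grad_def
proof (intro conjI ballI)
  show li: "locally_integrable UNIV \<psi>" "locally_integrable UNIV (grad \<psi>)"
    using test_function_continuous[OF assms] test_function_continuous_grad[OF assms]
    by (auto intro: locally_integrable_continuous)
  fix f :: "'a \<Rightarrow> real" and i :: 'a assume f: "f \<in> test_functions UNIV" and i: "i \<in> Basis"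
  note d = test_function_differentiable[OF assms] test_function_differentiable[OF f]
  obtain K where K: "compact K" "\<And>x. x \<notin> K \<Longrightarrow> f x = 0" "\<And>x. x \<notin> K \<Longrightarrow> grad f x = 0"
    using test_function_support[OF f] by metis
  have gr: "grad (\<lambda>x. \<psi> x * f x) x = \<psi> x *\<^sub>R grad f x + f x *\<^sub>R grad \<psi> x" for x
    by (rule grad_mult[OF d])
  have "(LINT x|lborel. grad (\<lambda>x. \<psi> x * f x) x \<bullet> i) = 0"
  proof (rule integral_grad_eq_0[OF _ _ K(1)])
    show "(\<lambda>x. \<psi> x * f x) differentiable at x" for x using d by (intro differentiable_mult)
    show "continuous_on UNIV (grad (\<lambda>x. \<psi> x * f x))"
      unfolding gr[abs_def]
      by (intro continuous_intros test_function_continuous[OF f] test_function_continuous[OF assms]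
          test_function_continuous_grad[OF f] test_function_continuous_grad[OF assms])
  qed (use K gr in auto)
  moreover have "integrable lborel (\<lambda>x. \<psi> x * (grad f x \<bullet> i))"
    "integrable lborel (\<lambda>x. (grad \<psi> x \<bullet> i) * f x)"
    using set_integrable_times_grad[OF li(1) f, of i]
      set_integrable_times_test[OF locally_integrable_inner[OF li(2), of i] f]
    by (simp_all add: set_integrable_def)
  ultimately show "(LINT x:UNIV|lborel. \<psi> x * (grad f x \<bullet> i)) = - (LINT x:UNIV|lborel. (grad \<psi> x \<bullet> i) * f x)"
    by (simp add: gr inner_add_left set_lebesgue_integral_def mult.commute[of "f _"])
qed

section \<open>The Gagliardo seminorm of test functions\<close>

lemma nn_integral_translate:
  fixes F :: "'a::euclidean_space \<Rightarrow> ennreal"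
  assumes "F \<in> borel_measurable lborel"
  shows "(\<integral>\<^sup>+x. F (h + x) \<partial>lborel) = (\<integral>\<^sup>+x. F x \<partial>lborel)"
proof -
  have "(\<integral>\<^sup>+x. F x \<partial>lborel) = (\<integral>\<^sup>+x. F x \<partial>distr lborel borel ((+) h))"
    by (simp only: lborel_distr_plus)
  also have "\<dots> = (\<integral>\<^sup>+x. F (h + x) \<partial>lborel)"
    using assms by (intro nn_integral_distr) auto
  finally show ?thesis ..
qed

subsection \<open>Radial integrals\<close>

text \<open>
  A function that is at most \<open>c k\<close> on a dyadic shell inside the ball of radius \<open>r k\<close> is dominated
  by the sum of \<open>c k\<close> times the indicators of these balls.
\<close>

lemma nn_integral_finite_dyadic:
  fixes w :: "'a::euclidean_space \<Rightarrow> ennreal" and c r :: "nat \<Rightarrow> real"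
  assumes shell: "\<And>h. w h \<noteq> 0 \<Longrightarrow> \<exists>k. norm h < r k \<and> w h \<le> ennreal (c k)"
    and c: "\<And>k. 0 \<le> c k" and r: "\<And>k. 0 \<le> r k"
    and geo: "\<And>k. c k * r k ^ DIM('a) = D * q ^ k" and q: "0 \<le> q" "q < 1"
  shows "(\<integral>\<^sup>+h. w h \<partial>lborel) < \<infinity>"
proof -
  let ?\<omega> = "unit_ball_vol (real DIM('a))"
  have "w h \<le> (\<Sum>k. ennreal (c k) * indicator (ball 0 (r k)) h)" for h
  proof (cases "w h = 0")
    case False
    then obtain k where k: "norm h < r k" "w h \<le> ennreal (c k)" using shell by blast
    have "w h \<le> ennreal (c k) * indicator (ball 0 (r k)) h" using k by simp
    also have "\<dots> \<le> (\<Sum>k. ennreal (c k) * indicator (ball 0 (r k)) h)"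
    proof -
      define g where "g j = ennreal (c j) * indicator (ball 0 (r j)) h" for j
      have "sum g {k} \<le> suminf g" by (rule sum_le_suminf) auto
      then have "g k \<le> suminf g" by simp
      then show ?thesis by (simp only: g_def[abs_def])
    qed
    finally show ?thesis .
  qed simp
  then have "(\<integral>\<^sup>+h. w h \<partial>lborel) \<le> (\<integral>\<^sup>+h. (\<Sum>k. ennreal (c k) * indicator (ball 0 (r k)) h) \<partial>(lborel::'a measure))"
    by (intro nn_integral_mono)
  also have "\<dots> = (\<Sum>k. \<integral>\<^sup>+h. ennreal (c k) * indicator (ball 0 (r k)) h \<partial>(lborel::'a measure))"
  proof (rule nn_integral_suminf)
    fix k
    have "ball (0::'a) (r k) \<in> sets lborel" by simp
    then show "(\<lambda>h::'a. ennreal (c k) * indicator (ball 0 (r k)) h) \<in> borel_measurable lborel"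
      by (intro borel_measurable_times_ennreal borel_measurable_const borel_measurable_indicator)
  qed
  also have "\<dots> = (\<Sum>k. ennreal ((?\<omega> * D) * q ^ k))"
  proof (rule suminf_cong)
    fix k
    have "(\<integral>\<^sup>+h. ennreal (c k) * indicator (ball 0 (r k)) h \<partial>(lborel::'a measure))
        = ennreal (c k) * ennreal (?\<omega> * r k ^ DIM('a))"
      using emeasure_ball[OF r[of k], of "0::'a"] by (simp add: nn_integral_cmult_indicator)
    also have "\<dots> = ennreal (?\<omega> * (c k * r k ^ DIM('a)))"
      using c[of k] by (simp add: ennreal_mult'[symmetric] mult_ac)
    finally show "(\<integral>\<^sup>+h. ennreal (c k) * indicator (ball 0 (r k)) h \<partial>(lborel::'a measure))
        = ennreal ((?\<omega> * D) * q ^ k)"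
      by (simp add: geo mult.assoc)
  qed
  also have "\<dots> < \<infinity>"
  proof -
    have "D \<ge> 0" using geo[of 0] c[of 0] r[of 0] by (metis mult_nonneg_nonneg mult.right_neutral power_0 zero_le_power)
    then have "(\<Sum>k. ennreal ((?\<omega> * D) * q ^ k)) \<noteq> top"
      using q by (intro ennreal_suminf_neq_top summable_mult summable_geometric) auto
    then show ?thesis by (simp add: less_top)
  qed
  finally show ?thesis .
qed

lemma dyadic_shell:
  fixes x :: real
  assumes "x > 0"
  obtains m :: int where "2 powr m \<le> x" "x < 2 powr (m + 1)"
proof -
  have "2 powr real_of_int \<lfloor>log 2 x\<rfloor> \<le> 2 powr log 2 x" by (intro powr_mono) auto
  moreover have "2 powr log 2 x < 2 powr (real_of_int \<lfloor>log 2 x\<rfloor> + 1)"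
    by (intro powr_less_mono) linarith+
  ultimately show thesis using that[of "\<lfloor>log 2 x\<rfloor>"] assms by simp
qed

text \<open>
  The exponents are written as \<open>\<alpha> - N\<close> and \<open>- \<beta> - N\<close>, so that the contributions of the shells are
  geometric with ratios \<open>2 powr - \<alpha>\<close> and \<open>2 powr - \<beta>\<close>.
\<close>

lemma nn_integral_norm_powr_ball:
  assumes "\<alpha> > 0"
  shows "(\<integral>\<^sup>+h. ennreal (norm h powr (\<alpha> - real DIM('a)) * indicator (ball 0 1) h) \<partial>(lborel :: 'a::euclidean_space measure)) < \<infinity>"
proof -
  define N where "N = real DIM('a)"
  have N: "N > 0" by (simp add: N_def)
  show ?thesis
  proof (rule nn_integral_finite_dyadic[where D="2 powr N" and q="2 powr (- \<alpha>)"
      and r="\<lambda>k. 2 powr (- real k)" and c="\<lambda>k. 2 powr (N + real k * (N - \<alpha>))"])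
    fix h :: 'a assume "ennreal (norm h powr (\<alpha> - real DIM('a)) * indicator (ball 0 1) h) \<noteq> 0"
    then have h: "h \<noteq> 0" "norm h < 1"
      by (auto simp: indicator_def split: if_splits)
    obtain m :: int where m: "2 powr m \<le> norm h" "norm h < 2 powr (m + 1)"
      using dyadic_shell[of "norm h"] h by auto
    have "2 powr m < 2 powr (0::real)" using m(1) h(2) by simp
    then have "m < 0" by (simp only: powr_less_cancel_iff[of 2] of_int_less_0_iff) 
    define k where "k = nat (- m - 1)"
    have k: "real_of_int m = - real k - 1" using \<open>m < 0\<close> by (simp add: k_def)
    have "norm h powr (\<alpha> - N) = norm h powr \<alpha> * norm h powr (- N)"
      by (simp add: powr_add[symmetric])
    also have "\<dots> \<le> (2 powr (- real k)) powr \<alpha> * (2 powr (- real k - 1)) powr (- N)"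
    proof (rule mult_mono)
      have "norm h \<le> 2 powr (- real k)" using m(2) k by simp
      then show "norm h powr \<alpha> \<le> (2 powr (- real k)) powr \<alpha>"
        using assms by (intro powr_mono2) auto
      have "2 powr (- real k - 1) \<le> norm h" using m(1) unfolding k .
      then show "norm h powr (- N) \<le> (2 powr (- real k - 1)) powr (- N)"
        using N by (intro powr_mono2') auto
    qed simp_all
    also have "\<dots> = 2 powr (N + real k * (N - \<alpha>))"
      by (simp add: powr_powr powr_add[symmetric] algebra_simps)
    finally have "norm h powr (\<alpha> - N) \<le> 2 powr (N + real k * (N - \<alpha>))" .
    then have "ennreal (norm h powr (\<alpha> - real DIM('a)) * indicator (ball 0 1) h)
        \<le> ennreal (2 powr (N + real k * (N - \<alpha>)))"
      using h by (intro ennreal_leI) (simp add: N_def)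
    moreover have "norm h < 2 powr (- real k)" using m(2) k by simp
    ultimately show "\<exists>k. norm h < 2 powr (- real k) \<and>
       ennreal (norm h powr (\<alpha> - real DIM('a)) * indicator (ball 0 1) h) \<le> ennreal (2 powr (N + real k * (N - \<alpha>)))"
      by blast
  next
    fix k
    show "2 powr (N + real k * (N - \<alpha>)) * (2 powr (- real k)) ^ DIM('a) = 2 powr N * (2 powr (- \<alpha>)) ^ k"
      by (simp add: powr_realpow[symmetric] powr_powr powr_add[symmetric] N_def[symmetric] algebra_simps)
    show "2 powr (- \<alpha>) < 1" using powr_less_mono[of "- \<alpha>" 0 2] assms by simp
  qed simp_all
qed

lemma nn_integral_norm_powr_outside_ball:
  assumes "\<beta> > 0"
  shows "(\<integral>\<^sup>+h. ennreal (norm h powr (- \<beta> - real DIM('a)) * indicator (- ball 0 1) h) \<partial>(lborel :: 'a::euclidean_space measure)) < \<infinity>"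
proof -
  define N where "N = real DIM('a)"
  have N: "N > 0" by (simp add: N_def)
  show ?thesis
  proof (rule nn_integral_finite_dyadic[where D="2 powr N" and q="2 powr (- \<beta>)"
      and r="\<lambda>k. 2 powr (real k + 1)" and c="\<lambda>k. 2 powr (real k * (- \<beta> - N))"])
    fix h :: 'a assume "ennreal (norm h powr (- \<beta> - real DIM('a)) * indicator (- ball 0 1) h) \<noteq> 0"
    then have h: "norm h \<ge> 1"
      by (auto simp: indicator_def split: if_splits)
    then have "norm h > 0" by linarith
    then obtain m :: int where m: "2 powr m \<le> norm h" "norm h < 2 powr (m + 1)"
      by (rule dyadic_shell)
    have "2 powr (0::real) < 2 powr (real_of_int (m + 1))" using m(2) h by simp
    then have "0 < m + 1" by (simp only: powr_less_cancel_iff[of 2] of_int_0_less_iff)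
    define k where "k = nat m"
    have k: "real_of_int m = real k" using \<open>0 < m + 1\<close> by (simp add: k_def)
    have "norm h powr (- \<beta> - N) \<le> (2 powr real k) powr (- \<beta> - N)"
      using m h assms N unfolding k by (intro powr_mono2') auto
    also have "\<dots> = 2 powr (real k * (- \<beta> - N))" by (simp add: powr_powr)
    finally have "ennreal (norm h powr (- \<beta> - real DIM('a)) * indicator (- ball 0 1) h)
        \<le> ennreal (2 powr (real k * (- \<beta> - N)))"
      using h by (intro ennreal_leI) (simp add: N_def)
    moreover have "norm h < 2 powr (real k + 1)" using m(2) by (simp add: k)
    ultimately show "\<exists>k. norm h < 2 powr (real k + 1) \<and>
       ennreal (norm h powr (- \<beta> - real DIM('a)) * indicator (- ball 0 1) h) \<le> ennreal (2 powr (real k * (- \<beta> - N)))"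
      by blast
  next
    fix k
    show "2 powr (real k * (- \<beta> - N)) * (2 powr (real k + 1)) ^ DIM('a) = 2 powr N * (2 powr (- \<beta>)) ^ k"
      by (simp add: powr_realpow[symmetric] powr_powr powr_add[symmetric] N_def[symmetric] algebra_simps)
    show "2 powr (- \<beta>) < 1" using powr_less_mono[of "- \<beta>" 0 2] assms by simp
  qed simp_all
qed

subsection \<open>Translations of test functions\<close>

text \<open>
  Jensen's inequality on the unit interval. With \<open>c\<close> the mean of \<open>g\<close>, Young's inequality bounds
  \<open>c powr (p - 1) * g t\<close> by \<open>g t powr p / p + c powr p / q\<close>; integrating gives the claim.
\<close>

lemma powr_integral_le_integral_powr:
  fixes g :: "real \<Rightarrow> real"
  assumes p: "1 < p" and g: "continuous_on UNIV g" "\<And>t. 0 \<le> g t"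
  shows "(LINT t:{0..1}|lborel. g t) powr p \<le> (LINT t:{0..1}|lborel. g t powr p)"
proof -
  define c where "c = (LINT t:{0..1}|lborel. g t)"
  define q where "q = p / (p - 1)"
  have q: "q > 1" "1 / p + 1 / q = 1" "(p - 1) * q = p" using p by (auto simp: q_def field_simps)
  have ig: "set_integrable lborel {0..1} g"
    unfolding set_integrable_def using g(1)
    by (intro borel_integrable_compact) (auto intro: continuous_on_subset)
  have igp: "set_integrable lborel {0..1} (\<lambda>t. g t powr p)"
    unfolding set_integrable_def using g p
    by (intro borel_integrable_compact continuous_on_powr') (auto intro: continuous_on_subset)
  have ic: "set_integrable lborel {0..1::real} (\<lambda>t. K)" for K :: real
    unfolding set_integrable_def by (intro borel_integrable_compact) auto
  have Ic: "(LINT t:{0..1::real}|lborel. K) = K" for K :: real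
    by (simp add: set_lebesgue_integral_def)
  have c0: "c \<ge> 0" unfolding c_def set_lebesgue_integral_def
    using g(2) by (intro integral_nonneg_AE AE_I2) (auto simp: indicator_def)
  have young: "c powr (p - 1) * g t \<le> (1 / p) * g t powr p + (1 / q) * c powr p" for t
    using Youngs_inequality[of p q "g t" "c powr (p - 1)"] p q g(2)[of t]
    by (simp add: powr_powr mult.commute)
  have ib: "set_integrable lborel {0..1} (\<lambda>t. (1 / p) * g t powr p + (1 / q) * c powr p)"
    by (rule set_integral_add(1)[OF set_integrable_mult_right[OF igp] ic])
  have "(LINT t:{0..1}|lborel. c powr (p - 1) * g t)
      \<le> (LINT t:{0..1}|lborel. (1 / p) * g t powr p + (1 / q) * c powr p)"
    by (rule set_integral_mono[OF set_integrable_mult_right[OF ig] ib young])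
  also have "\<dots> = (LINT t:{0..1}|lborel. (1 / p) * g t powr p) + (LINT t:{0..1::real}|lborel. (1 / q) * c powr p)"
    using set_integrable_mult_right[OF igp, of "1 / p"] ic[of "1 / q * c powr p"]
    by (rule set_integral_add(2))
  also have "\<dots> = (1 / p) * (LINT t:{0..1}|lborel. g t powr p) + (1 / q) * c powr p"
    by (simp only: set_integral_mult_right Ic)
  finally have *: "c powr (p - 1) * c \<le> (1 / p) * (LINT t:{0..1}|lborel. g t powr p) + (1 / q) * c powr p"
    by (simp only: set_integral_mult_right c_def[symmetric])
  have "c powr (p - 1) * c = c powr p"
  proof (cases "c = 0")
    case False
    with c0 have "c powr (p - 1) * c powr 1 = c powr p" by (simp only: powr_add[symmetric]) simp
    with False c0 show ?thesis by simp
  qed simp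
  moreover have "1 / q = 1 - 1 / p" using q(2) by simp
  ultimately have "(1 / p) * c powr p \<le> (1 / p) * (LINT t:{0..1}|lborel. g t powr p)"
    using * by (simp add: left_diff_distrib)
  then show ?thesis using p by (simp add: c_def[symmetric] divide_le_cancel)
qed

text \<open>The fundamental theorem of calculus on the segment from \<open>x\<close> to \<open>h + x\<close>, followed by Jensen.\<close>

lemma test_function_increment_powr:
  assumes p: "1 < p" and f: "f \<in> test_functions UNIV"
  shows "ennreal (\<bar>f (h + x) - f x\<bar> powr p)
    \<le> (\<integral>\<^sup>+t. ennreal (norm h powr p) * ennreal (norm (grad f (t *\<^sub>R h + x)) powr p) * indicator {0..1} t \<partial>lborel)"
proof -
  define g where "g t = \<bar>grad f (t *\<^sub>R h + x) \<bullet> h\<bar>" for t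
  have cg: "continuous_on UNIV (\<lambda>t. grad f (t *\<^sub>R h + x) \<bullet> h)"
    by (intro continuous_intros continuous_on_compose2[OF test_function_continuous_grad[OF f]]) auto
  then have g: "continuous_on UNIV g" "\<And>t. 0 \<le> g t"
    unfolding g_def by (auto intro: continuous_intros)
  have D: "((\<lambda>t. f (t *\<^sub>R h + x)) has_vector_derivative grad f (t *\<^sub>R h + x) \<bullet> h) (at t within {0..1})" for t
  proof -
    have "((\<lambda>t. t *\<^sub>R h + x) has_derivative (\<lambda>s. s *\<^sub>R h)) (at t within {0..1})"
      by (auto intro!: derivative_eq_intros)
    from has_derivative_compose[OF this has_derivative_grad[OF test_function_differentiable[OF f]]]
    show ?thesis by (simp add: has_vector_derivative_def)
  qed
  have "f (h + x) - f x = (LINT t:{0..1}|lborel. grad f (t *\<^sub>R h + x) \<bullet> h)"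
    using integral_FTC_Icc[of 0 1 "\<lambda>t. f (t *\<^sub>R h + x)" "\<lambda>t. grad f (t *\<^sub>R h + x) \<bullet> h"]
      D continuous_on_subset[OF cg]
    by (simp add: set_lebesgue_integral_def)
  then have "\<bar>f (h + x) - f x\<bar> \<le> (LINT t:{0..1}|lborel. g t)"
    unfolding g_def set_lebesgue_integral_def
    using integral_abs_bound[of lborel "\<lambda>t. indicator {0..1} t *\<^sub>R (grad f (t *\<^sub>R h + x) \<bullet> h)"]
    by (simp add: abs_mult)
  then have "\<bar>f (h + x) - f x\<bar> powr p \<le> (LINT t:{0..1}|lborel. g t) powr p"
    using p by (intro powr_mono2) auto
  also have "\<dots> \<le> (LINT t:{0..1}|lborel. g t powr p)"
    by (rule powr_integral_le_integral_powr[OF p g])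
  finally have "ennreal (\<bar>f (h + x) - f x\<bar> powr p) \<le> ennreal (LINT t|lborel. indicator {0..1} t * g t powr p)"
    by (simp add: set_lebesgue_integral_def ennreal_leI)
  also have "\<dots> = (\<integral>\<^sup>+t. ennreal (indicator {0..1} t * g t powr p) \<partial>lborel)"
  proof (rule nn_integral_eq_integral[symmetric])
    have "integrable lborel (\<lambda>t. indicator {0..1} t *\<^sub>R g t powr p)"
      using g p by (intro borel_integrable_compact continuous_on_powr') (auto intro: continuous_on_subset)
    then show "integrable lborel (\<lambda>t. indicator {0..1} t * g t powr p)" by simp
  qed simp
  also have "\<dots> \<le> (\<integral>\<^sup>+t. ennreal (norm h powr p) * ennreal (norm (grad f (t *\<^sub>R h + x)) powr p) * indicator {0..1} t \<partial>lborel)"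
  proof (rule nn_integral_mono)
    fix t
    have "g t powr p \<le> (norm h * norm (grad f (t *\<^sub>R h + x))) powr p"
      unfolding g_def using p Cauchy_Schwarz_ineq2[of "grad f (t *\<^sub>R h + x)" h]
      by (intro powr_mono2) (auto simp: mult.commute)
    then have "ennreal (g t powr p) \<le> ennreal (norm h powr p) * ennreal (norm (grad f (t *\<^sub>R h + x)) powr p)"
      by (simp add: powr_mult ennreal_mult'[symmetric] ennreal_leI)
    then show "ennreal (indicator {0..1} t * g t powr p)
      \<le> ennreal (norm h powr p) * ennreal (norm (grad f (t *\<^sub>R h + x)) powr p) * indicator {0..1} t"
      by (simp add: indicator_def)
  qed
  finally show ?thesis .
qed

lemma test_function_measurable:
  assumes "f \<in> test_functions U"
  shows "f \<in> borel_measurable borel" "grad f \<in> borel_measurable borel"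
  by (rule borel_measurable_continuous_onI[OF test_function_continuous[OF assms]])
     (rule borel_measurable_continuous_onI[OF test_function_continuous_grad[OF assms]])

lemma test_function_translation_small:
  fixes f :: "'a::euclidean_space \<Rightarrow> real"
  assumes p: "1 < p" and f: "f \<in> test_functions UNIV"
  shows "(\<integral>\<^sup>+x. ennreal (\<bar>f (h + x) - f x\<bar> powr p) \<partial>lborel)
    \<le> ennreal (norm h powr p) * (\<integral>\<^sup>+x. ennreal (norm (grad f x) powr p) \<partial>lborel)"
proof -
  note [measurable] = test_function_measurable[OF f]
  define A where "A = (\<integral>\<^sup>+x. ennreal (norm (grad f x) powr p) \<partial>lborel)"
  let ?k = "\<lambda>(x::'a) t::real. ennreal (norm h powr p) * ennreal (norm (grad f (t *\<^sub>R h + x)) powr p) * indicator {0..1} t"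
  have inner: "(\<integral>\<^sup>+x. ?k x t \<partial>lborel) = ennreal (norm h powr p) * A * indicator {0..1} t" for t
  proof -
    have "(\<integral>\<^sup>+x. ?k x t \<partial>lborel)
        = (\<integral>\<^sup>+x. ennreal (norm h powr p) * ennreal (norm (grad f (t *\<^sub>R h + x)) powr p) \<partial>lborel) * indicator {0..1} t"
      by (rule nn_integral_multc) measurable
    also have "\<dots> = ennreal (norm h powr p) * (\<integral>\<^sup>+x. ennreal (norm (grad f (t *\<^sub>R h + x)) powr p) \<partial>lborel) * indicator {0..1} t"
      by (subst nn_integral_cmult) simp_all
    also have "(\<integral>\<^sup>+x. ennreal (norm (grad f (t *\<^sub>R h + x)) powr p) \<partial>lborel) = A"
      unfolding A_def by (rule nn_integral_translate[of "\<lambda>x. ennreal (norm (grad f x) powr p)"]) measurable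
    finally show ?thesis .
  qed
  have "(\<integral>\<^sup>+x. ennreal (\<bar>f (h + x) - f x\<bar> powr p) \<partial>lborel) \<le> (\<integral>\<^sup>+x. (\<integral>\<^sup>+t. ?k x t \<partial>lborel) \<partial>lborel)"
    by (intro nn_integral_mono test_function_increment_powr[OF p f])
  also have "\<dots> = (\<integral>\<^sup>+t. (\<integral>\<^sup>+x. ?k x t \<partial>lborel) \<partial>lborel)"
    by (rule lborel_pair.Fubini'[symmetric]) measurable
  also have "\<dots> = (\<integral>\<^sup>+t. ennreal (norm h powr p) * A * indicator {0..1} t \<partial>(lborel::real measure))"
    by (simp only: inner)
  also have "\<dots> = ennreal (norm h powr p) * A"
    by (subst nn_integral_cmult_indicator) simp_all
  finally show ?thesis by (simp only: A_def)
qed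

lemma powr_diff_le:
  fixes a b :: real
  assumes "p > 0"
  shows "\<bar>a - b\<bar> powr p \<le> 2 powr p * (\<bar>a\<bar> powr p + \<bar>b\<bar> powr p)"
proof -
  have "\<bar>a - b\<bar> powr p \<le> (2 * max \<bar>a\<bar> \<bar>b\<bar>) powr p"
    using assms by (intro powr_mono2) auto
  also have "\<dots> = 2 powr p * max \<bar>a\<bar> \<bar>b\<bar> powr p" by (rule powr_mult)
  also have "\<dots> \<le> 2 powr p * (\<bar>a\<bar> powr p + \<bar>b\<bar> powr p)"
    by (intro mult_left_mono) (auto simp: max_def)
  finally show ?thesis .
qed

lemma translation_large:
  fixes f :: "'a::euclidean_space \<Rightarrow> real"
  assumes p: "0 < p" and f[measurable]: "f \<in> borel_measurable borel"
  shows "(\<integral>\<^sup>+x. ennreal (\<bar>f (h + x) - f x\<bar> powr p) \<partial>lborel)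
    \<le> ennreal (2 powr p) * (2 * (\<integral>\<^sup>+x. ennreal (\<bar>f x\<bar> powr p) \<partial>lborel))"
proof -
  have "(\<integral>\<^sup>+x. ennreal (\<bar>f (h + x) - f x\<bar> powr p) \<partial>lborel)
      \<le> (\<integral>\<^sup>+x. ennreal (2 powr p) * (ennreal (\<bar>f (h + x)\<bar> powr p) + ennreal (\<bar>f x\<bar> powr p)) \<partial>lborel)"
  proof (rule nn_integral_mono)
    fix x
    show "ennreal (\<bar>f (h + x) - f x\<bar> powr p)
      \<le> ennreal (2 powr p) * (ennreal (\<bar>f (h + x)\<bar> powr p) + ennreal (\<bar>f x\<bar> powr p))"
      using powr_diff_le[OF p, of "f (h + x)" "f x"]
      by (simp add: ennreal_plus[symmetric] ennreal_mult'[symmetric] ennreal_leI del: ennreal_plus)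
  qed
  also have "\<dots> = ennreal (2 powr p) * ((\<integral>\<^sup>+x. ennreal (\<bar>f (h + x)\<bar> powr p) \<partial>lborel) + (\<integral>\<^sup>+x. ennreal (\<bar>f x\<bar> powr p) \<partial>lborel))"
    by (subst nn_integral_cmult) (simp_all add: nn_integral_add)
  also have "(\<integral>\<^sup>+x. ennreal (\<bar>f (h + x)\<bar> powr p) \<partial>lborel) = (\<integral>\<^sup>+x. ennreal (\<bar>f x\<bar> powr p) \<partial>lborel)"
    by (rule nn_integral_translate[of "\<lambda>x. ennreal (\<bar>f x\<bar> powr p)"]) measurable
  finally show ?thesis by (simp add: mult_2)
qed

subsection \<open>The fractional energy is controlled by the Sobolev norm\<close>

text \<open>
  The Bochner integral is 0 by convention when it diverges. The extended version can express that
  the energy is finite.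
\<close>

definition gagliardo_nn :: "real \<Rightarrow> real \<Rightarrow> ('a::euclidean_space \<Rightarrow> real) \<Rightarrow> ennreal" where
  "gagliardo_nn p s u =
     (\<integral>\<^sup>+x. \<integral>\<^sup>+y. ennreal (\<bar>u x - u y\<bar> powr p / norm (x - y) powr (real DIM('a) + p * s)) \<partial>lborel \<partial>lborel)"

text \<open>
  In the variable \<open>h = y - x\<close>, translations by \<open>h\<close> cost \<open>\<bar>h\<bar> powr p\<close> times the local energy, which
  makes the kernel integrable on the unit ball as \<open>s < 1\<close>. Outside the ball the kernel itself is
  integrable as \<open>s > 0\<close>, and the crude bound by the \<open>L\<^sup>p\<close> norm suffices.
\<close>

lemma gagliardo_nn_test_function:
  assumes p: "1 < p" and s: "0 < s" "s < 1"
  obtains C where "C > 0"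
    "\<And>f :: 'a::euclidean_space \<Rightarrow> real. f \<in> test_functions UNIV \<Longrightarrow>
       gagliardo_nn p s f \<le> ennreal C * ((\<integral>\<^sup>+x. ennreal (norm (grad f x) powr p) \<partial>lborel)
         + (\<integral>\<^sup>+x. ennreal (\<bar>f x\<bar> powr p) \<partial>lborel))"
proof -
  let ?N = "real DIM('a)"
  let ?i = "\<lambda>h::'a. ennreal (norm h powr (p * (1 - s) - ?N) * indicator (ball 0 1) h)"
  let ?o = "\<lambda>h::'a. ennreal (norm h powr (- (p * s) - ?N) * indicator (- ball 0 1) h)"
  define C1 where "C1 = (\<integral>\<^sup>+h. ?i h \<partial>lborel)"
  define C2 where "C2 = (\<integral>\<^sup>+h. ?o h \<partial>lborel)"
  have C12: "C1 < \<infinity>" "C2 < \<infinity>"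
    unfolding C1_def C2_def using p s
    by (intro nn_integral_norm_powr_ball nn_integral_norm_powr_outside_ball; simp)+
  define C where "C = 1 + enn2real C1 + 2 powr p * 2 * enn2real C2"
  have C: "C > 0" unfolding C_def by (intro add_pos_nonneg) simp_all
  have C1: "C1 \<le> ennreal C"
  proof -
    have "C1 = ennreal (enn2real C1)" using C12 by (simp add: less_top)
    also have "\<dots> \<le> ennreal C" by (intro ennreal_leI) (simp add: C_def)
    finally show ?thesis .
  qed
  have C2: "C2 * (ennreal (2 powr p) * 2) \<le> ennreal C"
  proof -
    have "C2 = ennreal (enn2real C2)" using C12 by (simp add: less_top)
    then have "C2 * (ennreal (2 powr p) * 2) = ennreal (enn2real C2) * (ennreal (2 powr p) * ennreal 2)"
      by simp
    also have "\<dots> = ennreal (enn2real C2 * (2 powr p * 2))" 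
      by (simp add: ennreal_mult)
    also have "\<dots> \<le> ennreal C" by (intro ennreal_leI) (simp add: C_def)
    finally show ?thesis .
  qed
  show thesis
  proof (rule that[OF C])
    fix f :: "'a \<Rightarrow> real" assume f: "f \<in> test_functions UNIV"
    note [measurable] = test_function_measurable[OF f]
    define A where "A = (\<integral>\<^sup>+x. ennreal (norm (grad f x) powr p) \<partial>lborel)"
    define F where "F = (\<integral>\<^sup>+x. ennreal (\<bar>f x\<bar> powr p) \<partial>lborel)"
    let ?k = "\<lambda>(x::'a) h. ennreal (\<bar>f (h + x) - f x\<bar> powr p / norm h powr (?N + p * s))"
    have "gagliardo_nn p s f = (\<integral>\<^sup>+x. \<integral>\<^sup>+h. ?k x h \<partial>lborel \<partial>lborel)"
      unfolding gagliardo_nn_def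
    proof (rule nn_integral_cong)
      fix x
      let ?g = "\<lambda>y. ennreal (\<bar>f x - f y\<bar> powr p / norm (x - y) powr (?N + p * s))"
      have "(\<integral>\<^sup>+y. ?g y \<partial>lborel) = (\<integral>\<^sup>+h. ?g (x + h) \<partial>lborel)"
        by (rule nn_integral_translate[symmetric]) measurable
      also have "\<dots> = (\<integral>\<^sup>+h. ?k x h \<partial>lborel)"
        by (simp add: abs_minus_commute add.commute)
      finally show "(\<integral>\<^sup>+y. ?g y \<partial>lborel) = (\<integral>\<^sup>+h. ?k x h \<partial>lborel)" .
    qed
    also have "\<dots> = (\<integral>\<^sup>+h. \<integral>\<^sup>+x. ?k x h \<partial>lborel \<partial>lborel)"
      by (rule lborel_pair.Fubini'[symmetric]) measurable
    also have "\<dots> \<le> (\<integral>\<^sup>+h. ?i h * A + ?o h * (ennreal (2 powr p) * (2 * F)) \<partial>lborel)"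
    proof (rule nn_integral_mono)
      fix h :: 'a
      have "(\<integral>\<^sup>+x. ?k x h \<partial>lborel)
          = (\<integral>\<^sup>+x. ennreal (norm h powr (- (?N + p * s))) * ennreal (\<bar>f (h + x) - f x\<bar> powr p) \<partial>lborel)"
        by (simp only: powr_minus divide_inverse ennreal_mult'[symmetric] powr_ge_zero mult.commute)
      also have "\<dots> = ennreal (norm h powr (- (?N + p * s))) * (\<integral>\<^sup>+x. ennreal (\<bar>f (h + x) - f x\<bar> powr p) \<partial>lborel)"
        by (rule nn_integral_cmult) measurable
      also have "\<dots> \<le> ?i h * A + ?o h * (ennreal (2 powr p) * (2 * F))"
      proof (cases "h \<in> ball 0 1")
        case True
        have "ennreal (norm h powr (- (?N + p * s))) * (\<integral>\<^sup>+x. ennreal (\<bar>f (h + x) - f x\<bar> powr p) \<partial>lborel)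
            \<le> ennreal (norm h powr (- (?N + p * s))) * (ennreal (norm h powr p) * A)"
          unfolding A_def by (intro mult_left_mono test_function_translation_small[OF p f]) simp
        also have "\<dots> = ennreal (norm h powr (- (?N + p * s)) * norm h powr p) * A"
          by (simp add: ennreal_mult' mult.assoc)
        also have "norm h powr (- (?N + p * s)) * norm h powr p = norm h powr (p * (1 - s) - ?N)"
          by (simp add: powr_add[symmetric] algebra_simps)
        finally show ?thesis using True by simp
      next
        case False
        have "ennreal (norm h powr (- (?N + p * s))) * (\<integral>\<^sup>+x. ennreal (\<bar>f (h + x) - f x\<bar> powr p) \<partial>lborel)
            \<le> ennreal (norm h powr (- (?N + p * s))) * (ennreal (2 powr p) * (2 * F))"
          unfolding F_def using p by (intro mult_left_mono translation_large) auto
        moreover have "- (?N + p * s) = - (p * s) - ?N" by simp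
        ultimately have "ennreal (norm h powr (- (?N + p * s))) * (\<integral>\<^sup>+x. ennreal (\<bar>f (h + x) - f x\<bar> powr p) \<partial>lborel)
            \<le> ennreal (norm h powr (- (p * s) - ?N)) * (ennreal (2 powr p) * (2 * F))" by metis
        then show ?thesis using False by (simp del: minus_add_distrib)
      qed
      finally show "(\<integral>\<^sup>+x. ?k x h \<partial>lborel) \<le> ?i h * A + ?o h * (ennreal (2 powr p) * (2 * F))" .
    qed
    also have "\<dots> = C1 * A + C2 * (ennreal (2 powr p) * (2 * F))"
    proof -
      have b: "ball (0::'a) 1 \<in> sets borel" "- ball (0::'a) 1 \<in> sets borel" by simp_all
      note [measurable] = borel_measurable_indicator[OF b(1)] borel_measurable_indicator[OF b(2)]
      have m[measurable]: "?i \<in> borel_measurable lborel" "?o \<in> borel_measurable lborel"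
        by measurable
      show ?thesis
        unfolding C1_def C2_def
        by (subst nn_integral_add) (use m in \<open>simp_all only: nn_integral_multc borel_measurable_times_ennreal borel_measurable_const\<close>)
    qed
    also have "\<dots> = C1 * A + (C2 * (ennreal (2 powr p) * 2)) * F"
      by (simp only: mult.assoc)
    also have "\<dots> \<le> ennreal C * A + ennreal C * F"
      by (intro add_mono mult_right_mono C1 C2) simp_all
    also have "\<dots> = ennreal C * (A + F)" by (simp add: distrib_left)
    finally show "gagliardo_nn p s f \<le> ennreal C * ((\<integral>\<^sup>+x. ennreal (norm (grad f x) powr p) \<partial>lborel)
         + (\<integral>\<^sup>+x. ennreal (\<bar>f x\<bar> powr p) \<partial>lborel))"
      by (simp only: A_def F_def)
  qed
qed

section \<open>The function space\<close>

subsection \<open>Lebesgue norms on subsets\<close>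

lemma norm_indicator_scaleR_powr:
  "norm (indicator U x *\<^sub>R f x) powr p = indicator U x *\<^sub>R (norm (f x) powr p)"
  by (simp add: indicator_def)

lemma Lp_space_iff_in_Lp: "f \<in> Lp_space p U \<longleftrightarrow> in_Lp lborel p (\<lambda>x. indicator U x *\<^sub>R f x)"
  unfolding Lp_space_def in_Lp_def set_borel_measurable_def set_integrable_def
    norm_indicator_scaleR_powr by simp

lemma Lp_norm_eq_pnorm: "Lp_norm p U f = pnorm lborel p (\<lambda>x. indicator U x *\<^sub>R f x)"
  unfolding Lp_norm_def pnorm_def set_lebesgue_integral_def norm_indicator_scaleR_powr ..

lemma in_Lp_indicator:
  assumes "0 < p" "in_Lp M p f" "U \<in> sets M"
  shows "in_Lp M p (\<lambda>x. indicator U x *\<^sub>R f x)"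
proof (rule in_Lp_bound[OF assms(1,2)])
  show "(\<lambda>x. indicator U x *\<^sub>R f x) \<in> borel_measurable M"
    using in_Lp_measurable[OF assms(2)] assms(3)
    by (rule borel_measurable_scaleR[OF borel_measurable_indicator, rotated])
  show "AE x in M. norm (indicator U x *\<^sub>R f x) \<le> norm (f x)"
    by (rule AE_I2) (simp add: indicator_def)
qed

lemma in_Lp_test_function:
  assumes "f \<in> test_functions U" "0 < p"
  shows "in_Lp lborel p f" "in_Lp lborel p (grad f)"
proof -
  obtain K where K: "compact K" "\<And>x. x \<notin> K \<Longrightarrow> f x = 0" "\<And>x. x \<notin> K \<Longrightarrow> grad f x = 0"
    using test_function_support[OF assms(1)] by metis
  note c = test_function_continuous[OF assms(1)] test_function_continuous_grad[OF assms(1)]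
  have "continuous_on UNIV (\<lambda>x. norm (f x) powr p)" "continuous_on UNIV (\<lambda>x. norm (grad f x) powr p)"
    using assms(2)
    by (intro continuous_on_powr' continuous_on_norm c continuous_on_const; simp)+
  then show "in_Lp lborel p f" "in_Lp lborel p (grad f)"
    unfolding in_Lp_def
    using test_function_measurable[OF assms(1)] K
    by (auto intro!: integrable_of_compact_support[OF _ K(1)])
qed

lemma nn_integral_eq_pnorm:
  assumes "in_Lp M p f" "0 < p"
  shows "(\<integral>\<^sup>+x. ennreal (norm (f x) powr p) \<partial>M) = ennreal (pnorm M p f powr p)"
  unfolding pnorm_powr[OF assms(2)]
  by (rule nn_integral_eq_integral) (use assms in \<open>simp_all add: in_Lp_def\<close>)

subsection \<open>Linear structure\<close>

lemma X_spaceD: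
  assumes "u \<in> X_space p \<Omega>"
  shows "in_Lp lborel p u" "AE x in lborel. x \<notin> \<Omega> \<longrightarrow> u x = 0"
    "\<exists>G. in_Lp lborel p G \<and> has_weak_grad UNIV u G"
  using assms by (auto simp: X_space_def W1p_def Lp_space_iff_in_Lp)

text \<open>
  Test functions and elements of \<open>X\<close> vanish off \<open>\<Omega>\<close>, so the norms on \<open>\<Omega>\<close> may be replaced by norms on
  the whole space.
\<close>

lemma X_space_approximation:
  assumes "u \<in> X_space p \<Omega>" "1 < p" "open \<Omega>"
  obtains f :: "nat \<Rightarrow> 'a::euclidean_space \<Rightarrow> real"
  where "\<And>n. f n \<in> test_functions \<Omega>"
    "\<forall>e>0. \<exists>M. \<forall>m\<ge>M. \<forall>n\<ge>M. pnorm lborel p (\<lambda>x. grad (f m) x - grad (f n) x) < e"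
    "(\<lambda>n. pnorm lborel p (\<lambda>x. f n x - u x)) \<longlonglongrightarrow> 0"
proof -
  obtain f where f: "\<And>n. f n \<in> test_functions \<Omega>"
    "\<forall>e>0. \<exists>M. \<forall>m\<ge>M. \<forall>n\<ge>M. Lp_norm p \<Omega> (\<lambda>x. grad (f m) x - grad (f n) x) < e"
    "(\<lambda>n. Lp_norm p \<Omega> (\<lambda>x. f n x - u x)) \<longlonglongrightarrow> 0"
    using assms(1) unfolding X_space_def W1p_zero_def by blast
  have z: "f n x = 0" "grad (f n) x = 0" if "x \<notin> \<Omega>" for n x
    using that test_function_support[OF f(1)[of n]] by (metis subsetD)+
  have e1: "Lp_norm p \<Omega> (\<lambda>x. grad (f m) x - grad (f n) x) = pnorm lborel p (\<lambda>x. grad (f m) x - grad (f n) x)" for m n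
    unfolding Lp_norm_eq_pnorm by (rule pnorm_cong) (use z in \<open>auto simp: indicator_def\<close>)
  have e2: "Lp_norm p \<Omega> (\<lambda>x. f n x - u x) = pnorm lborel p (\<lambda>x. f n x - u x)" for n
    unfolding Lp_norm_eq_pnorm
  proof (rule pnorm_AE_cong)
    have m: "u \<in> borel_measurable lborel" "f n \<in> borel_measurable lborel"
      using X_spaceD(1)[OF assms(1)] test_function_measurable[OF f(1)] by (auto simp: in_Lp_def)
    then show d: "(\<lambda>x. f n x - u x) \<in> borel_measurable lborel" by measurable
    show "(\<lambda>x. indicat_real \<Omega> x *\<^sub>R (f n x - u x)) \<in> borel_measurable lborel"
      using d assms(3) by (intro borel_measurable_scaleR borel_measurable_indicator) auto
    show "AE x in lborel. norm (indicat_real \<Omega> x *\<^sub>R (f n x - u x)) = norm (f n x - u x)"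
      using X_spaceD(2)[OF assms(1)] by eventually_elim (use z in \<open>auto simp: indicator_def\<close>)
  qed
  note f' = f(2,3)[unfolded e1 e2]
  show thesis by (rule that[OF f(1) f'(1) f'(2)])
qed

lemma test_functions_subset_X_space:
  assumes "f \<in> test_functions \<Omega>" "0 < p"
  shows "f \<in> X_space p \<Omega>"
proof -
  have f': "f \<in> test_functions UNIV" using assms test_functions_mono[of \<Omega> UNIV] by auto
  have z: "f x = 0" if "x \<notin> \<Omega>" for x
    using that test_function_support[OF assms(1)] by (metis subsetD)
  have "f \<in> W1p p UNIV"
    using in_Lp_test_function[OF assms] has_weak_grad_test_function[OF f']
    by (auto simp: W1p_def Lp_space_iff_in_Lp)
  moreover have "f \<in> W1p_zero p \<Omega>"
    unfolding W1p_zero_def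
  proof (intro CollectI conjI exI[of _ "\<lambda>n. f"])
    have "(\<lambda>x. indicator \<Omega> x *\<^sub>R f x) = f" using z by (auto simp: indicator_def fun_eq_iff)
    then show "f \<in> Lp_space p \<Omega>"
      using in_Lp_test_function(1)[OF assms] by (simp only: Lp_space_iff_in_Lp)
  qed (use assms in \<open>auto simp: Lp_norm_def\<close>)
  ultimately show ?thesis using z by (simp add: X_space_def)
qed

lemma in_Lp_lincomb_real:
  fixes u v :: "'c \<Rightarrow> real"
  assumes "p > 0" "in_Lp M p u" "in_Lp M p v"
  shows "in_Lp M p (\<lambda>x. \<alpha> * u x + \<beta> * v x)"
  using in_Lp_lincomb[OF assms, of \<alpha> \<beta>] by simp

lemma pnorm_lincomb_real:
  fixes u v :: "'c \<Rightarrow> real"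
  assumes "1 \<le> p" "in_Lp M p u" "in_Lp M p v"
  shows "pnorm M p (\<lambda>x. \<alpha> * u x + \<beta> * v x) \<le> \<bar>\<alpha>\<bar> * pnorm M p u + \<bar>\<beta>\<bar> * pnorm M p v"
  using pnorm_lincomb[OF assms, of \<alpha> \<beta>] by simp

lemma W1p_zero_lincomb:
  fixes u v :: "'a::euclidean_space \<Rightarrow> real"
  assumes "1 < p" and u: "u \<in> X_space p \<Omega>" and v: "v \<in> X_space p \<Omega>" and "open \<Omega>"
  shows "(\<lambda>x. \<alpha> * u x + \<beta> * v x) \<in> W1p_zero p \<Omega>"
proof -
  have p: "0 < p" "1 \<le> p" using assms by auto
  obtain f where f: "\<And>n. f n \<in> test_functions \<Omega>"
    "\<forall>e>0. \<exists>M. \<forall>m\<ge>M. \<forall>n\<ge>M. pnorm lborel p (\<lambda>x. grad (f m) x - grad (f n) x) < e"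
    "(\<lambda>n. pnorm lborel p (\<lambda>x. f n x - u x)) \<longlonglongrightarrow> 0"
    using X_space_approximation[OF u \<open>1 < p\<close> \<open>open \<Omega>\<close>] by blast
  obtain g where g: "\<And>n. g n \<in> test_functions \<Omega>"
    "\<forall>e>0. \<exists>M. \<forall>m\<ge>M. \<forall>n\<ge>M. pnorm lborel p (\<lambda>x. grad (g m) x - grad (g n) x) < e"
    "(\<lambda>n. pnorm lborel p (\<lambda>x. g n x - v x)) \<longlonglongrightarrow> 0"
    using X_space_approximation[OF v \<open>1 < p\<close> \<open>open \<Omega>\<close>] by blast
  define h where "h n x = \<alpha> * f n x + \<beta> * g n x" for n x
  have h: "h n \<in> test_functions \<Omega>" for n
    unfolding h_def by (rule test_functions_lincomb[OF f(1) g(1)])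
  have z: "h n x = 0" "grad (h n) x = 0" if "x \<notin> \<Omega>" for n x
    using that test_function_support[OF h[of n]] by (metis subsetD)+
  have gh: "grad (h n) x = \<alpha> *\<^sub>R grad (f n) x + \<beta> *\<^sub>R grad (g n) x" for n x
    unfolding h_def by (intro grad_lincomb test_function_differentiable[OF f(1)] test_function_differentiable[OF g(1)])
  note Lf = in_Lp_test_function[OF f(1) p(1)] and Lg = in_Lp_test_function[OF g(1) p(1)]
    and Lu = X_spaceD(1)[OF u] and Lv = X_spaceD(1)[OF v]
  have \<Omega>: "\<Omega> \<in> sets lborel" using \<open>open \<Omega>\<close> by simp
  note in_restr = in_Lp_indicator[OF p(1) _ \<Omega>]
  have Lpn: "Lp_norm p \<Omega> w \<le> pnorm lborel p w" if "in_Lp lborel p w" for w :: "'a \<Rightarrow> 'b::euclidean_space"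
    unfolding Lp_norm_eq_pnorm
    by (rule pnorm_mono[OF p(1) that in_Lp_measurable[OF in_restr[OF that]]]) (rule AE_I2, simp add: indicator_def)
  have diff: "in_Lp lborel p (\<lambda>x. a x - b x)" if "in_Lp lborel p a" "in_Lp lborel p b"
    for a b :: "'a \<Rightarrow> 'b::euclidean_space"
    using in_Lp_lincomb[OF p(1) that, of 1 "-1"] by simp
  show ?thesis
    unfolding W1p_zero_def
  proof (intro CollectI conjI exI[of _ h] allI impI h)
    show "(\<lambda>x. \<alpha> * u x + \<beta> * v x) \<in> Lp_space p \<Omega>"
      unfolding Lp_space_iff_in_Lp by (rule in_restr[OF in_Lp_lincomb_real[OF p(1) Lu Lv]])
  next
    fix e :: real assume e: "e > 0"
    define d where "d = e / (\<bar>\<alpha>\<bar> + \<bar>\<beta>\<bar> + 1)"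
    have d: "d > 0" "(\<bar>\<alpha>\<bar> + \<bar>\<beta>\<bar>) * d < e" using e by (auto simp: d_def field_simps)
    obtain M1 M2 where M: "\<And>m n. m \<ge> M1 \<Longrightarrow> n \<ge> M1 \<Longrightarrow> pnorm lborel p (\<lambda>x. grad (f m) x - grad (f n) x) < d"
      "\<And>m n. m \<ge> M2 \<Longrightarrow> n \<ge> M2 \<Longrightarrow> pnorm lborel p (\<lambda>x. grad (g m) x - grad (g n) x) < d"
      using f(2)[rule_format, OF d(1)] g(2)[rule_format, OF d(1)] by blast
    have "Lp_norm p \<Omega> (\<lambda>x. grad (h m) x - grad (h n) x) < e" if "m \<ge> max M1 M2" "n \<ge> max M1 M2" for m n
    proof -
      have eq: "(\<lambda>x. grad (h m) x - grad (h n) x) = (\<lambda>x. \<alpha> *\<^sub>R (grad (f m) x - grad (f n) x) + \<beta> *\<^sub>R (grad (g m) x - grad (g n) x))"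
        by (simp add: gh algebra_simps)
      have "Lp_norm p \<Omega> (\<lambda>x. grad (h m) x - grad (h n) x) \<le> pnorm lborel p (\<lambda>x. grad (h m) x - grad (h n) x)"
        by (rule Lpn[OF diff[OF in_Lp_test_function(2)[OF h p(1)] in_Lp_test_function(2)[OF h p(1)]]])
      also have "\<dots> \<le> \<bar>\<alpha>\<bar> * pnorm lborel p (\<lambda>x. grad (f m) x - grad (f n) x) + \<bar>\<beta>\<bar> * pnorm lborel p (\<lambda>x. grad (g m) x - grad (g n) x)"
        unfolding eq by (rule pnorm_lincomb[OF p(2) diff[OF Lf(2) Lf(2)] diff[OF Lg(2) Lg(2)]])
      also have "\<dots> \<le> \<bar>\<alpha>\<bar> * d + \<bar>\<beta>\<bar> * d"
        using that by (intro add_mono mult_left_mono less_imp_le[OF M(1)] less_imp_le[OF M(2)]) auto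
      finally show ?thesis using d(2) by (simp add: distrib_right)
    qed
    then show "\<exists>M. \<forall>m\<ge>M. \<forall>n\<ge>M. Lp_norm p \<Omega> (\<lambda>x. grad (h m) x - grad (h n) x) < e" by blast
  next
    have le: "Lp_norm p \<Omega> (\<lambda>x. h n x - (\<alpha> * u x + \<beta> * v x))
        \<le> \<bar>\<alpha>\<bar> * pnorm lborel p (\<lambda>x. f n x - u x) + \<bar>\<beta>\<bar> * pnorm lborel p (\<lambda>x. g n x - v x)" for n
    proof -
      have eq: "(\<lambda>x. h n x - (\<alpha> * u x + \<beta> * v x)) = (\<lambda>x. \<alpha> * (f n x - u x) + \<beta> * (g n x - v x))"
        by (simp add: h_def algebra_simps)
      have "Lp_norm p \<Omega> (\<lambda>x. h n x - (\<alpha> * u x + \<beta> * v x)) \<le> pnorm lborel p (\<lambda>x. h n x - (\<alpha> * u x + \<beta> * v x))"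
        by (rule Lpn[OF diff[OF in_Lp_test_function(1)[OF h p(1)] in_Lp_lincomb_real[OF p(1) Lu Lv]]])
      also have "\<dots> \<le> \<bar>\<alpha>\<bar> * pnorm lborel p (\<lambda>x. f n x - u x) + \<bar>\<beta>\<bar> * pnorm lborel p (\<lambda>x. g n x - v x)"
        unfolding eq by (rule pnorm_lincomb_real[OF p(2) diff[OF Lf(1) Lu] diff[OF Lg(1) Lv]])
      finally show ?thesis .
    qed
    have "(\<lambda>n. \<bar>\<alpha>\<bar> * pnorm lborel p (\<lambda>x. f n x - u x) + \<bar>\<beta>\<bar> * pnorm lborel p (\<lambda>x. g n x - v x)) \<longlonglongrightarrow> \<bar>\<alpha>\<bar> * 0 + \<bar>\<beta>\<bar> * 0"
      by (intro tendsto_intros f(3) g(3))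
    then have lim: "(\<lambda>n. \<bar>\<alpha>\<bar> * pnorm lborel p (\<lambda>x. f n x - u x) + \<bar>\<beta>\<bar> * pnorm lborel p (\<lambda>x. g n x - v x)) \<longlonglongrightarrow> 0"
      by simp
    show "(\<lambda>n. Lp_norm p \<Omega> (\<lambda>x. h n x - (\<alpha> * u x + \<beta> * v x))) \<longlonglongrightarrow> 0"
      by (rule tendsto_sandwich[OF _ _ tendsto_const lim])
         (use le in \<open>auto simp: Lp_norm_eq_pnorm pnorm_nonneg\<close>)
  qed
qed

lemma X_space_lincomb:
  fixes u v :: "'a::euclidean_space \<Rightarrow> real"
  assumes "1 < p" "u \<in> X_space p \<Omega>" "v \<in> X_space p \<Omega>" "open \<Omega>"
  shows "(\<lambda>x. \<alpha> * u x + \<beta> * v x) \<in> X_space p \<Omega>"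
proof -
  have p: "p > 0" using assms by simp
  obtain G H where G: "in_Lp lborel p G" "has_weak_grad UNIV u G"
    and H: "in_Lp lborel p H" "has_weak_grad UNIV v H"
    using X_spaceD(3)[OF assms(2)] X_spaceD(3)[OF assms(3)] by blast
  have "(\<lambda>x. \<alpha> * u x + \<beta> * v x) \<in> W1p p UNIV"
    unfolding W1p_def
  proof (intro CollectI conjI bexI)
    show "(\<lambda>x. \<alpha> * u x + \<beta> * v x) \<in> Lp_space p UNIV"
      using in_Lp_lincomb_real[OF p X_spaceD(1)[OF assms(2)] X_spaceD(1)[OF assms(3)]]
      by (simp add: Lp_space_iff_in_Lp)
    show "has_weak_grad UNIV (\<lambda>x. \<alpha> * u x + \<beta> * v x) (\<lambda>x. \<alpha> *\<^sub>R G x + \<beta> *\<^sub>R H x)"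
      by (rule has_weak_grad_lincomb[OF G(2) H(2)])
    show "(\<lambda>x. \<alpha> *\<^sub>R G x + \<beta> *\<^sub>R H x) \<in> Lp_space p UNIV"
      using in_Lp_lincomb[OF p G(1) H(1)] by (simp add: Lp_space_iff_in_Lp)
  qed
  moreover have "AE x in lborel. x \<notin> \<Omega> \<longrightarrow> \<alpha> * u x + \<beta> * v x = 0"
    using X_spaceD(2)[OF assms(2)] X_spaceD(2)[OF assms(3)] by eventually_elim simp
  ultimately show ?thesis using W1p_zero_lincomb[OF assms] by (simp add: X_space_def)
qed

section \<open>The energies as powers of seminorms\<close>

subsection \<open>The local energy\<close>

definition grad_seminorm :: "real \<Rightarrow> 'a::euclidean_space set \<Rightarrow> ('a \<Rightarrow> real) \<Rightarrow> real" where
  "grad_seminorm p \<Omega> u = pnorm lborel p (\<lambda>x. indicator \<Omega> x *\<^sub>R weak_grad \<Omega> u x)"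

lemma grad_seminorm_nonneg: "0 \<le> grad_seminorm p \<Omega> u"
  by (simp add: grad_seminorm_def pnorm_nonneg)

lemma grad_energy_eq: "0 < p \<Longrightarrow> grad_energy p \<Omega> u = grad_seminorm p \<Omega> u powr p"
  unfolding grad_seminorm_def grad_energy_def set_lebesgue_integral_def
  by (simp only: pnorm_powr norm_indicator_scaleR_powr)

lemma weak_grad_X_space:
  assumes "u \<in> X_space p \<Omega>" "0 < p" "open \<Omega>"
  shows "has_weak_grad \<Omega> u (weak_grad \<Omega> u)"
    and "in_Lp lborel p (\<lambda>x. indicator \<Omega> x *\<^sub>R weak_grad \<Omega> u x)"
proof -
  obtain G where G: "in_Lp lborel p G" "has_weak_grad UNIV u G"
    using X_spaceD(3)[OF assms(1)] by blast
  have G': "has_weak_grad \<Omega> u G" by (rule has_weak_grad_subset[OF G(2)]) simp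
  then show W: "has_weak_grad \<Omega> u (weak_grad \<Omega> u)" by (rule has_weak_grad_weak_grad)
  have m: "(\<lambda>x. indicator \<Omega> x *\<^sub>R weak_grad \<Omega> u x) \<in> borel_measurable lborel"
    by (rule locally_integrable_imp_measurable[OF assms(3) has_weak_grad_locally_integrable(2)[OF W]])
  have "AE x in lborel. norm (indicator \<Omega> x *\<^sub>R weak_grad \<Omega> u x) \<le> norm (G x)"
    using has_weak_grad_unique[OF assms(3) W G'] by eventually_elim (simp add: indicator_def)
  then show "in_Lp lborel p (\<lambda>x. indicator \<Omega> x *\<^sub>R weak_grad \<Omega> u x)"
    by (rule in_Lp_bound[OF assms(2) G(1) m])
qed

lemma grad_seminorm_eqI:
  assumes "open \<Omega>" "has_weak_grad \<Omega> u G"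
  shows "grad_seminorm p \<Omega> u = pnorm lborel p (\<lambda>x. indicator \<Omega> x *\<^sub>R G x)"
  unfolding grad_seminorm_def
proof (rule pnorm_AE_cong)
  note W = has_weak_grad_weak_grad[OF assms(2)]
  show "(\<lambda>x. indicator \<Omega> x *\<^sub>R weak_grad \<Omega> u x) \<in> borel_measurable lborel"
    "(\<lambda>x. indicator \<Omega> x *\<^sub>R G x) \<in> borel_measurable lborel"
    by (rule locally_integrable_imp_measurable[OF assms(1) has_weak_grad_locally_integrable(2)[OF W]])
       (rule locally_integrable_imp_measurable[OF assms(1) has_weak_grad_locally_integrable(2)[OF assms(2)]])
  show "AE x in lborel. norm (indicator \<Omega> x *\<^sub>R weak_grad \<Omega> u x) = norm (indicator \<Omega> x *\<^sub>R G x)"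
    using has_weak_grad_unique[OF assms(1) W assms(2)] by eventually_elim (simp add: indicator_def)
qed

lemma grad_seminorm_lincomb:
  assumes "u \<in> X_space p \<Omega>" "v \<in> X_space p \<Omega>" "1 < p" "open \<Omega>"
  shows "grad_seminorm p \<Omega> (\<lambda>x. \<alpha> * u x + \<beta> * v x)
    \<le> \<bar>\<alpha>\<bar> * grad_seminorm p \<Omega> u + \<bar>\<beta>\<bar> * grad_seminorm p \<Omega> v"
proof -
  have p: "0 < p" "1 \<le> p" using assms(3) by auto
  note Wu = weak_grad_X_space[OF assms(1) p(1) assms(4)] and Wv = weak_grad_X_space[OF assms(2) p(1) assms(4)]
  have "grad_seminorm p \<Omega> (\<lambda>x. \<alpha> * u x + \<beta> * v x)
      = pnorm lborel p (\<lambda>x. indicator \<Omega> x *\<^sub>R (\<alpha> *\<^sub>R weak_grad \<Omega> u x + \<beta> *\<^sub>R weak_grad \<Omega> v x))"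
    by (rule grad_seminorm_eqI[OF assms(4) has_weak_grad_lincomb[OF Wu(1) Wv(1)]])
  also have "\<dots> = pnorm lborel p (\<lambda>x. \<alpha> *\<^sub>R (indicator \<Omega> x *\<^sub>R weak_grad \<Omega> u x) + \<beta> *\<^sub>R (indicator \<Omega> x *\<^sub>R weak_grad \<Omega> v x))"
    by (rule pnorm_cong) (simp add: scaleR_add_right mult.commute)
  also have "\<dots> \<le> \<bar>\<alpha>\<bar> * grad_seminorm p \<Omega> u + \<bar>\<beta>\<bar> * grad_seminorm p \<Omega> v"
    unfolding grad_seminorm_def by (rule pnorm_lincomb[OF p(2) Wu(2) Wv(2)])
  finally show ?thesis .
qed

lemma grad_seminorm_AE_cong:
  assumes "u \<in> X_space p \<Omega>" "v \<in> X_space p \<Omega>" "0 < p" "open \<Omega>" "AE x in lborel. v x = u x"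
  shows "grad_seminorm p \<Omega> v = grad_seminorm p \<Omega> u"
proof -
  have "has_weak_grad \<Omega> v (weak_grad \<Omega> u)"
    by (rule has_weak_grad_AE_cong[OF weak_grad_X_space(1)[OF assms(1,3,4)]
          has_weak_grad_locally_integrable(1)[OF weak_grad_X_space(1)[OF assms(2,3,4)]] assms(5)])
  from grad_seminorm_eqI[OF assms(4) this] show ?thesis by (simp only: grad_seminorm_def)
qed

lemma grad_seminorm_test_function:
  assumes "f \<in> test_functions \<Omega>" "open \<Omega>"
  shows "grad_seminorm p \<Omega> f = pnorm lborel p (grad f)"
proof -
  have "f \<in> test_functions UNIV" using assms(1) test_functions_mono[of \<Omega> UNIV] by auto
  then have "has_weak_grad \<Omega> f (grad f)"
    by (rule has_weak_grad_subset[OF has_weak_grad_test_function]) simp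
  then have "grad_seminorm p \<Omega> f = pnorm lborel p (\<lambda>x. indicator \<Omega> x *\<^sub>R grad f x)"
    by (rule grad_seminorm_eqI[OF assms(2)])
  also have "\<dots> = pnorm lborel p (grad f)"
  proof (rule pnorm_cong)
    fix x
    obtain K where "K \<subseteq> \<Omega>" "\<And>x. x \<notin> K \<Longrightarrow> grad f x = 0"
      using test_function_support[OF assms(1)] by metis
    then show "norm (indicator \<Omega> x *\<^sub>R grad f x) = norm (grad f x)"
      by (cases "x \<in> \<Omega>") auto
  qed
  finally show ?thesis .
qed

subsection \<open>The nonlocal energy\<close>

lemma gagliardo_nn_AE_cong:
  assumes eq: "AE x in lborel. v x = w x"
  shows "gagliardo_nn p s v = gagliardo_nn p s w"
proof -
  have "(\<integral>\<^sup>+y. ennreal (\<bar>v x - v y\<bar> powr p / norm (x - y) powr (real DIM('a) + p * s)) \<partial>lborel)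
      = (\<integral>\<^sup>+y. ennreal (\<bar>w x - w y\<bar> powr p / norm (x - y) powr (real DIM('a) + p * s)) \<partial>lborel)"
    if "v x = w x" for x :: 'a
    by (rule nn_integral_cong_AE) (use eq in eventually_elim, simp add: that)
  then show ?thesis
    unfolding gagliardo_nn_def
    by (intro nn_integral_cong_AE) (use eq in eventually_elim, simp)
qed

text \<open>
  The smooth approximations of \<open>u\<close> have bounded Sobolev norms, so their nonlocal energies are
  bounded. Along a subsequence they converge a.e., and Fatou's lemma in both variables carries
  the bound over to \<open>u\<close>.
\<close>

lemma gagliardo_nn_X_space_finite:
  fixes u :: "'a::euclidean_space \<Rightarrow> real"
  assumes p: "1 < p" and s: "0 < s" "s < 1" and u: "u \<in> X_space p \<Omega>" and \<Omega>: "open \<Omega>"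
  shows "gagliardo_nn p s u < \<infinity>"
proof -
  have p0: "0 < p" "1 \<le> p" using p by auto
  obtain f where f: "\<And>n. f n \<in> test_functions \<Omega>"
    "\<forall>e>0. \<exists>M. \<forall>m\<ge>M. \<forall>n\<ge>M. pnorm lborel p (\<lambda>x. grad (f m) x - grad (f n) x) < e"
    "(\<lambda>n. pnorm lborel p (\<lambda>x. f n x - u x)) \<longlonglongrightarrow> 0"
    using X_space_approximation[OF u p \<Omega>] by blast
  have f': "f n \<in> test_functions UNIV" for n using f(1) test_functions_mono[of \<Omega> UNIV] by auto
  note Lf = in_Lp_test_function[OF f(1) p0(1)] and Lu = X_spaceD(1)[OF u]
  obtain M1 where M1: "\<And>m n. m \<ge> M1 \<Longrightarrow> n \<ge> M1 \<Longrightarrow> pnorm lborel p (\<lambda>x. grad (f m) x - grad (f n) x) < 1"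
    using f(2)[rule_format, OF zero_less_one] by blast
  have "\<forall>\<^sub>F n in sequentially. pnorm lborel p (\<lambda>x. f n x - u x) < 1"
    using order_tendstoD(2)[OF f(3), of 1] by simp
  then obtain M2 where M2: "\<And>n. n \<ge> M2 \<Longrightarrow> pnorm lborel p (\<lambda>x. f n x - u x) < 1"
    unfolding eventually_sequentially by blast
  define M where "M = max M1 M2"
  define g where "g n = f (n + M)" for n
  define B1 where "B1 = pnorm lborel p (grad (f M)) + 1"
  define B2 where "B2 = pnorm lborel p u + 1"
  note Lg = Lf[of "_ + M", folded g_def]
  have M: "M1 \<le> n + M" "M2 \<le> n + M" "M1 \<le> M" for n by (simp_all add: M_def le_max_iff_disj trans_le_add2)
  have grad_bound: "pnorm lborel p (grad (g n)) \<le> B1" for n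
    using pnorm_le_add_diff[OF p0(2) Lg(2)[of n] Lf(2)[of M]] M1[OF M(1,3), of n]
    by (simp add: g_def B1_def)
  have Lp_bound: "pnorm lborel p (g n) \<le> B2" for n
    using pnorm_le_add_diff[OF p0(2) Lg(1)[of n] Lu] M2[OF M(2), of n]
    by (simp add: g_def B2_def)
  obtain C where C: "C > 0" "\<And>f :: 'a \<Rightarrow> real. f \<in> test_functions UNIV \<Longrightarrow>
       gagliardo_nn p s f \<le> ennreal C * ((\<integral>\<^sup>+x. ennreal (norm (grad f x) powr p) \<partial>lborel)
         + (\<integral>\<^sup>+x. ennreal (\<bar>f x\<bar> powr p) \<partial>lborel))"
    using gagliardo_nn_test_function[OF p s] by blast
  have gag: "gagliardo_nn p s (g n) \<le> ennreal (C * (B1 powr p + B2 powr p))" for n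
  proof -
    have "gagliardo_nn p s (g n) \<le> ennreal C * (ennreal (pnorm lborel p (grad (g n)) powr p) + ennreal (pnorm lborel p (g n) powr p))"
      using C(2)[OF f'[of "n + M"], folded g_def] nn_integral_eq_pnorm[OF Lg(2) p0(1), of n]
        nn_integral_eq_pnorm[OF Lg(1) p0(1), of n] by simp
    also have "\<dots> = ennreal (C * (pnorm lborel p (grad (g n)) powr p + pnorm lborel p (g n) powr p))"
      using C(1) by (simp add: ennreal_mult)
    also have "\<dots> \<le> ennreal (C * (B1 powr p + B2 powr p))"
      using C(1) p0 grad_bound[of n] Lp_bound[of n]
      by (intro ennreal_leI mult_left_mono add_mono powr_mono2) (simp_all add: pnorm_nonneg)
    finally show ?thesis .
  qed
  have Ld: "in_Lp lborel p (\<lambda>x. g n x - u x)" for n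
    using in_Lp_lincomb_real[OF p0(1) Lg(1)[of n] Lu, of 1 "-1"] by simp
  have lim0: "(\<lambda>n. pnorm lborel p (\<lambda>x. g n x - u x)) \<longlonglongrightarrow> 0"
    unfolding g_def using f(3) by (rule LIMSEQ_ignore_initial_segment)
  have "(\<lambda>n. pnorm lborel p (\<lambda>x. g n x - u x) powr p) \<longlonglongrightarrow> 0 powr p"
    by (rule tendsto_powr'[OF lim0 tendsto_const]) (use p0 in \<open>simp add: pnorm_nonneg\<close>)
  then have L1: "(\<lambda>n. LINT x|lborel. norm (norm (g n x - u x) powr p)) \<longlonglongrightarrow> 0"
    by (simp add: pnorm_powr[OF p0(1)])
  have "integrable lborel (\<lambda>x. norm (g n x - u x) powr p)" for n
    using Ld[of n] by (simp add: in_Lp_def)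
  from tendsto_L1_AE_subseq[OF this L1] obtain r
    where r: "AE x in lborel. (\<lambda>n. norm (g (r n) x - u x) powr p) \<longlonglongrightarrow> 0" by blast
  have conv: "AE x in lborel. (\<lambda>n. g (r n) x) \<longlonglongrightarrow> u x"
    using r
  proof eventually_elim
    case (elim x)
    have "(\<lambda>n. (norm (g (r n) x - u x) powr p) powr (1 / p)) \<longlonglongrightarrow> 0 powr (1 / p)"
      by (rule tendsto_powr'[OF elim tendsto_const]) (use p0 in simp)
    then have "(\<lambda>n. norm (g (r n) x - u x)) \<longlonglongrightarrow> 0" using p0 by (simp add: powr_powr)
    then show ?case using LIM_zero_cancel tendsto_norm_zero_iff by blast
  qed
  let ?k = "real DIM('a) + p * s"
  define K where "K v x y = ennreal (\<bar>v x - v y\<bar> powr p / norm (x - y) powr ?k)" for v and x y :: 'a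
  have mg[measurable]: "g n \<in> borel_measurable borel" for n
    using Lg(1)[of n] by (simp add: in_Lp_def)
  have mu[measurable]: "u \<in> borel_measurable borel"
    using Lu by (simp add: in_Lp_def)
  have mK[measurable]: "(\<lambda>y. K (g n) x y) \<in> borel_measurable lborel" for n x
    unfolding K_def by measurable
  have mKi: "(\<lambda>x. \<integral>\<^sup>+y. K (g n) x y \<partial>lborel) \<in> borel_measurable lborel" for n
    unfolding K_def by measurable
  have Klim: "K u x y = liminf (\<lambda>n. K (g (r n)) x y)"
    if "(\<lambda>n. g (r n) x) \<longlonglongrightarrow> u x" "(\<lambda>n. g (r n) y) \<longlonglongrightarrow> u y" for x y
  proof -
    have d: "(\<lambda>n. \<bar>g (r n) x - g (r n) y\<bar>) \<longlonglongrightarrow> \<bar>u x - u y\<bar>"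
      by (intro tendsto_rabs tendsto_diff that)
    have "(\<lambda>n. \<bar>g (r n) x - g (r n) y\<bar> powr p) \<longlonglongrightarrow> \<bar>u x - u y\<bar> powr p"
      by (rule tendsto_powr'[OF d tendsto_const]) (use p0 in simp)
    then have "(\<lambda>n. K (g (r n)) x y) \<longlonglongrightarrow> K u x y"
      unfolding K_def divide_inverse by (intro tendsto_ennrealI tendsto_mult_right)
    then show ?thesis by (rule lim_imp_Liminf[OF sequentially_bot, symmetric])
  qed
  have inner: "AE x in lborel. (\<integral>\<^sup>+y. K u x y \<partial>lborel) \<le> liminf (\<lambda>n. \<integral>\<^sup>+y. K (g (r n)) x y \<partial>lborel)"
    using conv
  proof eventually_elim
    case (elim x)
    have "(\<integral>\<^sup>+y. K u x y \<partial>lborel) = (\<integral>\<^sup>+y. liminf (\<lambda>n. K (g (r n)) x y) \<partial>lborel)"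
      by (rule nn_integral_cong_AE) (use conv in eventually_elim, rule Klim[OF elim])
    also have "\<dots> \<le> liminf (\<lambda>n. \<integral>\<^sup>+y. K (g (r n)) x y \<partial>lborel)"
      by (rule nn_integral_liminf[OF mK])
    finally show ?case .
  qed
  have "gagliardo_nn p s u = (\<integral>\<^sup>+x. \<integral>\<^sup>+y. K u x y \<partial>lborel \<partial>lborel)"
    by (simp add: gagliardo_nn_def K_def)
  also have "\<dots> \<le> (\<integral>\<^sup>+x. liminf (\<lambda>n. \<integral>\<^sup>+y. K (g (r n)) x y \<partial>lborel) \<partial>lborel)"
    by (rule nn_integral_mono_AE[OF inner])
  also have "\<dots> \<le> liminf (\<lambda>n. \<integral>\<^sup>+x. \<integral>\<^sup>+y. K (g (r n)) x y \<partial>lborel \<partial>lborel)"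
    by (rule nn_integral_liminf[OF mKi])
  also have "\<dots> \<le> liminf (\<lambda>n::nat. ennreal (C * (B1 powr p + B2 powr p)))"
    using gag by (intro Liminf_mono always_eventually) (simp add: gagliardo_nn_def K_def)
  also have "\<dots> = ennreal (C * (B1 powr p + B2 powr p))" by (simp add: Liminf_const)
  finally show ?thesis by (rule le_less_trans) simp
qed

text \<open>
  The exponent is chosen so that the \<open>p\<close>-th power is the integrand of the nonlocal energy. The
  energy thereby becomes the \<open>p\<close>-th power of an \<open>L\<^sup>p\<close> norm on the product space of a function that is
  linear in \<open>u\<close>.
\<close>

definition frac_quotient :: "real \<Rightarrow> real \<Rightarrow> ('a::euclidean_space \<Rightarrow> real) \<Rightarrow> 'a \<times> 'a \<Rightarrow> real" where
  "frac_quotient p s u z =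
     (u (fst z) - u (snd z)) / norm (fst z - snd z) powr ((real DIM('a) + p * s) / p)"

definition frac_seminorm :: "real \<Rightarrow> real \<Rightarrow> ('a::euclidean_space \<Rightarrow> real) \<Rightarrow> real" where
  "frac_seminorm p s u = pnorm (lborel \<Otimes>\<^sub>M lborel) p (frac_quotient p s u)"

lemma frac_seminorm_nonneg: "0 \<le> frac_seminorm p s u"
  by (simp add: frac_seminorm_def pnorm_nonneg)

lemma frac_quotient_powr:
  fixes u :: "'a::euclidean_space \<Rightarrow> real"
  assumes "0 < p"
  shows "norm (frac_quotient p s u (x, y)) powr p
    = \<bar>u x - u y\<bar> powr p / norm (x - y) powr (real DIM('a) + p * s)"
  using assms by (simp add: frac_quotient_def powr_divide powr_powr)

lemma
  fixes u :: "'a::euclidean_space \<Rightarrow> real"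
  assumes p: "1 < p" and s: "0 < s" "s < 1" and u: "u \<in> X_space p \<Omega>" and \<Omega>: "open \<Omega>"
  shows in_Lp_frac_quotient: "in_Lp (lborel \<Otimes>\<^sub>M lborel) p (frac_quotient p s u)"
    and gagliardo_eq: "gagliardo p s u = frac_seminorm p s u powr p"
    and gagliardo_nn_eq: "gagliardo_nn p s u = ennreal (frac_seminorm p s u powr p)"
proof -
  have p0: "0 < p" using p by simp
  have [measurable]: "u \<in> borel_measurable borel"
    using X_spaceD(1)[OF u] by (simp add: in_Lp_def)
  have m[measurable]: "frac_quotient p s u \<in> borel_measurable (lborel \<Otimes>\<^sub>M lborel)"
    unfolding frac_quotient_def[abs_def] by measurable
  have "(\<integral>\<^sup>+z. ennreal (norm (frac_quotient p s u z) powr p) \<partial>(lborel \<Otimes>\<^sub>M lborel))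
      = (\<integral>\<^sup>+x. \<integral>\<^sup>+y. ennreal (norm (frac_quotient p s u (x, y)) powr p) \<partial>lborel \<partial>lborel)"
    by (rule lborel.nn_integral_fst[symmetric]) measurable
  then have nn: "(\<integral>\<^sup>+z. ennreal (norm (frac_quotient p s u z) powr p) \<partial>(lborel \<Otimes>\<^sub>M lborel)) = gagliardo_nn p s u"
    by (simp only: frac_quotient_powr[OF p0] gagliardo_nn_def)
  have int: "integrable (lborel \<Otimes>\<^sub>M lborel) (\<lambda>z. norm (frac_quotient p s u z) powr p)"
  proof (rule integrableI_bounded)
    show "(\<lambda>z. norm (frac_quotient p s u z) powr p) \<in> borel_measurable (lborel \<Otimes>\<^sub>M lborel)" by measurable
    show "(\<integral>\<^sup>+z. ennreal (norm (norm (frac_quotient p s u z) powr p)) \<partial>(lborel \<Otimes>\<^sub>M lborel)) < \<infinity>"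
      using nn gagliardo_nn_X_space_finite[OF p s u \<Omega>] by simp
  qed
  with m show L: "in_Lp (lborel \<Otimes>\<^sub>M lborel) p (frac_quotient p s u)" by (simp add: in_Lp_def)
  have "(LINT x|lborel. LINT y|lborel. norm (frac_quotient p s u (x, y)) powr p)
      = (LINT z|(lborel \<Otimes>\<^sub>M lborel). norm (frac_quotient p s u z) powr p)"
    by (rule lborel_pair.integral_fst'[OF int])
  then show "gagliardo p s u = frac_seminorm p s u powr p"
    by (simp only: frac_quotient_powr[OF p0] gagliardo_def frac_seminorm_def pnorm_powr[OF p0])
  show "gagliardo_nn p s u = ennreal (frac_seminorm p s u powr p)"
    using nn nn_integral_eq_pnorm[OF L p0] by (simp only: frac_seminorm_def)
qed

lemma frac_seminorm_lincomb:
  fixes u v :: "'a::euclidean_space \<Rightarrow> real"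
  assumes "u \<in> X_space p \<Omega>" "v \<in> X_space p \<Omega>" "1 < p" "0 < s" "s < 1" "open \<Omega>"
  shows "frac_seminorm p s (\<lambda>x. \<alpha> * u x + \<beta> * v x) \<le> \<bar>\<alpha>\<bar> * frac_seminorm p s u + \<bar>\<beta>\<bar> * frac_seminorm p s v"
proof -
  have "frac_quotient p s (\<lambda>x. \<alpha> * u x + \<beta> * v x) = (\<lambda>z. \<alpha> * frac_quotient p s u z + \<beta> * frac_quotient p s v z)"
  proof
    fix z :: "'a \<times> 'a"
    show "frac_quotient p s (\<lambda>x. \<alpha> * u x + \<beta> * v x) z = \<alpha> * frac_quotient p s u z + \<beta> * frac_quotient p s v z"
      unfolding frac_quotient_def divide_inverse by (simp only: algebra_simps)
  qed
  then show ?thesis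
    unfolding frac_seminorm_def
    using pnorm_lincomb_real[OF _ in_Lp_frac_quotient[OF assms(3,4,5,1,6)] in_Lp_frac_quotient[OF assms(3,4,5,2,6)], of \<alpha> \<beta>] assms(3)
    by simp
qed

lemma frac_seminorm_AE_cong:
  fixes u v :: "'a::euclidean_space \<Rightarrow> real"
  assumes "u \<in> X_space p \<Omega>" "v \<in> X_space p \<Omega>" "1 < p" "0 < s" "s < 1" "open \<Omega>"
    and "AE x in lborel. v x = u x"
  shows "frac_seminorm p s v powr p = frac_seminorm p s u powr p"
proof -
  from gagliardo_nn_AE_cong[OF assms(7)]
  have "ennreal (frac_seminorm p s v powr p) = ennreal (frac_seminorm p s u powr p)"
    using gagliardo_nn_eq[OF assms(3,4,5,1,6)] gagliardo_nn_eq[OF assms(3,4,5,2,6)] by simp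
  then show ?thesis by simp
qed

lemma frac_seminorm_test_function:
  assumes p: "1 < p" and s: "0 < s" "s < 1"
  obtains C where "C > 0"
    "\<And>f :: 'a::euclidean_space \<Rightarrow> real. f \<in> test_functions UNIV \<Longrightarrow>
       frac_seminorm p s f powr p \<le> C * (pnorm lborel p (grad f) powr p + pnorm lborel p f powr p)"
proof -
  obtain C where C: "C > 0" "\<And>f :: 'a \<Rightarrow> real. f \<in> test_functions UNIV \<Longrightarrow>
       gagliardo_nn p s f \<le> ennreal C * ((\<integral>\<^sup>+x. ennreal (norm (grad f x) powr p) \<partial>lborel)
         + (\<integral>\<^sup>+x. ennreal (\<bar>f x\<bar> powr p) \<partial>lborel))"
    using gagliardo_nn_test_function[OF p s] by blast
  have p0: "0 < p" using p by simp
  show thesis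
  proof (rule that[OF C(1)])
    fix f :: "'a \<Rightarrow> real" assume f: "f \<in> test_functions UNIV"
    have "ennreal (frac_seminorm p s f powr p)
        \<le> ennreal C * (ennreal (pnorm lborel p (grad f) powr p) + ennreal (pnorm lborel p f powr p))"
      using C(2)[OF f] nn_integral_eq_pnorm[OF in_Lp_test_function(1)[OF f p0] p0]
        nn_integral_eq_pnorm[OF in_Lp_test_function(2)[OF f p0] p0]
        gagliardo_nn_eq[OF p s test_functions_subset_X_space[OF f p0] open_UNIV] by simp
    also have "\<dots> = ennreal (C * (pnorm lborel p (grad f) powr p + pnorm lborel p f powr p))"
      using C(1) by (simp add: ennreal_mult)
    finally show "frac_seminorm p s f powr p \<le> C * (pnorm lborel p (grad f) powr p + pnorm lborel p f powr p)"
      using C(1) by (simp add: ennreal_le_iff)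
  qed
qed

subsection \<open>The norm of the space\<close>

lemma X_norm_bounds:
  assumes "1 < p" "0 < s" "s < 1" "u \<in> X_space p \<Omega>" "open \<Omega>"
  shows "grad_seminorm p \<Omega> u \<le> X_norm p s \<Omega> u" "frac_seminorm p s u \<le> X_norm p s \<Omega> u"
    "X_norm p s \<Omega> u \<le> 2 * (grad_seminorm p \<Omega> u + frac_seminorm p s u)"
    "X_norm p s \<Omega> u powr p = grad_energy p \<Omega> u + gagliardo p s u"
proof -
  let ?a = "grad_seminorm p \<Omega> u" and ?b = "frac_seminorm p s u"
  have p: "p > 0" using assms(1) by simp
  have X: "X_norm p s \<Omega> u = (?a powr p + ?b powr p) powr (1 / p)"
    using grad_energy_eq[OF p, of \<Omega> u] gagliardo_eq[OF assms] by (simp add: X_norm_def)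
  have a: "?a \<ge> 0" and b: "?b \<ge> 0" by (simp_all add: grad_seminorm_nonneg frac_seminorm_nonneg)
  have root: "(c powr p) powr (1 / p) = c" if "c \<ge> 0" for c using that p by (simp add: powr_powr)
  have mono: "c powr (1 / p) \<le> d powr (1 / p)" if "0 \<le> c" "c \<le> d" for c d
    using that p by (intro powr_mono2) simp_all
  show "?a \<le> X_norm p s \<Omega> u" unfolding X using mono[of "?a powr p" "?a powr p + ?b powr p"] root[OF a] by simp
  show "?b \<le> X_norm p s \<Omega> u" unfolding X using mono[of "?b powr p" "?a powr p + ?b powr p"] root[OF b] by simp
  have "?a powr p + ?b powr p \<le> (?a + ?b) powr p + (?a + ?b) powr p"
    using a b p by (intro add_mono powr_mono2) simp_all
  also have "\<dots> = 2 powr 1 * (?a + ?b) powr p" by simp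
  also have "\<dots> \<le> 2 powr p * (?a + ?b) powr p"
    using assms(1) by (intro mult_right_mono powr_mono) simp_all
  also have "\<dots> = (2 * (?a + ?b)) powr p" by (simp only: powr_mult)
  finally have "(?a powr p + ?b powr p) powr (1 / p) \<le> ((2 * (?a + ?b)) powr p) powr (1 / p)"
    by (intro mono) simp_all
  then show "X_norm p s \<Omega> u \<le> 2 * (?a + ?b)" unfolding X using root[of "2 * (?a + ?b)"] a b by simp
  show "X_norm p s \<Omega> u powr p = grad_energy p \<Omega> u + gagliardo p s u"
    unfolding X using grad_energy_eq[OF p, of \<Omega> u] gagliardo_eq[OF assms] p by (simp add: powr_powr)
qed

section \<open>Narrow bumps of small energy\<close>

definition hardy_seminorm :: "real \<Rightarrow> real \<Rightarrow> 'a::euclidean_space set \<Rightarrow> ('a \<Rightarrow> real) \<Rightarrow> real" where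
  "hardy_seminorm p \<theta> \<Omega> u = pnorm lborel p (\<lambda>x. indicator \<Omega> x * (u x / norm x powr \<theta>))"

lemma hardy_integral_eq:
  assumes "0 < p"
  shows "(LINT x:\<Omega>|lborel. \<bar>u x\<bar> powr p / norm x powr (p * \<theta>)) = hardy_seminorm p \<theta> \<Omega> u powr p"
proof -
  have "indicator \<Omega> x *\<^sub>R (\<bar>u x\<bar> powr p / norm x powr (p * \<theta>))
      = norm (indicator \<Omega> x * (u x / norm x powr \<theta>)) powr p" for x
    by (simp add: indicator_def powr_divide powr_powr mult.commute)
  then show ?thesis
    unfolding hardy_seminorm_def set_lebesgue_integral_def by (simp only: pnorm_powr[OF assms])
qed

lemma powr_le_cancel_base:
  fixes x y :: real
  assumes "x powr p \<le> y powr p" "0 < p" "0 \<le> y"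
  shows "x \<le> y"
  using powr_less_mono2[of p y x] assms by (force simp: not_le[symmetric])

lemma bounded_support_pnorm:
  fixes f :: "'c \<Rightarrow> 'b::euclidean_space"
  assumes p: "0 < p" and f: "f \<in> borel_measurable M" and A: "A \<in> sets M" "emeasure M A < \<infinity>"
    and B: "0 \<le> B" "\<And>x. norm (f x) \<le> B * indicator A x"
  shows "in_Lp M p f" "pnorm M p f powr p \<le> B powr p * measure M A"
proof -
  have iA: "integrable M (\<lambda>x. B powr p * indicator A x)"
    using A by (intro integrable_mult_right integrable_real_indicator) auto
  have le: "norm (f x) powr p \<le> B powr p * indicator A x" for x
  proof -
    have "norm (f x) powr p \<le> (B * indicator A x) powr p"
      using p B(2)[of x] by (intro powr_mono2) auto
    then show ?thesis using B(2)[of x] by (cases "x \<in> A") auto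
  qed
  have m: "(\<lambda>x. norm (f x) powr p) \<in> borel_measurable M" using f by measurable
  have int: "integrable M (\<lambda>x. norm (f x) powr p)"
    by (rule Bochner_Integration.integrable_bound[OF iA m]) (rule AE_I2, use le in simp)
  with f show "in_Lp M p f" by (simp add: in_Lp_def)
  have "pnorm M p f powr p = (LINT x|M. norm (f x) powr p)" by (rule pnorm_powr[OF p])
  also have "\<dots> \<le> (LINT x|M. B powr p * indicator A x)" by (rule integral_mono[OF int iA le])
  also have "\<dots> = B powr p * measure M A" using A by simp
  finally show "pnorm M p f powr p \<le> B powr p * measure M A" .
qed

lemma grad_rescale:
  fixes f :: "'a::euclidean_space \<Rightarrow> real"
  assumes "\<And>x. f differentiable (at x)"
  shows "grad (\<lambda>x. K * f (c *\<^sub>R (x - a))) x = (K * c) *\<^sub>R grad f (c *\<^sub>R (x - a))"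
proof (rule grad_eqI)
  have "((\<lambda>x. c *\<^sub>R (x - a)) has_derivative (\<lambda>h. c *\<^sub>R h)) (at x)"
    by (auto intro!: derivative_eq_intros)
  from has_derivative_compose[OF this has_derivative_grad[OF assms]]
  have "((\<lambda>x. K * f (c *\<^sub>R (x - a))) has_derivative (\<lambda>h. K * (grad f (c *\<^sub>R (x - a)) \<bullet> (c *\<^sub>R h)))) (at x)"
    by (rule has_derivative_mult_right)
  then show "((\<lambda>x. K * f (c *\<^sub>R (x - a))) has_derivative (\<lambda>h. ((K * c) *\<^sub>R grad f (c *\<^sub>R (x - a))) \<bullet> h)) (at x)"
    by (simp add: mult.assoc)
qed

lemma box_bump_rescale:
  fixes x :: "'a::euclidean_space"
  assumes "e > 0"
  shows "box_bump (1 / e) (a - e *\<^sub>R One) (a + e *\<^sub>R One) x = box_bump 1 (- One) One ((1 / e) *\<^sub>R (x - a))"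
  unfolding box_bump_def
proof (rule prod.cong[OF refl])
  fix i :: 'a assume i: "i \<in> Basis"
  have "(1 / e) * (x \<bullet> i - (a - e *\<^sub>R One) \<bullet> i) = 1 * (((1 / e) *\<^sub>R (x - a)) \<bullet> i - (- One) \<bullet> i)"
    "(1 / e) * ((a + e *\<^sub>R One) \<bullet> i - x \<bullet> i) = 1 * (One \<bullet> i - ((1 / e) *\<^sub>R (x - a)) \<bullet> i)"
    using assms i by (simp_all add: inner_diff_left inner_add_left field_simps)
  then show "flat 1 ((1 / e) * (x \<bullet> i - (a - e *\<^sub>R One) \<bullet> i)) * flat 1 ((1 / e) * ((a + e *\<^sub>R One) \<bullet> i - x \<bullet> i))
    = flat 1 (1 * (((1 / e) *\<^sub>R (x - a)) \<bullet> i - (- One) \<bullet> i)) * flat 1 (1 * (One \<bullet> i - ((1 / e) *\<^sub>R (x - a)) \<bullet> i))"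
    by (simp only:)
qed

lemma flat1_ge: "1 / 2 \<le> t \<Longrightarrow> exp (- 2) \<le> flat 1 t"
  by (simp add: flat_def field_simps)

lemma unit_bump_lower_bound:
  fixes y :: "'a::euclidean_space"
  assumes "norm y \<le> 1 / 2"
  shows "(exp (- 2) * exp (- 2)) ^ DIM('a) \<le> box_bump 1 (- One) One y"
proof -
  have "(\<Prod>i\<in>(Basis::'a set). exp (- 2) * exp (- 2)) \<le> (\<Prod>i\<in>Basis. flat 1 (1 * (y \<bullet> i - (- One) \<bullet> i)) * flat 1 (1 * (One \<bullet> i - y \<bullet> i)))"
  proof (intro prod_mono conjI mult_mono flat1_ge flat1_nonneg)
    fix i :: 'a assume i: "i \<in> Basis"
    have "\<bar>y \<bullet> i\<bar> \<le> 1 / 2" using Basis_le_norm[OF i, of y] assms by linarith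
    then show "1 / 2 \<le> 1 * (y \<bullet> i - (- One) \<bullet> i)" "1 / 2 \<le> 1 * (One \<bullet> i - y \<bullet> i)"
      using i by (simp_all add: abs_le_iff)
  qed simp_all
  then show ?thesis by (simp add: box_bump_def)
qed

lemma cbox_cube_subset_ball:
  fixes a :: "'a::euclidean_space"
  assumes "real DIM('a) * e < R" "x \<in> cbox (a - e *\<^sub>R One) (a + e *\<^sub>R One)"
  shows "x \<in> ball a R"
proof -
  have "\<bar>(x - a) \<bullet> i\<bar> \<le> e" if i: "i \<in> Basis" for i
  proof -
    have "(a - e *\<^sub>R One) \<bullet> i \<le> x \<bullet> i" "x \<bullet> i \<le> (a + e *\<^sub>R One) \<bullet> i"
      using assms(2) i by (auto simp: mem_box)
    then show ?thesis using i by (simp add: inner_diff_left inner_add_left abs_le_iff)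
  qed
  then have "(\<Sum>i\<in>Basis. \<bar>(x - a) \<bullet> i\<bar>) \<le> (\<Sum>i\<in>(Basis::'a set). e)" by (rule sum_mono)
  then have "norm (x - a) \<le> real DIM('a) * e" using norm_le_l1[of "x - a"] by simp
  with assms(1) show ?thesis by (simp add: dist_norm norm_minus_commute)
qed

lemma measure_cube:
  fixes a :: "'a::euclidean_space"
  assumes "e > 0"
  shows "measure lborel (cbox (a - e *\<^sub>R One) (a + e *\<^sub>R One)) = (2 * e) ^ DIM('a)"
proof -
  have "(a - e *\<^sub>R One) \<bullet> i \<le> (a + e *\<^sub>R One) \<bullet> i" if "i \<in> Basis" for i
    using that assms by (simp add: inner_diff_left inner_add_left)
  then have "measure lborel (cbox (a - e *\<^sub>R One) (a + e *\<^sub>R One)) = (\<Prod>i\<in>Basis. ((a + e *\<^sub>R One) \<bullet> i - (a - e *\<^sub>R One) \<bullet> i))"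
    by (intro content_cbox ballI)
  also have "\<dots> = (\<Prod>i\<in>(Basis::'a set). 2 * e)"
    by (rule prod.cong) (simp_all add: inner_diff_left inner_add_left)
  finally show ?thesis by simp
qed

text \<open>
  A bump of fixed height on a cube of side \<open>2 * e\<close> has gradient of order \<open>1 / e\<close>, hence local energy
  of order \<open>e powr (N - p)\<close>. This tends to zero because \<open>p < N\<close>. The other seminorms are controlled
  by the local one and the \<open>L\<^sup>p\<close> norm, the Hardy seminorm because the bump stays away from
  the origin.
\<close>

lemma exists_high_bump_of_small_norm:
  fixes a :: "'a::euclidean_space"
  assumes p: "1 < p" "p < real DIM('a)" and s: "0 < s" "s < 1" and \<theta>: "0 \<le> \<theta>" and \<Omega>: "open \<Omega>" "a \<in> \<Omega>" "a \<noteq> 0"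
    and \<kappa>: "0 < \<kappa>" and \<delta>: "0 < \<delta>"
  obtains \<psi> r where "\<psi> \<in> test_functions \<Omega>" "\<And>x. 0 \<le> \<psi> x" "0 < r" "\<And>x. x \<in> ball a r \<Longrightarrow> \<kappa> \<le> \<psi> x"
    "grad_seminorm p \<Omega> \<psi> \<le> \<delta>" "frac_seminorm p s \<psi> \<le> \<delta>" "pnorm lborel p \<psi> \<le> \<delta>"
    "in_Lp lborel p (\<lambda>x. indicator \<Omega> x * (\<psi> x / norm x powr \<theta>))" "hardy_seminorm p \<theta> \<Omega> \<psi> \<le> \<delta>"
proof -
  let ?N = "DIM('a)"
  define b where "b = box_bump 1 (- One) (One::'a)"
  have p0: "0 < p" using p by simp
  have "(\<lambda>x. 1 * box_bump 1 (- One) (One::'a) x) \<in> test_functions UNIV"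
    by (rule box_bump_test_function) simp_all
  then have b: "b \<in> test_functions UNIV" by (simp add: b_def)
  obtain M where M: "M \<ge> 0" "\<And>x. norm (grad b x) \<le> M"
  proof -
    obtain K where "compact K" "\<And>x. x \<notin> K \<Longrightarrow> grad b x = 0"
      using test_function_support[OF b] by metis
    from bounded_of_compact_support[OF test_function_continuous_grad[OF b] this] that show thesis by metis
  qed
  define c0 where "c0 = (exp (- 2) * exp (- 2) :: real) ^ ?N"
  have c0: "c0 > 0" by (simp add: c0_def)
  define K where "K = \<kappa> / c0"
  have K: "K > 0" using \<kappa> c0 by (simp add: K_def)
  obtain R0 where R0: "R0 > 0" "ball a R0 \<subseteq> \<Omega>" using \<Omega> openE by blast
  define R where "R = min R0 (norm a / 2)"
  have R: "R > 0" "R \<le> norm a / 2" "ball a R \<subseteq> \<Omega>" using R0 \<Omega>(3) by (auto simp: R_def)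
  obtain C where C: "C > 0"
    "\<And>f :: 'a \<Rightarrow> real. f \<in> test_functions UNIV \<Longrightarrow>
       frac_seminorm p s f powr p \<le> C * (pnorm lborel p (grad f) powr p + pnorm lborel p f powr p)"
    using frac_seminorm_test_function[OF p(1) s] by blast
  define H where "H = 1 / (norm a / 2) powr \<theta>"
  have H: "H > 0" using \<Omega>(3) by (simp add: H_def)
  define G where "G e = (K * M) powr p * 2 ^ ?N * e powr (real ?N - p)" for e
  define L where "L e = K powr p * 2 ^ ?N * e ^ ?N" for e :: real
  define T where "T = 1 + C + H powr p"
  have T: "T \<ge> 1" "T \<ge> C" "T \<ge> H powr p" using C(1) H by (auto simp: T_def)
  have "((\<lambda>e. e powr (real ?N - p)) \<longlongrightarrow> 0 powr (real ?N - p)) (at_right 0)"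
    by (rule tendsto_powr'[OF tendsto_ident_at tendsto_const])
       (use p in \<open>simp add: eventually_at_filter\<close>)
  then have "((\<lambda>e. e powr (real ?N - p)) \<longlongrightarrow> 0) (at_right 0)" by simp
  then have "(G \<longlongrightarrow> (K * M) powr p * 2 ^ ?N * 0) (at_right 0)"
    unfolding G_def by (intro tendsto_mult tendsto_const)
  moreover have "(L \<longlongrightarrow> K powr p * 2 ^ ?N * 0 ^ ?N) (at_right 0)"
    unfolding L_def by (intro tendsto_intros)
  ultimately have "((\<lambda>e. T * (G e + L e)) \<longlongrightarrow> T * ((K * M) powr p * 2 ^ ?N * 0 + K powr p * 2 ^ ?N * 0 ^ ?N)) (at_right 0)"
    by (intro tendsto_intros)
  then have lim: "((\<lambda>e. T * (G e + L e)) \<longlongrightarrow> 0) (at_right 0)" by (simp add: zero_power)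
  have ev1: "\<forall>\<^sub>F e in at_right 0. T * (G e + L e) < \<delta> powr p"
    by (rule order_tendstoD(2)[OF lim]) (use \<delta> in simp)
  have lim2: "((\<lambda>e. real ?N * e) \<longlongrightarrow> real ?N * 0) (at_right 0)" by (intro tendsto_intros)
  have ev2: "\<forall>\<^sub>F e in at_right 0. real ?N * e < R"
    by (rule order_tendstoD(2)[OF lim2]) (use R in simp)
  have ev3: "\<forall>\<^sub>F e in at_right 0. (0::real) < e" by (simp add: eventually_at_filter)
  obtain e where e: "T * (G e + L e) < \<delta> powr p" "real ?N * e < R" "0 < e"
    using eventually_happens[OF eventually_conj[OF ev1 eventually_conj[OF ev2 ev3]]] by auto
  define Q where "Q = cbox (a - e *\<^sub>R One) (a + e *\<^sub>R One)"
  have QR: "x \<in> ball a R" if "x \<in> Q" for x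
    using cbox_cube_subset_ball[OF e(2)] that by (simp add: Q_def)
  have Q\<Omega>: "Q \<subseteq> \<Omega>" using QR R(3) by blast
  have mQ: "measure lborel Q = (2 * e) ^ ?N" "Q \<in> sets lborel" "emeasure lborel Q < \<infinity>"
    unfolding Q_def using measure_cube[OF e(3)] emeasure_lborel_cbox_finite by auto
  define \<psi> where "\<psi> x = K * box_bump (1 / e) (a - e *\<^sub>R One) (a + e *\<^sub>R One) x" for x
  have \<psi>t: "\<psi> \<in> test_functions \<Omega>"
    unfolding \<psi>_def using e(3) Q\<Omega> by (intro box_bump_test_function) (simp_all add: Q_def)
  then have \<psi>u: "\<psi> \<in> test_functions UNIV" using test_functions_mono[of \<Omega> UNIV] by auto
  note m = test_function_measurable[OF \<psi>t]
  have \<psi>b: "\<psi> x = K * b ((1 / e) *\<^sub>R (x - a))" for x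
    unfolding \<psi>_def b_def by (simp only: box_bump_rescale[OF e(3)])
  have \<psi>0: "0 \<le> \<psi> x" for x using K by (simp add: \<psi>_def box_bump_nonneg)
  have \<psi>K: "\<psi> x \<le> K" for x
    using K mult_left_mono[OF box_bump_le_1[of "1 / e" "a - e *\<^sub>R One" "a + e *\<^sub>R One" x], of K] by (simp add: \<psi>_def)
  have \<psi>Q: "\<psi> x = 0" if "x \<notin> Q" for x
  proof -
    have "x \<notin> box (a - e *\<^sub>R One) (a + e *\<^sub>R One)"
      using that box_subset_cbox[of "a - e *\<^sub>R One" "a + e *\<^sub>R One"] unfolding Q_def by blast
    then show ?thesis using e(3) by (simp add: \<psi>_def box_bump_eq_0)
  qed
  have gQ: "grad \<psi> x = 0" if "x \<notin> Q" for x
  proof -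
    have "\<psi> \<in> test_functions Q"
      unfolding \<psi>_def using e(3) by (intro box_bump_test_function) (simp_all add: Q_def)
    then obtain S where "S \<subseteq> Q" "\<And>x. x \<notin> S \<Longrightarrow> grad \<psi> x = 0" using test_function_support by metis
    with that show ?thesis by blast
  qed
  have gM: "norm (grad \<psi> x) \<le> K * M / e" for x
  proof -
    have "grad \<psi> x = (K * (1 / e)) *\<^sub>R grad b ((1 / e) *\<^sub>R (x - a))"
      unfolding \<psi>b[abs_def] by (rule grad_rescale[OF test_function_differentiable[OF b]])
    moreover have "norm ((K * (1 / e)) *\<^sub>R grad b ((1 / e) *\<^sub>R (x - a))) \<le> (K * (1 / e)) * M"
      using K e(3) M(2) by (simp add: divide_right_mono mult_left_mono)
    ultimately show ?thesis by simp
  qed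
  have g: "pnorm lborel p (grad \<psi>) powr p \<le> G e"
  proof -
    have "pnorm lborel p (grad \<psi>) powr p \<le> (K * M / e) powr p * measure lborel Q"
    proof (rule bounded_support_pnorm(2)[OF p0 _ mQ(2,3)])
      show "norm (grad \<psi> x) \<le> K * M / e * indicator Q x" for x
        using gM[of x] gQ[of x] by (cases "x \<in> Q") auto
    qed (use m K M e in auto)
    also have "\<dots> = G e"
      using K M(1) e(3) by (simp add: mQ(1) G_def powr_divide powr_diff powr_realpow power_mult_distrib)
    finally show ?thesis .
  qed
  have l: "pnorm lborel p \<psi> powr p \<le> L e"
  proof -
    have "pnorm lborel p \<psi> powr p \<le> K powr p * measure lborel Q"
    proof (rule bounded_support_pnorm(2)[OF p0 _ mQ(2,3)])
      show "norm (\<psi> x) \<le> K * indicator Q x" for x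
        using \<psi>0[of x] \<psi>K[of x] \<psi>Q[of x] by (cases "x \<in> Q") auto
    qed (use m K in auto)
    then show ?thesis by (simp add: mQ(1) L_def power_mult_distrib mult.assoc)
  qed
  have GL: "0 \<le> G e" "0 \<le> L e" using e(3) by (simp_all add: G_def L_def)
  have hb: "norm (indicator \<Omega> x * (\<psi> x / norm x powr \<theta>)) \<le> K * H * indicator Q x" for x
  proof (cases "x \<in> Q")
    case True
    have "norm (x - a) < norm a / 2" using QR[OF True] R(2) by (simp add: dist_norm norm_minus_commute)
    then have n: "norm a / 2 \<le> norm x" using norm_triangle_ineq2[of a x] by (simp add: norm_minus_commute)
    then have "(norm a / 2) powr \<theta> \<le> norm x powr \<theta>" using \<theta> by (intro powr_mono2) auto
    moreover have "(norm a / 2) powr \<theta> > 0" using \<Omega>(3) by simp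
    ultimately have "\<psi> x / norm x powr \<theta> \<le> K / (norm a / 2) powr \<theta>"
      using K \<psi>0[of x] \<psi>K[of x] by (intro frac_le) auto
    then show ?thesis using True Q\<Omega> \<psi>0[of x] by (auto simp: H_def)
  qed (simp add: \<psi>Q)
  have mh: "(\<lambda>x. indicator \<Omega> x * (\<psi> x / norm x powr \<theta>)) \<in> borel_measurable lborel"
  proof -
    have "(\<lambda>x. \<psi> x / norm x powr \<theta>) \<in> borel_measurable lborel" using m(1) by measurable
    then show ?thesis using \<Omega>(1) by (intro borel_measurable_times borel_measurable_indicator) auto
  qed
  have KH: "0 \<le> K * H" using K H by simp
  note hL = bounded_support_pnorm[OF p0 mh mQ(2,3) KH hb]
  have h: "hardy_seminorm p \<theta> \<Omega> \<psi> powr p \<le> H powr p * L e"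
    using hL(2) by (simp add: hardy_seminorm_def L_def mQ(1) powr_mult power_mult_distrib mult_ac)
  have fs: "frac_seminorm p s \<psi> powr p \<le> C * (G e + L e)"
    using C(2)[OF \<psi>u] mult_left_mono[OF add_mono[OF g l], of C] C(1) by linarith
  have small: "x \<le> \<delta>" if "x powr p \<le> t * (G e + L e)" "t \<le> T" for x t
  proof (rule powr_le_cancel_base[OF _ p0])
    have "t * (G e + L e) \<le> T * (G e + L e)" using that GL by (intro mult_right_mono) auto
    then show "x powr p \<le> \<delta> powr p" using that(1) e(1) by linarith
  qed (use \<delta> in simp)
  show thesis
  proof (rule that[of \<psi> "e / 2"])
    show "\<psi> \<in> test_functions \<Omega>" "0 < e / 2" using \<psi>t e by auto
    show "0 \<le> \<psi> x" for x by (rule \<psi>0)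
    show "\<kappa> \<le> \<psi> x" if "x \<in> ball a (e / 2)" for x
    proof -
      have "norm (x - a) < e / 2" using that by (simp add: dist_norm norm_minus_commute)
      then have "(1 / e) * norm (x - a) \<le> 1 / 2" using e(3) by (simp add: field_simps)
      then have "norm ((1 / e) *\<^sub>R (x - a)) \<le> 1 / 2"
        unfolding norm_scaleR using e(3) by simp
      then have "c0 \<le> b ((1 / e) *\<^sub>R (x - a))" unfolding c0_def b_def by (rule unit_bump_lower_bound)
      then have "K * c0 \<le> K * b ((1 / e) *\<^sub>R (x - a))" using K by (intro mult_left_mono) auto
      then show ?thesis using c0 by (simp add: \<psi>b K_def)
    qed
    show "grad_seminorm p \<Omega> \<psi> \<le> \<delta>"
      by (rule small[OF _ T(1)]) (use g GL in \<open>simp add: grad_seminorm_test_function[OF \<psi>t \<Omega>(1)]\<close>)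
    show "pnorm lborel p \<psi> \<le> \<delta>" by (rule small[OF _ T(1)]) (use l GL in simp)
    show "frac_seminorm p s \<psi> \<le> \<delta>" by (rule small[OF fs T(2)])
    have "H powr p * L e \<le> H powr p * (G e + L e)" using GL by (intro mult_left_mono) auto
    with h have "hardy_seminorm p \<theta> \<Omega> \<psi> powr p \<le> H powr p * (G e + L e)" by linarith
    then show "hardy_seminorm p \<theta> \<Omega> \<psi> \<le> \<delta>" by (rule small[OF _ T(3)])
    show "in_Lp lborel p (\<lambda>x. indicator \<Omega> x * (\<psi> x / norm x powr \<theta>))" by (rule hL(1))
  qed
qed

text \<open>
  The sets \<open>{x. 1 / m \<le> \<phi> x \<le> m}\<close> exhaust \<open>\<Omega>\<close> up to a null set, so one of them is not a null set. A
  set that is null near each of its points is a null set. The origin is a null set and may be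
  avoided.
\<close>

lemma exists_point_of_local_boundedness:
  fixes \<phi> :: "'a::euclidean_space \<Rightarrow> real"
  assumes \<Omega>: "open \<Omega>" "\<Omega> \<noteq> {}" and pos: "AE x in lborel. x \<in> \<Omega> \<longrightarrow> \<phi> x > 0"
  obtains a m where "a \<in> \<Omega>" "a \<noteq> 0" "1 \<le> m"
    "\<And>r. r > 0 \<Longrightarrow> \<not> negligible ({x \<in> \<Omega>. 1 / m \<le> \<phi> x \<and> \<phi> x \<le> m} \<inter> ball a r)"
proof -
  define E where "E n = {x \<in> \<Omega>. x \<noteq> 0 \<and> 1 / real (Suc n) \<le> \<phi> x \<and> \<phi> x \<le> real (Suc n)}" for n
  have "\<exists>n. \<not> negligible (E n)"
  proof (rule ccontr)
    assume "\<not> (\<exists>n. \<not> negligible (E n))"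
    then have "negligible (\<Union>n. E n)" by (intro negligible_countable_Union) auto
    moreover obtain N where N: "\<And>x. x \<in> space lborel - N \<Longrightarrow> x \<in> \<Omega> \<longrightarrow> \<phi> x > 0" "N \<in> null_sets lborel"
      using AE_E3[OF pos] by blast
    then have "negligible N" by (simp add: negligible_iff_null_sets null_sets_completionI)
    ultimately have "negligible ((\<Union>n. E n) \<union> N \<union> {0})" by (intro negligible_Un negligible_sing)
    moreover have "\<Omega> \<subseteq> (\<Union>n. E n) \<union> N \<union> {0}"
    proof
      fix x assume x: "x \<in> \<Omega>"
      show "x \<in> (\<Union>n. E n) \<union> N \<union> {0}"
      proof (cases "x = 0 \<or> x \<in> N")
        case False
        then have "\<phi> x > 0" using x N(1)[of x] by simp
        obtain n1 where n1: "\<phi> x \<le> real n1" using real_arch_simple by blast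
        obtain n2 where n2: "1 / \<phi> x \<le> real n2" using real_arch_simple by blast
        have "\<phi> x \<le> real (Suc (n1 + n2))" using n1 by simp
        moreover have "1 / real (Suc (n1 + n2)) \<le> \<phi> x"
        proof -
          have "1 / \<phi> x \<le> real (Suc (n1 + n2))" using n2 by simp
          then show ?thesis using \<open>\<phi> x > 0\<close> by (simp add: field_simps)
        qed
        ultimately have "x \<in> E (n1 + n2)" using x False by (simp add: E_def)
        then show ?thesis by blast
      qed auto
    qed
    ultimately have "negligible \<Omega>" by (rule negligible_subset)
    then show False using open_not_negligible[OF \<Omega>] by simp
  qed
  then obtain n where n: "\<not> negligible (E n)" by blast
  then obtain a where a: "a \<in> E n" "\<And>U. openin (top_of_set (E n)) U \<Longrightarrow> a \<in> U \<Longrightarrow> \<not> negligible U"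
    using locally_negligible_alt[of "E n"] by blast
  show thesis
  proof (rule that[of a "real (Suc n)"])
    show "a \<in> \<Omega>" "a \<noteq> 0" "1 \<le> real (Suc n)" using a(1) by (auto simp: E_def)
    fix r :: real assume "r > 0"
    then have "\<not> negligible (E n \<inter> ball a r)"
      using a(1) by (intro a(2)) (auto intro: openin_open_Int)
    moreover have "E n \<inter> ball a r \<subseteq> {x \<in> \<Omega>. 1 / real (Suc n) \<le> \<phi> x \<and> \<phi> x \<le> real (Suc n)} \<inter> ball a r"
      by (auto simp: E_def)
    ultimately show "\<not> negligible ({x \<in> \<Omega>. 1 / real (Suc n) \<le> \<phi> x \<and> \<phi> x \<le> real (Suc n)} \<inter> ball a r)"
      using negligible_subset by blast
  qed
qed

section \<open>The functional along paths\<close>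

lemma X_space_Lp_integral:
  assumes "u \<in> X_space p \<Omega>" "0 < p" "open \<Omega>"
  shows "(LINT x:\<Omega>|lborel. \<bar>u x\<bar> powr p) = pnorm lborel p u powr p"
proof -
  have "(LINT x:\<Omega>|lborel. \<bar>u x\<bar> powr p) = (LINT x|lborel. norm (u x) powr p)"
    unfolding set_lebesgue_integral_def
  proof (rule integral_cong_AE)
    have "u \<in> borel_measurable lborel" by (rule in_Lp_measurable[OF X_spaceD(1)[OF assms(1)]])
    then have m: "(\<lambda>x. \<bar>u x\<bar> powr p) \<in> borel_measurable lborel" by measurable
    then show "(\<lambda>x. norm (u x) powr p) \<in> borel_measurable lborel" by simp
    show "(\<lambda>x. indicat_real \<Omega> x *\<^sub>R \<bar>u x\<bar> powr p) \<in> borel_measurable lborel"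
      using assms(3) by (intro borel_measurable_scaleR[OF borel_measurable_indicator m]) simp
    show "AE x in lborel. indicat_real \<Omega> x *\<^sub>R \<bar>u x\<bar> powr p = norm (u x) powr p"
      using X_spaceD(2)[OF assms(1)] by eventually_elim (auto simp: indicator_def)
  qed
  then show ?thesis by (simp only: pnorm_powr[OF assms(2)])
qed

lemma S_set_iff:
  assumes "0 < p" "open \<Omega>"
  shows "u \<in> S_set p \<Omega> \<longleftrightarrow> u \<in> X_space p \<Omega> \<and> pnorm lborel p u = 1"
proof -
  have "pnorm lborel p u powr p = 1 \<longleftrightarrow> pnorm lborel p u = 1"
  proof
    assume "pnorm lborel p u powr p = 1"
    then have "(pnorm lborel p u powr p) powr (1 / p) = 1" by simp
    then show "pnorm lborel p u = 1" using assms(1) pnorm_nonneg[of lborel p u] by (simp add: powr_powr)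
  qed simp
  then show ?thesis using X_space_Lp_integral[OF _ assms, of u] by (auto simp: S_set_def)
qed

definition pos_integral :: "real \<Rightarrow> 'a::euclidean_space set \<Rightarrow> ('a \<Rightarrow> real) \<Rightarrow> real" where
  "pos_integral p \<Omega> u = (LINT x:\<Omega>|lborel. (max (u x) 0) powr p)"

lemma pos_integral_nonneg: "0 \<le> pos_integral p \<Omega> u"
  unfolding pos_integral_def set_lebesgue_integral_def by (rule integral_nonneg_AE) simp

lemma J_eq:
  assumes "u \<in> X_space p \<Omega>" "1 < p" "0 < s" "s < 1" "open \<Omega>"
  shows "J p s \<theta> \<mu> \<Omega> d u = grad_seminorm p \<Omega> u powr p + frac_seminorm p s u powr p
    - \<mu> * hardy_seminorm p \<theta> \<Omega> u powr p - d * pos_integral p \<Omega> u"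
proof -
  have p: "0 < p" using assms by simp
  show ?thesis
    unfolding J_def pos_integral_def hardy_integral_eq[OF p] grad_energy_eq[OF p]
      gagliardo_eq[OF assms(2,3,4,1,5)] ..
qed

text \<open>
  The local and nonlocal seminorms scale by subadditivity, the two subtracted terms by their
  definition. The inequality serves to normalise a path.
\<close>

lemma J_scale_le:
  assumes "u \<in> X_space p \<Omega>" "1 < p" "0 < s" "s < 1" "open \<Omega>" "0 < c"
  shows "J p s \<theta> \<mu> \<Omega> d (\<lambda>x. c * u x) \<le> c powr p * J p s \<theta> \<mu> \<Omega> d u"
proof -
  have p: "0 < p" using assms by simp
  have X: "(\<lambda>x. c * u x) \<in> X_space p \<Omega>"
    using X_space_lincomb[OF assms(2,1,1,5), of c 0] by simp
  have g: "grad_seminorm p \<Omega> (\<lambda>x. c * u x) powr p \<le> (c * grad_seminorm p \<Omega> u) powr p"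
    using grad_seminorm_lincomb[OF assms(1,1,2,5), of c 0] assms(6) p
    by (intro powr_mono2) (simp_all add: grad_seminorm_nonneg)
  have b: "frac_seminorm p s (\<lambda>x. c * u x) powr p \<le> (c * frac_seminorm p s u) powr p"
    using frac_seminorm_lincomb[OF assms(1,1,2,3,4,5), of c 0] assms(6) p
    by (intro powr_mono2) (simp_all add: frac_seminorm_nonneg)
  have "hardy_seminorm p \<theta> \<Omega> (\<lambda>x. c * u x) = pnorm lborel p (\<lambda>x. c *\<^sub>R (indicator \<Omega> x * (u x / norm x powr \<theta>)))"
    unfolding hardy_seminorm_def by (rule pnorm_cong) (simp add: mult.left_commute)
  then have h: "hardy_seminorm p \<theta> \<Omega> (\<lambda>x. c * u x) = c * hardy_seminorm p \<theta> \<Omega> u"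
    unfolding hardy_seminorm_def pnorm_scaleR[OF p] using assms(6) by simp
  have "max (c * u x) 0 powr p = c powr p * max (u x) 0 powr p" for x
  proof -
    have "max (c * u x) 0 = c * max (u x) 0" using assms(6) by (simp add: max_def mult_le_0_iff zero_le_mult_iff)
    then show ?thesis by (simp only: powr_mult)
  qed
  then have P: "pos_integral p \<Omega> (\<lambda>x. c * u x) = c powr p * pos_integral p \<Omega> u"
    unfolding pos_integral_def by (simp only: set_integral_mult_right)
  show ?thesis
    unfolding J_eq[OF X assms(2-5)] J_eq[OF assms(1-5)] h P
    using g b unfolding powr_mult by (simp add: right_diff_distrib distrib_left mult_ac)
qed

subsection \<open>Paths\<close>

lemma continuous_map_lincomb:
  fixes u v :: "'a::euclidean_space \<Rightarrow> real" and \<alpha> \<beta> :: "real \<Rightarrow> real"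
  assumes p: "1 < p" and s: "0 < s" "s < 1" and \<Omega>: "open \<Omega>"
    and u: "u \<in> X_space p \<Omega>" and v: "v \<in> X_space p \<Omega>"
    and c: "continuous_on T \<alpha>" "continuous_on T \<beta>"
  shows "continuous_map (top_of_set T) (X_topology p s \<Omega>) (\<lambda>t x. \<alpha> t * u x + \<beta> t * v x)"
proof -
  let ?\<gamma> = "\<lambda>t x. \<alpha> t * u x + \<beta> t * v x"
  define A where "A = grad_seminorm p \<Omega> u + frac_seminorm p s u"
  define B where "B = grad_seminorm p \<Omega> v + frac_seminorm p s v"
  have X: "(\<lambda>x. a * u x + b * v x) \<in> X_space p \<Omega>" for a b by (rule X_space_lincomb[OF p u v \<Omega>])
  have le: "X_norm p s \<Omega> (\<lambda>x. ?\<gamma> t' x - ?\<gamma> t x) \<le> 2 * (\<bar>\<alpha> t' - \<alpha> t\<bar> * A + \<bar>\<beta> t' - \<beta> t\<bar> * B)" for t t'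
  proof -
    have eq: "(\<lambda>x. ?\<gamma> t' x - ?\<gamma> t x) = (\<lambda>x. (\<alpha> t' - \<alpha> t) * u x + (\<beta> t' - \<beta> t) * v x)"
      by (simp add: algebra_simps)
    have "X_norm p s \<Omega> (\<lambda>x. (\<alpha> t' - \<alpha> t) * u x + (\<beta> t' - \<beta> t) * v x)
        \<le> 2 * ((\<bar>\<alpha> t' - \<alpha> t\<bar> * grad_seminorm p \<Omega> u + \<bar>\<beta> t' - \<beta> t\<bar> * grad_seminorm p \<Omega> v)
          + (\<bar>\<alpha> t' - \<alpha> t\<bar> * frac_seminorm p s u + \<bar>\<beta> t' - \<beta> t\<bar> * frac_seminorm p s v))"
      by (rule order_trans[OF X_norm_bounds(3)[OF p s X \<Omega>] mult_left_mono[OF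
            add_mono[OF grad_seminorm_lincomb[OF u v p \<Omega>] frac_seminorm_lincomb[OF u v p s \<Omega>]]]]) simp
    also have "\<dots> = 2 * (\<bar>\<alpha> t' - \<alpha> t\<bar> * A + \<bar>\<beta> t' - \<beta> t\<bar> * B)"
      unfolding A_def B_def by (simp only: distrib_left add_ac)
    finally show ?thesis by (simp only: eq)
  qed
  have op: "openin (top_of_set T) {t \<in> T. ?\<gamma> t \<in> V}" if V: "openin (X_topology p s \<Omega>) V" for V
    unfolding openin_euclidean_subtopology_iff
  proof (intro conjI ballI)
    fix t assume t: "t \<in> {t \<in> T. ?\<gamma> t \<in> V}"
    then have tT: "t \<in> T" and tV: "?\<gamma> t \<in> V" by simp_all
    have "\<forall>u\<in>V. \<exists>r>0. \<forall>w\<in>X_space p \<Omega>. X_norm p s \<Omega> (\<lambda>x. w x - u x) < r \<longrightarrow> w \<in> V"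
      using V unfolding openin_X_topology by (rule conjunct2)
    from bspec[OF this tV] obtain r where r: "r > 0"
      "\<forall>w\<in>X_space p \<Omega>. X_norm p s \<Omega> (\<lambda>x. w x - ?\<gamma> t x) < r \<longrightarrow> w \<in> V"
      by (elim exE conjE)
    define b where "b t' = 2 * (\<bar>\<alpha> t' - \<alpha> t\<bar> * A + \<bar>\<beta> t' - \<beta> t\<bar> * B)" for t'
    have "continuous_on T b"
      unfolding b_def by (intro continuous_intros c)
    from this[unfolded continuous_on_iff, rule_format, OF tT r(1)]
    obtain e where e: "e > 0" "\<And>t'. t' \<in> T \<Longrightarrow> dist t' t < e \<Longrightarrow> dist (b t') (b t) < r"
      by metis
    have "t' \<in> {t \<in> T. ?\<gamma> t \<in> V}" if "t' \<in> T" "dist t' t < e" for t'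
    proof -
      have "2 * (\<bar>\<alpha> t' - \<alpha> t\<bar> * A + \<bar>\<beta> t' - \<beta> t\<bar> * B) < r"
        using e(2)[OF that] by (simp add: dist_real_def b_def)
      with le[of t' t] have "X_norm p s \<Omega> (\<lambda>x. ?\<gamma> t' x - ?\<gamma> t x) < r" by linarith
      from r(2)[rule_format, OF X this] that(1) show ?thesis by simp
    qed
    with e(1) show "\<exists>e>0. \<forall>t'\<in>T. dist t' t < e \<longrightarrow> t' \<in> {t \<in> T. ?\<gamma> t \<in> V}" by blast
  qed auto
  show ?thesis
    unfolding continuous_map_def using op X by (simp add: Pi_iff)
qed

text \<open>
  The two subtracted terms are nonnegative, so the functional is dominated by the norm of the
  space. The norm is bounded on the compact image of a path. The bound matters because the supremum
  of an unbounded set of reals is unspecified.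
\<close>

lemma bdd_above_J_path:
  fixes \<Omega> :: "'a::euclidean_space set"
  assumes p: "1 < p" and s: "0 < s" "s < 1" and \<Omega>: "open \<Omega>" and \<mu>: "0 \<le> \<mu>" and d: "0 \<le> d"
    and \<gamma>: "\<gamma> \<in> path_set p s \<Omega> \<phi>"
  shows "bdd_above (J p s \<theta> \<mu> \<Omega> d ` \<gamma> ` {-1..1})"
proof -
  have p0: "0 < p" using p by simp
  have cm: "continuous_map (top_of_set {-1..1}) (subtopology (X_topology p s \<Omega>) (S_set p \<Omega>)) \<gamma>"
    using \<gamma> by (simp add: path_set_def)
  then have cmX: "continuous_map (top_of_set {-1..1}) (X_topology p s \<Omega>) \<gamma>"
    by (rule continuous_map_into_fulltopology)
  have X: "\<gamma> t \<in> X_space p \<Omega>" if "t \<in> {-1..1}" for t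
    using continuous_map_image_subset_topspace[OF cmX] that by auto
  define q where "q u = grad_seminorm p \<Omega> u + frac_seminorm p s u" for u
  define V where "V n = {u \<in> X_space p \<Omega>. q u < real n}" for n
  have "openin (X_topology p s \<Omega>) (V n)" for n
    unfolding openin_X_topology
  proof (intro conjI ballI)
    fix u assume u: "u \<in> V n"
    then have uX: "u \<in> X_space p \<Omega>" and r: "(real n - q u) / 2 > 0" by (auto simp: V_def)
    have "v \<in> V n" if v: "v \<in> X_space p \<Omega>" and near: "X_norm p s \<Omega> (\<lambda>x. v x - u x) < (real n - q u) / 2" for v
    proof -
      have w: "(\<lambda>x. v x - u x) \<in> X_space p \<Omega>" using X_space_lincomb[OF p v uX \<Omega>, of 1 "-1"] by simp
      have "grad_seminorm p \<Omega> v \<le> grad_seminorm p \<Omega> u + grad_seminorm p \<Omega> (\<lambda>x. v x - u x)"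
        "frac_seminorm p s v \<le> frac_seminorm p s u + frac_seminorm p s (\<lambda>x. v x - u x)"
        using grad_seminorm_lincomb[OF uX w p \<Omega>, of 1 1] frac_seminorm_lincomb[OF uX w p s \<Omega>, of 1 1] by simp_all
      then have "q v < real n"
        using X_norm_bounds(1,2)[OF p s w \<Omega>] near unfolding q_def by argo
      with v show ?thesis by (simp add: V_def)
    qed
    with r show "\<exists>r>0. \<forall>v\<in>X_space p \<Omega>. X_norm p s \<Omega> (\<lambda>x. v x - u x) < r \<longrightarrow> v \<in> V n" by blast
  qed (auto simp: V_def)
  define W where "W n = {t \<in> {-1..1}. \<gamma> t \<in> V n}" for n
  have W: "openin (top_of_set {-1..1}) (W n)" for n
    using openin_continuous_map_preimage[OF cmX \<open>openin _ (V n)\<close>] by (simp add: W_def)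
  have "{-1..1} \<subseteq> (\<Union>n. W n)"
  proof
    fix t :: real assume t: "t \<in> {-1..1}"
    obtain n where "q (\<gamma> t) < real n" using reals_Archimedean2 by blast
    with t X have "t \<in> W n" by (simp add: W_def V_def)
    then show "t \<in> (\<Union>n. W n)" by blast
  qed
  then obtain D where D: "D \<subseteq> range W" "finite D" "{-1..1} \<subseteq> \<Union>D"
    using compact_Icc[of "-1::real" 1] W unfolding compact_eq_openin_cover by (metis imageE)
  then obtain F where F: "finite F" "D = W ` F" by (meson finite_subset_image)
  have bound: "q (\<gamma> t) \<le> real (\<Sum>F)" if t: "t \<in> {-1..1}" for t
  proof -
    obtain n where n: "n \<in> F" "t \<in> W n" using D(3) F(2) t by blast
    then have "q (\<gamma> t) < real n" by (simp add: W_def V_def)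
    moreover have "n \<le> \<Sum>F" using F(1) n(1) by (rule member_le_sum[of n F "\<lambda>x. x", simplified, rotated]) 
    ultimately show ?thesis by linarith
  qed
  show ?thesis
  proof (rule bdd_aboveI2[where M="2 * real (\<Sum>F) powr p"], elim imageE)
    fix u t assume u: "u = \<gamma> t" "t \<in> {-1..1::real}"
    have uX: "u \<in> X_space p \<Omega>" and qu: "q u \<le> real (\<Sum>F)" using X bound u by auto
    have "J p s \<theta> \<mu> \<Omega> d u \<le> grad_seminorm p \<Omega> u powr p + frac_seminorm p s u powr p"
      unfolding J_eq[OF uX p s \<Omega>] using \<mu> d pos_integral_nonneg[of p \<Omega> u]
      by (simp add: add_increasing2 diff_le_eq)
    also have "\<dots> \<le> q u powr p + q u powr p"
      unfolding q_def using p0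
      by (intro add_mono powr_mono2) (simp_all add: grad_seminorm_nonneg frac_seminorm_nonneg)
    also have "\<dots> \<le> real (\<Sum>F) powr p + real (\<Sum>F) powr p"
      using qu p0 unfolding q_def
      by (intro add_mono powr_mono2) (simp_all add: grad_seminorm_nonneg frac_seminorm_nonneg)
    finally show "J p s \<theta> \<mu> \<Omega> d u \<le> 2 * real (\<Sum>F) powr p" by simp
  qed
qed

text \<open>
  The term with the positive part vanishes at \<open>- \<phi>\<close>, and the other three terms are even.
\<close>

lemma lambda1_le_J_start:
  fixes \<Omega> :: "'a::euclidean_space set"
  assumes p: "1 < p" and s: "0 < s" "s < 1" and \<Omega>: "open \<Omega>"
    and \<phi>: "first_eigenfunction p s \<theta> \<mu> \<Omega> \<phi>"
    and u: "u \<in> X_space p \<Omega>" "AE x in lborel. u x = - \<phi> x"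
  shows "lambda1 p s \<theta> \<mu> \<Omega> \<le> J p s \<theta> \<mu> \<Omega> d u"
proof -
  have p0: "0 < p" using p by simp
  have \<phi>X: "\<phi> \<in> X_space p \<Omega>" and pos: "AE x in lborel. x \<in> \<Omega> \<longrightarrow> \<phi> x > 0"
    and J\<phi>: "J p s \<theta> \<mu> \<Omega> 0 \<phi> = lambda1 p s \<theta> \<mu> \<Omega>"
    using \<phi> by (auto simp: first_eigenfunction_def S_set_def)
  have uX: "(\<lambda>x. -1 * u x + 0 * u x) \<in> X_space p \<Omega>" by (rule X_space_lincomb[OF p u(1) u(1) \<Omega>])
  have ae: "AE x in lborel. \<phi> x = -1 * u x + 0 * u x" using u(2) by eventually_elim simp
  have g: "grad_seminorm p \<Omega> \<phi> \<le> grad_seminorm p \<Omega> u"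
    using grad_seminorm_AE_cong[OF uX \<phi>X p0 \<Omega> ae] grad_seminorm_lincomb[OF u(1) u(1) p \<Omega>, of "-1" 0] by simp
  have "frac_seminorm p s \<phi> powr p \<le> frac_seminorm p s u powr p"
    unfolding frac_seminorm_AE_cong[OF uX \<phi>X p s \<Omega> ae]
    using frac_seminorm_lincomb[OF u(1) u(1) p s \<Omega>, of "-1" 0] p0
    by (intro powr_mono2) (simp_all add: frac_seminorm_nonneg)
  moreover have "grad_seminorm p \<Omega> \<phi> powr p \<le> grad_seminorm p \<Omega> u powr p"
    using g p0 by (intro powr_mono2) (simp_all add: grad_seminorm_nonneg)
  moreover have "hardy_seminorm p \<theta> \<Omega> u = hardy_seminorm p \<theta> \<Omega> \<phi>"
    unfolding hardy_seminorm_def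
  proof (rule pnorm_AE_cong)
    have *: "(\<lambda>x. indicat_real \<Omega> x * (w x / norm x powr \<theta>)) \<in> borel_measurable lborel" if "w \<in> X_space p \<Omega>" for w
    proof -
      have "w \<in> borel_measurable lborel" by (rule in_Lp_measurable[OF X_spaceD(1)[OF that]])
      then have "(\<lambda>x. w x / norm x powr \<theta>) \<in> borel_measurable lborel" by measurable
      then show ?thesis using \<Omega> by (intro borel_measurable_times borel_measurable_indicator) auto
    qed
    show "(\<lambda>x. indicat_real \<Omega> x * (u x / norm x powr \<theta>)) \<in> borel_measurable lborel"
      "(\<lambda>x. indicat_real \<Omega> x * (\<phi> x / norm x powr \<theta>)) \<in> borel_measurable lborel"
      by (rule *[OF u(1)], rule *[OF \<phi>X])
    show "AE x in lborel. norm (indicat_real \<Omega> x * (u x / norm x powr \<theta>)) = norm (indicat_real \<Omega> x * (\<phi> x / norm x powr \<theta>))"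
      using u(2) by eventually_elim simp
  qed
  moreover have "pos_integral p \<Omega> u = 0"
  proof -
    have "AE x in lborel. indicat_real \<Omega> x *\<^sub>R (max (u x) 0 powr p) = 0"
      using u(2) pos by eventually_elim (use p0 in \<open>auto simp: indicator_def\<close>)
    then show ?thesis
      unfolding pos_integral_def set_lebesgue_integral_def by (rule integral_eq_zero_AE)
  qed
  ultimately show ?thesis
    unfolding J\<phi>[symmetric] J_eq[OF \<phi>X p s \<Omega>] J_eq[OF u(1) p s \<Omega>] by simp
qed

lemma lambda1_le_SUP_path:
  fixes \<Omega> :: "'a::euclidean_space set"
  assumes p: "1 < p" and s: "0 < s" "s < 1" and \<Omega>: "open \<Omega>" and \<mu>: "0 \<le> \<mu>" and d: "0 \<le> d"
    and \<phi>: "first_eigenfunction p s \<theta> \<mu> \<Omega> \<phi>" and \<gamma>: "\<gamma> \<in> path_set p s \<Omega> \<phi>"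
  shows "lambda1 p s \<theta> \<mu> \<Omega> \<le> (SUP u\<in>\<gamma> ` {-1..1}. J p s \<theta> \<mu> \<Omega> d u)"
proof -
  have "continuous_map (top_of_set {-1..1}) (X_topology p s \<Omega>) \<gamma>"
    using \<gamma> continuous_map_into_fulltopology by (auto simp: path_set_def)
  then have "\<gamma> (-1) \<in> X_space p \<Omega>"
    using continuous_map_image_subset_topspace by fastforce
  then have "lambda1 p s \<theta> \<mu> \<Omega> \<le> J p s \<theta> \<mu> \<Omega> d (\<gamma> (-1))"
    using \<gamma> by (intro lambda1_le_J_start[OF p s \<Omega> \<phi>]) (simp_all add: path_set_def)
  also have "\<dots> \<le> (SUP u\<in>\<gamma> ` {-1..1}. J p s \<theta> \<mu> \<Omega> d u)"
    by (rule cSUP_upper[OF _ bdd_above_J_path[OF p s \<Omega> \<mu> d \<gamma>]]) simp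
  finally show ?thesis .
qed

section \<open>Low paths and the limit of the minimax levels\<close>

lemma continuous_on_pnorm_lincomb:
  fixes u v :: "'c \<Rightarrow> real"
  assumes p: "1 \<le> p" and u: "in_Lp M p u" and v: "in_Lp M p v"
  shows "continuous_on T (\<lambda>t. pnorm M p (\<lambda>x. t * u x + (1 - \<bar>t\<bar>) * v x))"
proof (rule lipschitz_on_continuous_on[OF lipschitz_onI])
  let ?n = "\<lambda>t. pnorm M p (\<lambda>x. t * u x + (1 - \<bar>t\<bar>) * v x)"
  have p0: "0 < p" using p by simp
  have L: "in_Lp M p (\<lambda>x. t * u x + (1 - \<bar>t\<bar>) * v x)" for t :: real
    by (rule in_Lp_lincomb_real[OF p0 u v])
  have le: "?n t \<le> ?n r + \<bar>t - r\<bar> * (pnorm M p u + pnorm M p v)" for t r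
  proof -
    have eq: "(\<lambda>x. (t * u x + (1 - \<bar>t\<bar>) * v x) - (r * u x + (1 - \<bar>r\<bar>) * v x)) = (\<lambda>x. (t - r) * u x + (\<bar>r\<bar> - \<bar>t\<bar>) * v x)"
      by (simp add: algebra_simps)
    have "?n t \<le> ?n r + pnorm M p (\<lambda>x. (t - r) * u x + (\<bar>r\<bar> - \<bar>t\<bar>) * v x)"
      using pnorm_le_add_diff[OF p L L, of t r] by (simp only: eq)
    also have "pnorm M p (\<lambda>x. (t - r) * u x + (\<bar>r\<bar> - \<bar>t\<bar>) * v x) \<le> \<bar>t - r\<bar> * pnorm M p u + \<bar>\<bar>r\<bar> - \<bar>t\<bar>\<bar> * pnorm M p v"
      by (rule pnorm_lincomb_real[OF p u v])
    also have "\<dots> \<le> \<bar>t - r\<bar> * pnorm M p u + \<bar>t - r\<bar> * pnorm M p v"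
      by (intro add_left_mono mult_right_mono pnorm_nonneg) linarith
    finally show ?thesis by (simp add: distrib_left)
  qed
  show "dist (?n t) (?n r) \<le> (pnorm M p u + pnorm M p v) * dist t r" for t r
    using le[of t r] le[of r t] by (simp add: dist_real_def abs_le_iff abs_minus_commute[of r t] mult.commute)
  show "0 \<le> pnorm M p u + pnorm M p v" by (simp add: pnorm_nonneg)
qed

text \<open>
  For small \<open>\<tau>\<close> the energy of \<open>- (1 - \<tau>) \<phi> + \<tau> \<psi>\<close> exceeds that of \<open>\<phi>\<close> by little, uniformly in all
  \<open>\<psi>\<close> whose seminorms are at most 1. Here \<open>A\<close>, \<open>B\<close>, \<open>H\<close> stand for the three seminorms of \<open>\<phi>\<close>. The two-sided
  condition on \<open>n\<close>, the \<open>L\<^sup>p\<close> norm of the combination, covers both signs of \<open>\<Lambda>\<close>.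
\<close>

lemma near_start_estimate:
  fixes A B H \<mu> \<Lambda> p :: real
  assumes p: "0 < p" and nn: "0 \<le> A" "0 \<le> B" "0 \<le> H"
    and less: "A powr p + B powr p - \<mu> * H powr p < \<Lambda>"
  obtains \<eta> where "0 < \<eta>" "\<eta> \<le> 1 / 4"
    "\<And>\<tau> n. 0 \<le> \<tau> \<Longrightarrow> \<tau> \<le> \<eta> \<Longrightarrow> 1 - 2 * \<tau> \<le> n \<Longrightarrow> n \<le> 1 + 2 * \<tau> \<Longrightarrow>
       (A + \<tau>) powr p + (B + \<tau>) powr p - \<mu> * max 0 ((1 - \<tau>) * H - \<tau>) powr p \<le> \<Lambda> * n powr p"
proof -
  define F where "F \<tau> = (A + \<tau>) powr p + (B + \<tau>) powr p - \<mu> * max 0 ((1 - \<tau>) * H - \<tau>) powr p" for \<tau>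
  have F0: "F 0 < \<Lambda>" using less nn by (simp add: F_def)
  have ev0: "\<forall>\<^sub>F \<tau> in at_right 0. (0::real) \<le> \<tau>" by (simp add: eventually_at_filter)
  have "\<forall>\<^sub>F \<tau> in at_right 0. 0 \<le> A + \<tau>" using ev0 by eventually_elim (use nn in simp)
  then have tA: "((\<lambda>\<tau>. (A + \<tau>) powr p) \<longlongrightarrow> (A + 0) powr p) (at_right 0)"
    using p by (intro tendsto_powr'[OF tendsto_add[OF tendsto_const tendsto_ident_at] tendsto_const]) simp
  have "\<forall>\<^sub>F \<tau> in at_right 0. 0 \<le> B + \<tau>" using ev0 by eventually_elim (use nn in simp)
  then have tB: "((\<lambda>\<tau>. (B + \<tau>) powr p) \<longlongrightarrow> (B + 0) powr p) (at_right 0)"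
    using p by (intro tendsto_powr'[OF tendsto_add[OF tendsto_const tendsto_ident_at] tendsto_const]) simp
  have "((\<lambda>\<tau>. max 0 ((1 - \<tau>) * H - \<tau>)) \<longlongrightarrow> max 0 ((1 - 0) * H - 0)) (at_right 0)"
    by (intro tendsto_intros)
  then have tH: "((\<lambda>\<tau>. max 0 ((1 - \<tau>) * H - \<tau>) powr p) \<longlongrightarrow> max 0 ((1 - 0) * H - 0) powr p) (at_right 0)"
    by (rule tendsto_powr'[OF _ tendsto_const]) (use p in simp)
  have tF: "(F \<longlongrightarrow> F 0) (at_right 0)"
    unfolding F_def by (intro tendsto_add tendsto_diff tendsto_mult tendsto_const tA tB tH)
  have tn: "((\<lambda>\<tau>. \<Lambda> * (1 + c * \<tau>) powr p) \<longlongrightarrow> \<Lambda> * (1 + c * 0) powr p) (at_right 0)" for c :: real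
    by (rule tendsto_mult[OF tendsto_const tendsto_powr'[OF tendsto_add[OF tendsto_const
              tendsto_mult[OF tendsto_const tendsto_ident_at]] tendsto_const]]) simp
  have ev: "\<forall>\<^sub>F \<tau> in at_right 0. 0 < \<Lambda> * (1 + c * \<tau>) powr p - F \<tau>" for c :: real
    by (rule order_tendstoD(1)[OF tendsto_diff[OF tn tF]]) (use F0 in simp)
  obtain b where b: "b > 0" "\<And>\<tau>. 0 < \<tau> \<Longrightarrow> \<tau> < b \<Longrightarrow> 0 < \<Lambda> * (1 + 2 * \<tau>) powr p - F \<tau> \<and> 0 < \<Lambda> * (1 + (-2) * \<tau>) powr p - F \<tau>"
    using eventually_conj[OF ev[of 2] ev[of "-2"]] unfolding eventually_at_right_field by blast
  show thesis
  proof (rule that[of "min (b / 2) (1 / 4)"])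
    show "0 < min (b / 2) (1 / 4)" "min (b / 2) (1 / 4) \<le> 1 / 4" using b(1) by simp_all
    fix \<tau> n assume \<tau>: "0 \<le> \<tau>" "\<tau> \<le> min (b / 2) (1 / 4)" and n: "1 - 2 * \<tau> \<le> n" "n \<le> 1 + 2 * \<tau>"
    have "F \<tau> \<le> \<Lambda> * n powr p"
    proof (cases "\<tau> = 0")
      case True
      then show ?thesis using n F0 by simp
    next
      case False
      with \<tau> b have F: "F \<tau> < \<Lambda> * (1 + 2 * \<tau>) powr p" "F \<tau> < \<Lambda> * (1 - 2 * \<tau>) powr p"
        using b(2)[of \<tau>] by simp_all
      have n': "(1 - 2 * \<tau>) powr p \<le> n powr p" "n powr p \<le> (1 + 2 * \<tau>) powr p"
        using n \<tau> p by (intro powr_mono2; simp)+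
      show ?thesis
      proof (cases "\<Lambda> \<ge> 0")
        case True
        from mult_left_mono[OF n'(1) this] F(2) show ?thesis by linarith
      next
        case False
        then have "\<Lambda> \<le> 0" by simp
        from mult_left_mono_neg[OF n'(2) this] F(1) show ?thesis by linarith
      qed
    qed
    then show "(A + \<tau>) powr p + (B + \<tau>) powr p - \<mu> * max 0 ((1 - \<tau>) * H - \<tau>) powr p \<le> \<Lambda> * n powr p"
      by (simp only: F_def)
  qed
qed

text \<open>
  The path joins \<open>- \<phi>\<close> to \<open>\<phi>\<close> through a bump \<open>\<psi>\<close>, after normalisation of \<open>t \<phi> + (1 - \<bar>t\<bar>) \<psi>\<close>. The
  bump has small norm, so the energy is low while \<open>t \<le> - 1 + \<eta>\<close>. It is so high near \<open>a\<close> that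
  afterwards the function exceeds a fixed positive number on a fixed set of positive measure, where
  the term with \<open>d\<close> makes the functional as negative as desired.
\<close>

lemma exists_low_path:
  fixes \<Omega> :: "'a::euclidean_space set"
  assumes p: "1 < p" "p < real DIM('a)" and s: "0 < s" "s < 1" and \<theta>: "0 \<le> \<theta>" and \<mu>: "0 \<le> \<mu>"
    and \<Omega>: "open \<Omega>" "\<Omega> \<noteq> {}" and \<phi>: "first_eigenfunction p s \<theta> \<mu> \<Omega> \<phi>" and \<epsilon>: "0 < \<epsilon>"
  obtains d0 \<gamma> where "0 \<le> d0" "\<gamma> \<in> path_set p s \<Omega> \<phi>"
    "\<And>d t. d0 \<le> d \<Longrightarrow> t \<in> {-1..1} \<Longrightarrow> J p s \<theta> \<mu> \<Omega> d (\<gamma> t) \<le> lambda1 p s \<theta> \<mu> \<Omega> + \<epsilon>"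
proof -
  have p0: "0 < p" "1 \<le> p" using p by auto
  define \<Lambda> where "\<Lambda> = lambda1 p s \<theta> \<mu> \<Omega> + \<epsilon>"
  have \<phi>S: "\<phi> \<in> S_set p \<Omega>" and pos: "AE x in lborel. x \<in> \<Omega> \<longrightarrow> \<phi> x > 0"
    and J\<phi>: "J p s \<theta> \<mu> \<Omega> 0 \<phi> = lambda1 p s \<theta> \<mu> \<Omega>"
    using \<phi> by (auto simp: first_eigenfunction_def)
  have \<phi>X: "\<phi> \<in> X_space p \<Omega>" and \<phi>1: "pnorm lborel p \<phi> = 1"
    using \<phi>S by (simp_all add: S_set_iff[OF p0(1) \<Omega>(1)])
  have L\<phi>: "in_Lp lborel p \<phi>" by (rule X_spaceD(1)[OF \<phi>X])
  have m\<phi>: "\<phi> \<in> borel_measurable lborel" by (rule in_Lp_measurable[OF L\<phi>])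
  define A where "A = grad_seminorm p \<Omega> \<phi>"
  define B where "B = frac_seminorm p s \<phi>"
  define H where "H = hardy_seminorm p \<theta> \<Omega> \<phi>"
  have nn: "0 \<le> A" "0 \<le> B" "0 \<le> H"
    by (simp_all add: A_def B_def H_def grad_seminorm_nonneg frac_seminorm_nonneg hardy_seminorm_def pnorm_nonneg)
  have "A powr p + B powr p - \<mu> * H powr p < \<Lambda>"
    using J\<phi> \<epsilon> unfolding J_eq[OF \<phi>X p(1) s \<Omega>(1)] A_def B_def H_def \<Lambda>_def by simp
  from near_start_estimate[OF p0(1) nn this] obtain \<eta> where \<eta>: "0 < \<eta>" "\<eta> \<le> 1 / 4"
    and near: "\<And>\<tau> n. 0 \<le> \<tau> \<Longrightarrow> \<tau> \<le> \<eta> \<Longrightarrow> 1 - 2 * \<tau> \<le> n \<Longrightarrow> n \<le> 1 + 2 * \<tau> \<Longrightarrow>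
       (A + \<tau>) powr p + (B + \<tau>) powr p - \<mu> * max 0 ((1 - \<tau>) * H - \<tau>) powr p \<le> \<Lambda> * n powr p"
    by blast
  obtain a m where a: "a \<in> \<Omega>" "a \<noteq> 0" and m: "1 \<le> m"
    and spot: "\<And>r. r > 0 \<Longrightarrow> \<not> negligible ({x \<in> \<Omega>. 1 / m \<le> \<phi> x \<and> \<phi> x \<le> m} \<inter> ball a r)"
    using exists_point_of_local_boundedness[OF \<Omega> pos] by blast
  \<comment> \<open>This height makes \<open>\<psi>\<close> win against \<open>- \<phi> \<ge> - m\<close> by at least 1 when its weight is \<open>\<eta>\<close>.\<close>
  define \<kappa> where "\<kappa> = (m + 1) / \<eta>"
  have \<kappa>: "0 < \<kappa>" "1 \<le> \<kappa>" "\<eta> * \<kappa> = m + 1" using \<eta> m by (simp_all add: \<kappa>_def field_simps)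
  obtain \<psi> r where \<psi>: "\<psi> \<in> test_functions \<Omega>" "\<And>x. 0 \<le> \<psi> x" "0 < r" "\<And>x. x \<in> ball a r \<Longrightarrow> \<kappa> \<le> \<psi> x"
    and \<psi>1: "grad_seminorm p \<Omega> \<psi> \<le> 1" "frac_seminorm p s \<psi> \<le> 1" "pnorm lborel p \<psi> \<le> 1"
    and \<psi>H: "in_Lp lborel p (\<lambda>x. indicator \<Omega> x * (\<psi> x / norm x powr \<theta>))" "hardy_seminorm p \<theta> \<Omega> \<psi> \<le> 1"
    using exists_high_bump_of_small_norm[OF p s \<theta> \<Omega>(1) a \<kappa>(1) zero_less_one] by blast
  have \<psi>X: "\<psi> \<in> X_space p \<Omega>" by (rule test_functions_subset_X_space[OF \<psi>(1) p0(1)])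
  have L\<psi>: "in_Lp lborel p \<psi>" by (rule X_spaceD(1)[OF \<psi>X])
  define W where "W = {x \<in> \<Omega>. 1 / m \<le> \<phi> x \<and> \<phi> x \<le> m} \<inter> ball a r"
  have Wm: "W \<in> sets lborel"
  proof -
    have [measurable]: "\<phi> \<in> borel_measurable borel" using m\<phi> by simp
    have "{x. 1 / m \<le> \<phi> x \<and> \<phi> x \<le> m} \<in> sets borel" by measurable
    moreover have "W = {x. 1 / m \<le> \<phi> x \<and> \<phi> x \<le> m} \<inter> \<Omega> \<inter> ball a r" by (auto simp: W_def)
    ultimately show ?thesis using \<Omega>(1) by simp
  qed
  have Wfin: "emeasure lborel W < \<infinity>"
  proof -
    have "emeasure lborel W \<le> emeasure lborel (ball a r)" using Wm by (intro emeasure_mono) (auto simp: W_def)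
    also have "\<dots> < \<infinity>" using emeasure_lborel_ball_finite[of a r] by simp
    finally show ?thesis .
  qed
  have Wpos: "measure lborel W > 0"
  proof -
    have "emeasure lborel W \<noteq> 0"
    proof
      assume "emeasure lborel W = 0"
      then have "W \<in> null_sets lborel" using Wm by auto
      then have "negligible W" by (simp add: negligible_iff_null_sets null_sets_completionI)
      with spot[OF \<psi>(3)] show False by (simp add: W_def)
    qed
    with Wfin show ?thesis by (simp add: measure_def enn2real_positive_iff zero_less_iff_neq_zero)
  qed
  define c where "c = (1 / m) powr p * measure lborel W"
  have c: "c > 0" using Wpos m by (simp add: c_def)
  define v where "v t x = t * \<phi> x + (1 - \<bar>t\<bar>) * \<psi> x" for t x
  define n where "n t = pnorm lborel p (v t)" for t
  have vX: "v t \<in> X_space p \<Omega>" for t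
    unfolding v_def by (rule X_space_lincomb[OF p(1) \<phi>X \<psi>X \<Omega>(1)])
  have Lv: "in_Lp lborel p (v t)" for t by (rule X_spaceD(1)[OF vX])
  have gv: "grad_seminorm p \<Omega> (v t) \<le> \<bar>t\<bar> * A + (1 - \<bar>t\<bar>)" if "t \<in> {-1..1}" for t
  proof -
    have "grad_seminorm p \<Omega> (v t) \<le> \<bar>t\<bar> * A + \<bar>1 - \<bar>t\<bar>\<bar> * grad_seminorm p \<Omega> \<psi>"
      unfolding v_def A_def by (rule grad_seminorm_lincomb[OF \<phi>X \<psi>X p(1) \<Omega>(1)])
    also have "\<bar>1 - \<bar>t\<bar>\<bar> * grad_seminorm p \<Omega> \<psi> \<le> \<bar>1 - \<bar>t\<bar>\<bar> * 1"
      by (rule mult_left_mono[OF \<psi>1(1)]) simp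
    finally show ?thesis using that by (auto simp: abs_le_iff)
  qed
  have bv: "frac_seminorm p s (v t) \<le> \<bar>t\<bar> * B + (1 - \<bar>t\<bar>)" if "t \<in> {-1..1}" for t
  proof -
    have "frac_seminorm p s (v t) \<le> \<bar>t\<bar> * B + \<bar>1 - \<bar>t\<bar>\<bar> * frac_seminorm p s \<psi>"
      unfolding v_def B_def by (rule frac_seminorm_lincomb[OF \<phi>X \<psi>X p(1) s \<Omega>(1)])
    also have "\<bar>1 - \<bar>t\<bar>\<bar> * frac_seminorm p s \<psi> \<le> \<bar>1 - \<bar>t\<bar>\<bar> * 1"
      by (rule mult_left_mono[OF \<psi>1(2)]) simp
    finally show ?thesis using that by (auto simp: abs_le_iff)
  qed
  have nv: "n t \<le> 1" if "t \<in> {-1..1}" for t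
  proof -
    have "n t \<le> \<bar>t\<bar> * 1 + \<bar>1 - \<bar>t\<bar>\<bar> * pnorm lborel p \<psi>"
      unfolding n_def v_def \<phi>1[symmetric] by (rule pnorm_lincomb_real[OF p0(2) L\<phi> L\<psi>])
    also have "\<bar>1 - \<bar>t\<bar>\<bar> * pnorm lborel p \<psi> \<le> \<bar>1 - \<bar>t\<bar>\<bar> * 1"
      by (rule mult_left_mono[OF \<psi>1(3)]) simp
    finally show ?thesis using that by (auto simp: abs_le_iff)
  qed
  have n_lower: "1 - 2 * (1 - \<bar>t\<bar>) \<le> n t" if "t \<in> {-1..1}" for t
  proof -
    have "pnorm lborel p (\<lambda>x. t * \<phi> x + 0 * \<psi> x) \<le> n t + pnorm lborel p (\<lambda>x. (t * \<phi> x + 0 * \<psi> x) - v t x)"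
      unfolding n_def by (rule pnorm_le_add_diff[OF p0(2) in_Lp_lincomb_real[OF p0(1) L\<phi> L\<psi>] Lv])
    moreover have "pnorm lborel p (\<lambda>x. t * \<phi> x + 0 * \<psi> x) = \<bar>t\<bar>"
      using pnorm_scaleR[OF p0(1), of lborel t \<phi>] \<phi>1 by simp
    moreover have "pnorm lborel p (\<lambda>x. (t * \<phi> x + 0 * \<psi> x) - v t x) = \<bar>1 - \<bar>t\<bar>\<bar> * pnorm lborel p \<psi>"
      unfolding v_def pnorm_scaleR[OF p0(1), symmetric] by (rule pnorm_cong) simp
    moreover have "\<bar>1 - \<bar>t\<bar>\<bar> * pnorm lborel p \<psi> \<le> \<bar>1 - \<bar>t\<bar>\<bar> * 1"
      by (rule mult_left_mono[OF \<psi>1(3)]) simp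
    ultimately show ?thesis using that by (auto simp: abs_le_iff)
  qed
  \<comment> \<open>If the Hardy integral of \<open>\<phi>\<close> diverged, then \<open>H\<close> would be 0 by convention and the bound trivial.\<close>
  have hv: "max 0 (\<bar>t\<bar> * H - (1 - \<bar>t\<bar>)) \<le> hardy_seminorm p \<theta> \<Omega> (v t)" if t: "t \<in> {-1..1}" for t
  proof -
    let ?h = "\<lambda>u x. indicator \<Omega> x * (u x / norm x powr \<theta>)"
    have 0: "0 \<le> hardy_seminorm p \<theta> \<Omega> (v t)" by (simp add: hardy_seminorm_def pnorm_nonneg)
    have "\<bar>t\<bar> * H - (1 - \<bar>t\<bar>) \<le> hardy_seminorm p \<theta> \<Omega> (v t)"
    proof (cases "in_Lp lborel p (?h \<phi>)")
      case True
      have eq: "?h (v t) = (\<lambda>x. t * ?h \<phi> x + (1 - \<bar>t\<bar>) * ?h \<psi> x)"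
        unfolding v_def divide_inverse by (rule ext) (simp only: algebra_simps)
      have Lh: "in_Lp lborel p (?h (v t))"
        unfolding eq by (rule in_Lp_lincomb_real[OF p0(1) True \<psi>H(1)])
      have "pnorm lborel p (\<lambda>x. t *\<^sub>R ?h \<phi> x) \<le> pnorm lborel p (?h (v t)) + pnorm lborel p (\<lambda>x. t *\<^sub>R ?h \<phi> x - ?h (v t) x)"
        by (rule pnorm_le_add_diff[OF p0(2) in_Lp_scaleR[OF True] Lh])
      moreover have "pnorm lborel p (\<lambda>x. t *\<^sub>R ?h \<phi> x) = \<bar>t\<bar> * H"
        unfolding H_def hardy_seminorm_def by (rule pnorm_scaleR[OF p0(1)])
      moreover have "pnorm lborel p (\<lambda>x. t *\<^sub>R ?h \<phi> x - ?h (v t) x) = \<bar>1 - \<bar>t\<bar>\<bar> * hardy_seminorm p \<theta> \<Omega> \<psi>"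
        unfolding hardy_seminorm_def pnorm_scaleR[OF p0(1), symmetric]
      proof (rule pnorm_cong)
        fix x
        have "?h (v t) x = t * ?h \<phi> x + (1 - \<bar>t\<bar>) * ?h \<psi> x" using eq by (rule fun_cong)
        then have "t *\<^sub>R ?h \<phi> x - ?h (v t) x = - ((1 - \<bar>t\<bar>) *\<^sub>R ?h \<psi> x)"
          unfolding real_scaleR_def by linarith
        then show "norm (t *\<^sub>R ?h \<phi> x - ?h (v t) x) = norm ((1 - \<bar>t\<bar>) *\<^sub>R ?h \<psi> x)"
          by (simp only: norm_minus_cancel)
      qed
      moreover have "\<bar>1 - \<bar>t\<bar>\<bar> * hardy_seminorm p \<theta> \<Omega> \<psi> \<le> \<bar>1 - \<bar>t\<bar>\<bar> * 1"
        by (rule mult_left_mono[OF \<psi>H(2)]) simp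
      ultimately show ?thesis using t unfolding hardy_seminorm_def by (auto simp: abs_le_iff)
    next
      case False
      have mh: "?h \<phi> \<in> borel_measurable lborel"
      proof -
        have "(\<lambda>x. \<phi> x / norm x powr \<theta>) \<in> borel_measurable lborel" using m\<phi> by measurable
        then show ?thesis using \<Omega>(1) by (intro borel_measurable_times borel_measurable_indicator) auto
      qed
      with False have "\<not> integrable lborel (\<lambda>x. norm (?h \<phi> x) powr p)" by (simp add: in_Lp_def)
      then have "H = 0"
        unfolding H_def hardy_seminorm_def pnorm_def by (simp add: not_integrable_integral_eq)
      then show ?thesis using 0 t by (auto simp: abs_le_iff)
    qed
    with 0 show ?thesis by simp
  qed
  have Pv: "c \<le> pos_integral p \<Omega> (v t)" if t: "- 1 + \<eta> \<le> t" "t \<le> 1" for t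
  proof -
    have ge: "1 / m \<le> v t x" if x: "x \<in> W" for x
    proof -
      have x': "1 / m \<le> \<phi> x" "\<phi> x \<le> m" "\<kappa> \<le> \<psi> x" using x \<psi>(4)[of x] by (auto simp: W_def)
      have m1: "1 / m \<le> 1" using m by simp
      have \<phi>0: "0 \<le> \<phi> x" by (rule order_trans[OF _ x'(1)]) (use m in simp)
      show ?thesis
      proof (cases "t \<ge> 0")
        case True
        have "t * (1 / m) + (1 - t) * (1 / m) \<le> t * \<phi> x + (1 - t) * \<psi> x"
          using True t x' m1 \<kappa>(2) by (intro add_mono mult_left_mono) auto
        moreover have "t * (1 / m) + (1 - t) * (1 / m) = 1 / m"
          by (simp add: add_divide_distrib[symmetric])
        ultimately show ?thesis using True by (simp add: v_def)
      next
        case False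
        have "\<eta> * \<kappa> \<le> (1 + t) * \<psi> x"
          using False t x'(3) \<kappa>(1) \<eta> by (intro mult_mono) auto
        moreover have "- t * \<phi> x \<le> 1 * m"
          using False t x'(2) \<phi>0 \<eta> m by (intro mult_mono) auto
        ultimately show ?thesis using False m1 \<kappa>(3) by (simp add: v_def)
      qed
    qed
    have mv: "v t \<in> borel_measurable lborel" by (rule in_Lp_measurable[OF Lv])
    have mmax: "(\<lambda>x. max (v t x) 0) \<in> borel_measurable lborel" using mv by measurable
    have "in_Lp lborel p (\<lambda>x. max (v t x) 0)"
      by (rule in_Lp_bound[OF p0(1) Lv[of t] mmax]) (rule AE_I2, simp)
    then have int: "integrable lborel (\<lambda>x. indicator \<Omega> x *\<^sub>R max (v t x) 0 powr p)"
      using \<Omega>(1) by (intro integrable_mult_indicator) (simp_all add: in_Lp_def)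
    have intW: "integrable lborel (\<lambda>x. (1 / m) powr p * indicator W x)"
      using Wm Wfin by (intro integrable_mult_right integrable_real_indicator) auto
    have le: "(1 / m) powr p * indicator W x \<le> indicator \<Omega> x *\<^sub>R max (v t x) 0 powr p" for x
    proof (cases "x \<in> W")
      case True
      then have "x \<in> \<Omega>" by (simp add: W_def)
      moreover have "(1 / m) powr p \<le> max (v t x) 0 powr p"
        using ge[OF True] m p0 by (intro powr_mono2) auto
      ultimately show ?thesis using True by simp
    qed simp
    have "c = (LINT x|lborel. (1 / m) powr p * indicator W x)"
      unfolding c_def using Wm by simp
    also have "\<dots> \<le> (LINT x|lborel. indicator \<Omega> x *\<^sub>R max (v t x) 0 powr p)"
      by (rule integral_mono[OF intW int le])
    finally show ?thesis by (simp add: pos_integral_def set_lebesgue_integral_def)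
  qed
  \<comment> \<open>For \<open>d \<ge> d0\<close> the functional is at most \<open>- \<bar>\<Lambda>\<bar>\<close> at \<open>v t\<close> for \<open>t\<close> above \<open>- 1 + \<eta>\<close>.\<close>
  define d0 where "d0 = ((A + 1) powr p + (B + 1) powr p + \<bar>\<Lambda>\<bar>) / c"
  have d0: "0 \<le> d0" using c by (simp add: d0_def)
  have Jv: "J p s \<theta> \<mu> \<Omega> d (v t) \<le> \<Lambda> * n t powr p" if d: "d0 \<le> d" and t: "t \<in> {-1..1}" for d t
  proof (cases "t \<le> - 1 + \<eta>")
    case True
    define \<tau> where "\<tau> = 1 + t"
    have \<tau>: "0 \<le> \<tau>" "\<tau> \<le> \<eta>" "\<bar>t\<bar> = 1 - \<tau>" using True t \<eta> by (auto simp: \<tau>_def)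
    have "(1 - \<tau>) * A \<le> 1 * A" "(1 - \<tau>) * B \<le> 1 * B"
      using nn \<tau> by (intro mult_right_mono; simp)+
    then have "grad_seminorm p \<Omega> (v t) \<le> A + \<tau>" "frac_seminorm p s (v t) \<le> B + \<tau>"
      using gv[OF t] bv[OF t] \<tau>(3) by simp_all
    then have "grad_seminorm p \<Omega> (v t) powr p \<le> (A + \<tau>) powr p" "frac_seminorm p s (v t) powr p \<le> (B + \<tau>) powr p"
      using p0 by (intro powr_mono2; simp add: grad_seminorm_nonneg frac_seminorm_nonneg)+
    moreover have "\<mu> * max 0 ((1 - \<tau>) * H - \<tau>) powr p \<le> \<mu> * hardy_seminorm p \<theta> \<Omega> (v t) powr p"
      using hv[OF t] \<mu> p0 \<tau>(3) by (intro mult_left_mono powr_mono2) auto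
    moreover have "0 \<le> d * pos_integral p \<Omega> (v t)"
      using d d0 by (intro mult_nonneg_nonneg pos_integral_nonneg) simp
    ultimately have "J p s \<theta> \<mu> \<Omega> d (v t)
        \<le> (A + \<tau>) powr p + (B + \<tau>) powr p - \<mu> * max 0 ((1 - \<tau>) * H - \<tau>) powr p"
      unfolding J_eq[OF vX p(1) s \<Omega>(1)] by linarith
    also have "\<dots> \<le> \<Lambda> * n t powr p"
    proof (rule near[OF \<tau>(1,2)])
      show "1 - 2 * \<tau> \<le> n t" using n_lower[OF t] \<tau>(3) by simp
      show "n t \<le> 1 + 2 * \<tau>" using nv[OF t] \<tau>(1) by simp
    qed
    finally show ?thesis .
  next
    case False
    have t1: "\<bar>t\<bar> \<le> 1" using t by auto
    have "\<bar>t\<bar> * A \<le> 1 * A" "\<bar>t\<bar> * B \<le> 1 * B"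
      by (rule mult_right_mono[OF t1 nn(1)], rule mult_right_mono[OF t1 nn(2)])
    then have "grad_seminorm p \<Omega> (v t) \<le> A + 1" "frac_seminorm p s (v t) \<le> B + 1"
      using gv[OF t] bv[OF t] by simp_all
    then have "grad_seminorm p \<Omega> (v t) powr p \<le> (A + 1) powr p" "frac_seminorm p s (v t) powr p \<le> (B + 1) powr p"
      using p0 by (intro powr_mono2; simp add: grad_seminorm_nonneg frac_seminorm_nonneg)+
    moreover have "0 \<le> \<mu> * hardy_seminorm p \<theta> \<Omega> (v t) powr p" using \<mu> by simp
    moreover have "d0 * c \<le> d * pos_integral p \<Omega> (v t)"
      using Pv[of t] False t d d0 c by (intro mult_mono) auto
    moreover have "d0 * c = (A + 1) powr p + (B + 1) powr p + \<bar>\<Lambda>\<bar>" using c by (simp add: d0_def)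
    ultimately have "J p s \<theta> \<mu> \<Omega> d (v t) \<le> - \<bar>\<Lambda>\<bar>"
      unfolding J_eq[OF vX p(1) s \<Omega>(1)] by linarith
    moreover have "- \<bar>\<Lambda>\<bar> \<le> \<Lambda> * n t powr p"
    proof -
      have "n t powr p \<le> 1 powr p" using nv[OF t] p0 by (intro powr_mono2) (simp_all add: n_def pnorm_nonneg)
      then have "\<bar>\<Lambda> * n t powr p\<bar> \<le> \<bar>\<Lambda>\<bar> * 1" unfolding abs_mult by (intro mult_left_mono) simp_all
      then show ?thesis by linarith
    qed
    ultimately show ?thesis by linarith
  qed
  have npos: "0 < n t" if t: "t \<in> {-1..1}" for t
  proof (cases "t \<le> - 1 + \<eta>")
    case True
    then show ?thesis using n_lower[OF t] t \<eta> by auto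
  next
    case False
    have "n t \<noteq> 0"
    proof
      assume n0: "n t = 0"
      have "pos_integral p \<Omega> (v t) \<le> (LINT x:\<Omega>|lborel. \<bar>v t x\<bar> powr p)"
        unfolding pos_integral_def
      proof (rule set_integral_mono)
        have mmax: "(\<lambda>x. max (v t x) 0) \<in> borel_measurable lborel"
          using in_Lp_measurable[OF Lv[of t]] by measurable
        have \<Omega>s: "\<Omega> \<in> sets lborel" using \<Omega>(1) by simp
        have "in_Lp lborel p (\<lambda>x. max (v t x) 0)"
          by (rule in_Lp_bound[OF p0(1) Lv[of t] mmax]) (rule AE_I2, simp)
        with Lv[of t] show "set_integrable lborel \<Omega> (\<lambda>x. max (v t x) 0 powr p)"
          "set_integrable lborel \<Omega> (\<lambda>x. \<bar>v t x\<bar> powr p)"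
          unfolding set_integrable_def
          by (intro integrable_mult_indicator[OF \<Omega>s]; simp add: in_Lp_def)+
        show "max (v t x) 0 powr p \<le> \<bar>v t x\<bar> powr p" for x
          using p0 by (intro powr_mono2) auto
      qed
      also have "\<dots> = 0" using X_space_Lp_integral[OF vX p0(1) \<Omega>(1), of t] n0 p0 by (simp add: n_def)
      finally show False using Pv[of t] False t c by simp
    qed
    then show ?thesis using pnorm_nonneg[of lborel p "v t"] by (simp add: n_def)
  qed
  have ncont: "continuous_on {-1..1} n"
    unfolding n_def v_def by (rule continuous_on_pnorm_lincomb[OF p0(2) L\<phi> L\<psi>])
  define \<gamma> where "\<gamma> t x = (t / n t) * \<phi> x + ((1 - \<bar>t\<bar>) / n t) * \<psi> x" for t x
  have \<gamma>v: "\<gamma> t = (\<lambda>x. (1 / n t) * v t x)" for t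
    by (rule ext) (simp add: \<gamma>_def v_def add_divide_distrib)
  have \<gamma>S: "\<gamma> t \<in> S_set p \<Omega>" if t: "t \<in> {-1..1}" for t
  proof -
    have "pnorm lborel p (\<gamma> t) = \<bar>1 / n t\<bar> * n t"
      unfolding \<gamma>v using pnorm_scaleR[OF p0(1), of lborel "1 / n t" "v t"] by (simp add: n_def)
    then have "pnorm lborel p (\<gamma> t) = 1" using npos[OF t] by simp
    moreover have "\<gamma> t \<in> X_space p \<Omega>"
      unfolding \<gamma>_def by (rule X_space_lincomb[OF p(1) \<phi>X \<psi>X \<Omega>(1)])
    ultimately show ?thesis by (simp add: S_set_iff[OF p0(1) \<Omega>(1)])
  qed
  have "continuous_map (top_of_set {-1..1}) (X_topology p s \<Omega>) \<gamma>"
    unfolding \<gamma>_def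
  proof (rule continuous_map_lincomb[OF p(1) s \<Omega>(1) \<phi>X \<psi>X])
    have nz: "\<forall>t\<in>{-1..1}. n t \<noteq> 0" using npos by force
    show "continuous_on {-1..1} (\<lambda>t. t / n t)" "continuous_on {-1..1} (\<lambda>t. (1 - \<bar>t\<bar>) / n t)"
      by (intro continuous_on_divide ncont nz continuous_intros)+
  qed
  then have cont: "continuous_map (top_of_set {-1..1}) (subtopology (X_topology p s \<Omega>) (S_set p \<Omega>)) \<gamma>"
    unfolding continuous_map_in_subtopology using \<gamma>S by auto
  have n1: "n (-1) = 1" "n 1 = 1"
  proof -
    have "n t = pnorm lborel p \<phi>" if "\<bar>t\<bar> = 1" for t
      unfolding n_def v_def by (rule pnorm_cong) (use that in \<open>simp add: abs_mult\<close>)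
    then show "n (-1) = 1" "n 1 = 1" using \<phi>1 by simp_all
  qed
  show thesis
  proof (rule that[OF d0, of \<gamma>])
    show "\<gamma> \<in> path_set p s \<Omega> \<phi>"
      unfolding path_set_def using cont by (simp add: \<gamma>_def n1)
    fix d t assume d: "d0 \<le> d" and t: "t \<in> {-1..1::real}"
    have "J p s \<theta> \<mu> \<Omega> d (\<gamma> t) \<le> (1 / n t) powr p * J p s \<theta> \<mu> \<Omega> d (v t)"
      unfolding \<gamma>v using npos[OF t] by (intro J_scale_le[OF vX p(1) s \<Omega>(1)]) simp
    also have "\<dots> \<le> (1 / n t) powr p * (\<Lambda> * n t powr p)"
      by (rule mult_left_mono[OF Jv[OF d t]]) simp
    also have "\<dots> = \<Lambda>" using npos[OF t] by (simp add: powr_divide)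
    finally show "J p s \<theta> \<mu> \<Omega> d (\<gamma> t) \<le> lambda1 p s \<theta> \<mu> \<Omega> + \<epsilon>" by (simp only: \<Lambda>_def)
  qed
qed

theorem theorem5p3:
  fixes p s \<theta> \<mu> :: real
    and \<Omega> :: "'a::euclidean_space set"
    and \<phi>\<^sub>1 :: "'a \<Rightarrow> real"
  assumes "0 < s" "s < 1" "1 < p" "p < real DIM('a)"
    and "s \<le> \<theta>" "\<theta> \<le> 1"
    and "open \<Omega>" "connected \<Omega>" "\<Omega> \<noteq> {}" "bounded \<Omega>"
    and "0 < \<mu>" "\<mu> < mu_zero DIM('a) p s \<theta>"
    and "first_eigenfunction p s \<theta> \<mu> \<Omega> \<phi>\<^sub>1"
  shows "((\<lambda>d. minimax_level p s \<theta> \<mu> \<Omega> \<phi>\<^sub>1 d) \<longlongrightarrow> lambda1 p s \<theta> \<mu> \<Omega>) at_top"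
proof (rule tendstoI)
  fix e :: real assume e: "0 < e"
  have \<theta>: "0 \<le> \<theta>" and \<mu>: "0 \<le> \<mu>" and e2: "0 < e / 2" using assms e by auto
  obtain d0 \<gamma> where d0: "0 \<le> d0" and \<gamma>: "\<gamma> \<in> path_set p s \<Omega> \<phi>\<^sub>1"
    and low: "\<And>d t. d0 \<le> d \<Longrightarrow> t \<in> {-1..1} \<Longrightarrow> J p s \<theta> \<mu> \<Omega> d (\<gamma> t) \<le> lambda1 p s \<theta> \<mu> \<Omega> + e / 2"
    using exists_low_path[OF assms(3,4,1,2) \<theta> \<mu> assms(7,9,13) e2] by blast
  have "dist (minimax_level p s \<theta> \<mu> \<Omega> \<phi>\<^sub>1 d) (lambda1 p s \<theta> \<mu> \<Omega>) < e" if d: "d0 \<le> d" for d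
  proof -
    have dn: "0 \<le> d" using d0 d by simp
    note ge = lambda1_le_SUP_path[OF assms(3,1,2,7) \<mu> dn assms(13)]
    have lower: "lambda1 p s \<theta> \<mu> \<Omega> \<le> minimax_level p s \<theta> \<mu> \<Omega> \<phi>\<^sub>1 d"
      unfolding minimax_level_def by (rule cINF_greatest) (use \<gamma> ge in auto)
    have "minimax_level p s \<theta> \<mu> \<Omega> \<phi>\<^sub>1 d \<le> (SUP u\<in>\<gamma> ` {-1..1}. J p s \<theta> \<mu> \<Omega> d u)"
      unfolding minimax_level_def by (rule cINF_lower[OF bdd_belowI2[OF ge] \<gamma>])
    also have "\<dots> \<le> lambda1 p s \<theta> \<mu> \<Omega> + e / 2"
      by (rule cSUP_least) (use low[OF d] in auto)
    finally show ?thesis using lower e by (simp add: dist_real_def)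
  qed
  then show "\<forall>\<^sub>F d in at_top. dist (minimax_level p s \<theta> \<mu> \<Omega> \<phi>\<^sub>1 d) (lambda1 p s \<theta> \<mu> \<Omega>) < e"
    by (rule eventually_mono[OF eventually_ge_at_top[of d0]])
qed

end
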